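(* Let $n\ge1$, let $\Omega\subset\mathbb{R}^n$ be a smooth bounded domain, $w\in L^2(\Omega)$, $p>1$, with $p<\frac{n+2}{n-2}$ when $n\ge3$, and let $L\ge1$. There exists $k_1(L)\ge k(L)$ such that for all $k\ge k_1(L)$, $z\in Z_k$ and $T\in\mathcal{C}_L(P_k,\overline\Omega)$ the function $u^T_{k,z}$ is a solution of the Dirichlet problem $$-\Delta u=|u|^{p-1}u+w\ \text{ in }T\left(\tfrac1kC_z\right),\qquad u=0\ \text{ on }\partial T\left(\tfrac1kC_z\right).$$
   Context: Energy: $E(u)=\frac12\int_\Omega|\nabla u|^2dx-\frac1{p+1}\int_\Omega|u|^{p+1}dx-\int_\Omega wu\,dx$ on $H^1_0(\Omega)$; for open $U\subset\Omega$, functions in $H^1_0(U)$ are extended by $0$ to $\Omega$. Solutions of Dirichlet problems on $U$ are weak solutions in $H^1_0(U)$. Cubes: $C_0=\{x\in\mathbb{R}^n: 0<x_i<1,\ i=1,\dots,n\}$, $C_z=z+C_0$ and $\sigma(z)=(-1)^{\sum_{i=1}^n z_i}$ for $z\in\mathbb{Z}^n$; for $k\in\mathbb{N}$, $Z_k=\{z\in\mathbb{Z}^n:\frac1kC_z\subset\Omega\}$ and $P_k=\bigcup_{z\in Z_k}\frac1k\overline{C}_z$. Fix $k_\Omega\in\mathbb{N}$ with $Z_k\ne\emptyset$ for all $k\ge k_\Omega$. Maps: for $L\ge1$ and $P,Q\subset\mathbb{R}^n$, $\mathcal{C}_L(P,Q)$ is the set of $T:P\to Q$ with $\frac1L|x-y|\le|T(x)-T(y)|\le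 L|x-y|$ for all $x,y\in P$. The functions $\tilde u^T_{k,z}$ and the number $k(L)$: for every $L\ge1$ there is (and we fix) $k(L)\ge k_\Omega$ such that for all $k\ge k(L)$, $z\in Z_k$, $T\in\mathcal{C}_L(P_k,\overline\Omega)$, the minimum of $E(u)$ over $u\in H^1_0(T(\frac1kC_z))$ with $\int_{T(\frac1kC_z)}|u|^{p+1}dx<1$ is achieved by a unique function $\tilde u^T_{k,z}$. The functions $u^T_{k,z}$: for such $k,z,T$ and $u\in H^1_0(T(\frac1kC_z))$ set $M(u)=\max\{E(\tilde u^T_{k,z}+t(u-\tilde u^T_{k,z})):t\ge0\}$. There exists (and we fix one) $u^T_{k,z}\in H^1_0(T(\frac1kC_z))$ with $u^T_{k,z}\not\equiv\tilde u^T_{k,z}$, $\sigma(z)[u^T_{k,z}-\tilde u^T_{k,z}]\ge0$ in $T(\frac1kC_z)$ and $E(u^T_{k,z})=M(u^T_{k,z})=\min\{M(u): u\in H^1_0(T(\frac1kC_z)),\ u\not\equiv\tilde u^T_{k,z},\ \sigma(z)[u-\tilde u^T_{k,z}]\ge0 \text{ in }T(\frac1kC_z)\}$. *)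

theory Defs
  imports "HOL-Analysis.Analysis"
begin

definition partial_deriv :: "'n::finite \<Rightarrow> (real^'n \<Rightarrow> real) \<Rightarrow> real^'n \<Rightarrow> real" where
  "partial_deriv i f x = frechet_derivative f (at x) (axis i 1)"

definition gradient :: "(real^'n \<Rightarrow> real) \<Rightarrow> real^'n \<Rightarrow> real^'n::finite" where
  "gradient f x = (\<chi> i. partial_deriv i f x)"

fun C_k :: "nat \<Rightarrow> (real^'n::finite \<Rightarrow> real) \<Rightarrow> bool" where
  "C_k 0 f \<longleftrightarrow> continuous_on UNIV f"
| "C_k (Suc m) f \<longleftrightarrow> (\<forall>x. f differentiable (at x)) \<and> (\<forall>i. C_k m (partial_deriv i f))"

definition smooth :: "(real^'n::finite \<Rightarrow> real) \<Rightarrow> bool" where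
  "smooth f \<longleftrightarrow> (\<forall>m. C_k m f)"

text \<open>
  Near each boundary point the domain lies strictly on one side of the graph of a smooth
  function over a coordinate hyperplane. A function of the \<open>n - 1\<close> variables other than
  \<open>x\<^sub>i\<close> is encoded as a function of \<open>x\<close> that does not depend on the \<open>i\<close>-th coordinate;
  the sign \<open>s\<close> says on which side of the graph the domain lies.
\<close>
definition smooth_boundary :: "(real^'n::finite) set \<Rightarrow> bool" where
  "smooth_boundary \<Omega> \<longleftrightarrow>
     (\<forall>x0 \<in> frontier \<Omega>. \<exists>r > 0. \<exists>i. \<exists>s \<in> {-1, 1::real}. \<exists>\<gamma>.
        smooth \<gamma> \<and>
        (\<forall>x y. (\<forall>j. j \<noteq> i \<longrightarrow> x $ j = y $ j) \<longrightarrow> \<gamma> x = \<gamma> y) \<and>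
        \<Omega> \<inter> ball x0 r = {x \<in> ball x0 r. s * x $ i > \<gamma> x})"

definition smooth_bounded_domain :: "(real^'n::finite) set \<Rightarrow> bool" where
  "smooth_bounded_domain \<Omega> \<longleftrightarrow>
     open \<Omega> \<and> connected \<Omega> \<and> \<Omega> \<noteq> {} \<and> bounded \<Omega> \<and> smooth_boundary \<Omega>"

text \<open>
  Elements of function spaces are represented by functions rather than by classes of almost
  everywhere equal functions; identities and inequalities between them are stated almost
  everywhere.
\<close>

definition L2 :: "(real^'n::finite) set \<Rightarrow> (real^'n \<Rightarrow> 'b::euclidean_space) set" where
  "L2 U = {f. f \<in> borel_measurable (lebesgue_on U) \<and>
              integrable (lebesgue_on U) (\<lambda>x. (norm (f x))\<^sup>2)}"

definition test_functions :: "(real^'n::finite) set \<Rightarrow> (real^'n \<Rightarrow> real) set" where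
  "test_functions U =
     {\<phi>. smooth \<phi> \<and> compact (closure {x. \<phi> x \<noteq> 0}) \<and> closure {x. \<phi> x \<noteq> 0} \<subseteq> U}"

definition is_weak_gradient ::
    "(real^'n::finite) set \<Rightarrow> (real^'n \<Rightarrow> real) \<Rightarrow> (real^'n \<Rightarrow> real^'n) \<Rightarrow> bool" where
  "is_weak_gradient U u g \<longleftrightarrow>
     u \<in> L2 U \<and> g \<in> L2 U \<and>
     (\<forall>\<phi> \<in> test_functions U. \<forall>i.
        (\<integral>x. u x * partial_deriv i \<phi> x \<partial>lebesgue_on U) = - (\<integral>x. g x $ i * \<phi> x \<partial>lebesgue_on U))"

definition H1 :: "(real^'n::finite) set \<Rightarrow> (real^'n \<Rightarrow> real) set" where
  "H1 U = {u. \<exists>g. is_weak_gradient U u g}"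

definition weak_gradient ::
    "(real^'n::finite) set \<Rightarrow> (real^'n \<Rightarrow> real) \<Rightarrow> real^'n \<Rightarrow> real^'n" where
  "weak_gradient U u = (SOME g. is_weak_gradient U u g)"

text \<open>
  The closure of the test functions in the norm of \<open>H1 U\<close>. The members are functions on the whole
  space that are \<open>0\<close> outside \<open>U\<close>, so that extension by \<open>0\<close> to a larger set is built in.
\<close>
definition H10 :: "(real^'n::finite) set \<Rightarrow> (real^'n \<Rightarrow> real) set" where
  "H10 U = {u \<in> H1 U. (\<forall>x. x \<notin> U \<longrightarrow> u x = 0) \<and>
     (\<exists>\<phi>::nat \<Rightarrow> real^'n \<Rightarrow> real. (\<forall>m. \<phi> m \<in> test_functions U) \<and>
        (\<lambda>m. (\<integral>x. (u x - \<phi> m x)\<^sup>2 \<partial>lebesgue_on U)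
            + (\<integral>x. (norm (weak_gradient U u x - gradient (\<phi> m) x))\<^sup>2 \<partial>lebesgue_on U))
          \<longlonglongrightarrow> 0)}"

text \<open>Weak solutions of \<open>- \<Delta>u = f\<close> in \<open>U\<close>, \<open>u = 0\<close> on the boundary of \<open>U\<close>.\<close>
definition weak_dirichlet_solution ::
    "(real^'n::finite) set \<Rightarrow> (real^'n \<Rightarrow> real) \<Rightarrow> (real^'n \<Rightarrow> real) \<Rightarrow> bool" where
  "weak_dirichlet_solution U f u \<longleftrightarrow>
     u \<in> H10 U \<and>
     (\<forall>v \<in> H10 U. integrable (lebesgue_on U) (\<lambda>x. f x * v x) \<and>
        (\<integral>x. weak_gradient U u x \<bullet> weak_gradient U v x \<partial>lebesgue_on U)
          = (\<integral>x. f x * v x \<partial>lebesgue_on U))"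

definition energy ::
    "(real^'n::finite) set \<Rightarrow> (real^'n \<Rightarrow> real) \<Rightarrow> real \<Rightarrow> (real^'n \<Rightarrow> real) \<Rightarrow> real" where
  "energy \<Omega> w p u =
     1 / 2 * (\<integral>x. (norm (weak_gradient \<Omega> u x))\<^sup>2 \<partial>lebesgue_on \<Omega>)
     - 1 / (p + 1) * (\<integral>x. \<bar>u x\<bar> powr (p + 1) \<partial>lebesgue_on \<Omega>)
     - (\<integral>x. w x * u x \<partial>lebesgue_on \<Omega>)"

definition small_functions :: "real \<Rightarrow> (real^'n::finite) set \<Rightarrow> (real^'n \<Rightarrow> real) set" where
  "small_functions p U = {u \<in> H10 U. (\<integral>x. \<bar>u x\<bar> powr (p + 1) \<partial>lebesgue_on U) < 1}"

definition unique_small_minimizer ::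
    "(real^'n::finite) set \<Rightarrow> (real^'n \<Rightarrow> real) \<Rightarrow> real \<Rightarrow> (real^'n) set \<Rightarrow> (real^'n \<Rightarrow> real) \<Rightarrow> bool"
  where
  "unique_small_minimizer \<Omega> w p U u \<longleftrightarrow>
     is_arg_min (energy \<Omega> w p) (\<lambda>v. v \<in> small_functions p U) u \<and>
     (\<forall>v. is_arg_min (energy \<Omega> w p) (\<lambda>v. v \<in> small_functions p U) v
        \<longrightarrow> (AE x in lebesgue_on U. v x = u x))"

definition ray_max ::
    "(real^'n::finite) set \<Rightarrow> (real^'n \<Rightarrow> real) \<Rightarrow> real \<Rightarrow> (real^'n \<Rightarrow> real) \<Rightarrow> (real^'n \<Rightarrow> real) \<Rightarrow> real"
  where
  "ray_max \<Omega> w p a u =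
     (GREATEST m. m \<in> {energy \<Omega> w p (\<lambda>x. a x + t * (u x - a x)) | t. t \<ge> 0})"

definition one_sided ::
    "(real^'n::finite) set \<Rightarrow> real \<Rightarrow> (real^'n \<Rightarrow> real) \<Rightarrow> (real^'n \<Rightarrow> real) set" where
  "one_sided U s a =
     {u \<in> H10 U. \<not> (AE x in lebesgue_on U. u x = a x) \<and>
                 (AE x in lebesgue_on U. s * (u x - a x) \<ge> 0)}"

definition one_sided_minimax ::
    "(real^'n::finite) set \<Rightarrow> (real^'n \<Rightarrow> real) \<Rightarrow> real \<Rightarrow> (real^'n) set \<Rightarrow> real
      \<Rightarrow> (real^'n \<Rightarrow> real) \<Rightarrow> (real^'n \<Rightarrow> real) \<Rightarrow> bool" where
  "one_sided_minimax \<Omega> w p U s a u \<longleftrightarrow>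
     is_arg_min (ray_max \<Omega> w p a) (\<lambda>v. v \<in> one_sided U s a) u \<and>
     energy \<Omega> w p u = ray_max \<Omega> w p a u"

definition cube :: "int^'n \<Rightarrow> (real^'n::finite) set" where
  "cube z = (\<lambda>x. (\<chi> i. of_int (z $ i)) + x) ` {x. \<forall>i. 0 < x $ i \<and> x $ i < 1}"

definition scaled_cube :: "nat \<Rightarrow> int^'n \<Rightarrow> (real^'n::finite) set" where
  "scaled_cube k z = (\<lambda>x. (1 / real k) *\<^sub>R x) ` cube z"

definition cube_sign :: "int^'n::finite \<Rightarrow> real" where
  "cube_sign z = (-1) powi (\<Sum>i\<in>UNIV. z $ i)"

definition cube_indices :: "(real^'n::finite) set \<Rightarrow> nat \<Rightarrow> (int^'n) set" where
  "cube_indices \<Omega> k = {z. scaled_cube k z \<subseteq> \<Omega>}"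

definition cube_union :: "(real^'n::finite) set \<Rightarrow> nat \<Rightarrow> (real^'n) set" where
  "cube_union \<Omega> k = (\<Union>z \<in> cube_indices \<Omega> k. (\<lambda>x. (1 / real k) *\<^sub>R x) ` closure (cube z))"

text \<open>Extensional functions, so that a map is determined by its values on \<open>P\<close>.\<close>
definition bilipschitz_maps ::
    "real \<Rightarrow> (real^'n::finite) set \<Rightarrow> (real^'n) set \<Rightarrow> (real^'n \<Rightarrow> real^'n) set" where
  "bilipschitz_maps L P Q =
     {T \<in> P \<rightarrow>\<^sub>E Q. \<forall>x \<in> P. \<forall>y \<in> P.
        1 / L * norm (x - y) \<le> norm (T x - T y) \<and> norm (T x - T y) \<le> L * norm (x - y)}"

end

theory Submission
  imports Defs
begin

text \<open>
  Put \<open>a = \<close> the small minimizer, \<open>d = u - a\<close> and \<open>s = \<plusminus>1\<close> the sign of the cube. Since \<open>a\<close> is a critical point,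
  the energy of \<open>a + t d\<close> minus that of \<open>a\<close> is \<open>t\<^sup>2/2 \<integral> \<bar>\<nabla>d\<bar>\<^sup>2 - \<integral> r(a, t d)\<close>, where \<open>r\<close> is the convexity
  remainder of \<open>\<bar>x\<bar>\<^sup>p\<^sup>+\<^sup>1 / (p + 1)\<close>. The images of the cubes have small diameter, hence small Sobolev constant for the
  subcritical exponent \<open>p + 1\<close>, and this makes the maximum of the energy on every ray unique.

  Let \<open>v\<close> be an arbitrary direction. The constraint \<open>s d \<ge> 0\<close> does not interfere with the variation \<open>d + \<epsilon> s v\<close>: truncating
  \<open>s d + \<epsilon> v\<close> at \<open>0\<close> yields an admissible competitor, the truncation does not increase the Dirichlet
  integral, and the remaining terms change in the favourable direction because \<open>s (\<bar>a + d\<bar>\<^sup>p\<^sup>-\<^sup>1 (a + d) - \<bar>a\<bar>\<^sup>p\<^sup>-\<^sup>1 a) \<ge> 0\<close>.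
  As the ray maxima of the competitors converge to the unique one on the ray of \<open>d\<close>, minimality gives the
  Euler--Lagrange inequality for \<open>v\<close>, and that for \<open>- v\<close> gives the equation.
\<close>

section \<open>Smooth functions\<close>

text \<open>Minimality compares only the maxima over whole rays, so a competitor is seen at its own
  maximum point \<open>t\<close>, about which nothing is known in advance. A bound on
  \<open>t\<close> uniform in the competitors gives convergent subsequences, and uniqueness of the
  maximum on the ray of \<open>d\<close> forces the limit \<open>1\<close>. The truncation has to
  stay in the closure of the test functions, hence a smooth function in place of the positive part,
  with parameter \<open>\<epsilon>\<^sup>2\<close> so that its error is of lower order than the
  variation. Smallness comes from the factor \<open>R powr (1 - \<alpha>)\<close>, with
  \<open>\<alpha> = n (1/2 - 1/(p + 1))\<close>, in the Sobolev constant of a set of diameter below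
  \<open>R\<close>; the condition \<open>\<alpha> < 1\<close> is exactly subcriticality. Two
  features of the setting also have to be dealt with: \<open>weak_gradient\<close> is a choice, so
  uniqueness almost everywhere must be proved; and \<open>T\<close> maps into the closure of the
  domain, whereas energies are integrals over the domain, which is where the one-sided smooth
  boundary enters.\<close>

lemma partial_deriv_eq:
  assumes "(f has_derivative f') (at x)"
  shows "partial_deriv i f x = f' (axis i 1)"
  unfolding partial_deriv_def frechet_derivative_at[OF assms, symmetric] ..

lemma C_k_Suc_imp: "C_k (Suc m) f \<Longrightarrow> C_k m f"
proof (induction m arbitrary: f)
  case 0
  then show ?case by (auto intro!: differentiable_imp_continuous_on simp: differentiable_on_def
        intro: differentiable_at_withinI)
next
  case (Suc m)
  then show ?case by (metis C_k.simps(2))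
qed

lemma smooth_differentiable: "smooth f \<Longrightarrow> f differentiable (at x)"
  unfolding smooth_def by (metis C_k.simps(2))

lemma smooth_partial_deriv: "smooth f \<Longrightarrow> smooth (partial_deriv i f)"
  unfolding smooth_def by (metis C_k.simps(2))

lemma smooth_continuous: "smooth f \<Longrightarrow> continuous_on UNIV f"
  unfolding smooth_def by (metis C_k.simps(1))

lemma smooth_has_derivative:
  fixes f :: "real^'n::finite \<Rightarrow> real"
  assumes "smooth f"
  shows "(f has_derivative (\<lambda>h. gradient f x \<bullet> h)) (at x)"
proof -
  have d: "(f has_derivative frechet_derivative f (at x)) (at x)"
    using smooth_differentiable[OF assms] frechet_derivative_works by blast
  interpret bounded_linear "frechet_derivative f (at x)"
    using d has_derivative_bounded_linear by blast
  have "frechet_derivative f (at x) h = gradient f x \<bullet> h" for h :: "real^'n"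
  proof -
    have "frechet_derivative f (at x) h = frechet_derivative f (at x) (\<Sum>i\<in>UNIV. h $ i *\<^sub>R axis i 1)"
      using basis_expansion[of h] by (simp add: scalar_mult_eq_scaleR)
    also have "\<dots> = gradient f x \<bullet> h"
      by (simp add: sum scale inner_vec_def gradient_def partial_deriv_def mult.commute)
    finally show ?thesis .
  qed
  then have "frechet_derivative f (at x) = (\<lambda>h. gradient f x \<bullet> h)" by auto
  with d show ?thesis by simp
qed

lemma continuous_on_gradient: "smooth f \<Longrightarrow> continuous_on UNIV (gradient f)"
  unfolding gradient_def
  by (intro continuous_on_vec_lambda) (simp add: smooth_continuous smooth_partial_deriv)

lemma gradient_eqI:
  assumes "(f has_derivative (\<lambda>h. v \<bullet> h)) (at x)"
  shows "gradient f x = v"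
  unfolding gradient_def using partial_deriv_eq[OF assms] by (simp add: vec_eq_iff inner_axis)

section \<open>Algebra and composition of smooth functions\<close>

lemma C_k_const: "C_k m (\<lambda>x::real^'n::finite. c)"
proof (induction m arbitrary: c)
  case (Suc m)
  have "partial_deriv i (\<lambda>x::real^'n. c) = (\<lambda>x. 0)" for i
    using partial_deriv_eq[of "\<lambda>x::real^'n. c" "\<lambda>x. 0"] by (auto simp: fun_eq_iff)
  with Suc show ?case by simp
qed simp

lemma C_k_add:
  fixes f g :: "real^'n::finite \<Rightarrow> real"
  assumes "C_k m f" "C_k m g"
  shows "C_k m (\<lambda>x. f x + g x)"
  using assms
proof (induction m arbitrary: f g)
  case (Suc m)
  have "partial_deriv i (\<lambda>x. f x + g x) = (\<lambda>x. partial_deriv i f x + partial_deriv i g x)" for i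
  proof
    fix x
    have "(f has_derivative frechet_derivative f (at x)) (at x)"
      "(g has_derivative frechet_derivative g (at x)) (at x)"
      using Suc.prems by (simp_all flip: frechet_derivative_works)
    from has_derivative_add[OF this]
    show "partial_deriv i (\<lambda>x. f x + g x) x = partial_deriv i f x + partial_deriv i g x"
      by (simp add: partial_deriv_eq partial_deriv_def[of _ f] partial_deriv_def[of _ g])
  qed
  with Suc show ?case by simp
qed (auto intro: continuous_intros)

lemma C_k_mult:
  fixes f g :: "real^'n::finite \<Rightarrow> real"
  assumes "C_k m f" "C_k m g"
  shows "C_k m (\<lambda>x. f x * g x)"
  using assms
proof (induction m arbitrary: f g)
  case (Suc m)
  have "partial_deriv i (\<lambda>x. f x * g x)
      = (\<lambda>x. f x * partial_deriv i g x + partial_deriv i f x * g x)" for i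
  proof
    fix x
    have "(f has_derivative frechet_derivative f (at x)) (at x)"
      "(g has_derivative frechet_derivative g (at x)) (at x)"
      using Suc.prems by (simp_all flip: frechet_derivative_works)
    from has_derivative_mult[OF this]
    show "partial_deriv i (\<lambda>x. f x * g x) x = f x * partial_deriv i g x + partial_deriv i f x * g x"
      by (simp add: partial_deriv_eq partial_deriv_def[of _ f] partial_deriv_def[of _ g])
  qed
  moreover have "C_k m (\<lambda>x. f x * partial_deriv i g x + partial_deriv i f x * g x)" for i
    using Suc.prems C_k_Suc_imp[OF Suc.prems(1)] C_k_Suc_imp[OF Suc.prems(2)]
    by (intro C_k_add Suc.IH) auto
  ultimately show ?case using Suc.prems by simp
qed (auto intro: continuous_intros)

text \<open>The chain rule replaces \<open>f\<close> by its derivative, so an induction for a single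
  \<open>f\<close> would not close; over a class \<open>F\<close> closed under differentiation it
  does.\<close>

lemma C_k_compose:
  fixes g :: "real^'n::finite \<Rightarrow> real"
  assumes F: "\<And>f. f \<in> F \<Longrightarrow> \<exists>f'\<in>F. \<forall>s. (f has_real_derivative f' s) (at s)"
    and "f \<in> F" "C_k m g"
  shows "C_k m (\<lambda>x. f (g x))"
  using assms(2,3)
proof (induction m arbitrary: f)
  case 0
  obtain f' where "\<forall>s. (f has_real_derivative f' s) (at s)" using F 0 by blast
  then have "continuous_on UNIV f"
    by (auto intro: DERIV_continuous_on has_field_derivative_at_within)
  with 0 show ?case by (auto intro: continuous_on_compose2)
next
  case (Suc m)
  obtain f' where f': "f' \<in> F" "\<And>s. (f has_real_derivative f' s) (at s)" using F Suc by blast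
  have d: "((\<lambda>x. f (g x)) has_derivative (\<lambda>h. frechet_derivative g (at x) h * f' (g x))) (at x)" for x
    using Suc.prems frechet_derivative_works f'(2)
    by (intro DERIV_compose_FDERIV) auto
  have "partial_deriv i (\<lambda>x. f (g x)) = (\<lambda>x. partial_deriv i g x * f' (g x))" for i
    using partial_deriv_eq[OF d] by (auto simp: partial_deriv_def[of _ g])
  moreover have "C_k m (\<lambda>x. partial_deriv i g x * f' (g x))" for i
    using Suc f' C_k_Suc_imp[OF Suc.prems(2)] by (intro C_k_mult) auto
  moreover have "(\<lambda>x. f (g x)) differentiable (at x)" for x
    using d differentiableI by blast
  ultimately show ?case by simp
qed

lemma smooth_const: "smooth (\<lambda>x::real^'n::finite. c)"
  by (simp add: smooth_def C_k_const)

lemma smooth_add: "smooth f \<Longrightarrow> smooth g \<Longrightarrow> smooth (\<lambda>x::real^'n::finite. f x + g x)"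
  by (simp add: smooth_def C_k_add)

lemma smooth_mult: "smooth f \<Longrightarrow> smooth g \<Longrightarrow> smooth (\<lambda>x::real^'n::finite. f x * g x)"
  by (simp add: smooth_def C_k_mult)

lemma smooth_prod:
  assumes "finite A" "\<And>a. a \<in> A \<Longrightarrow> smooth (f a)"
  shows "smooth (\<lambda>x::real^'n::finite. \<Prod>a\<in>A. f a x)"
  using assms by (induction A) (auto intro: smooth_const smooth_mult)

lemma smooth_component: "smooth (\<lambda>x::real^'n::finite. x $ i)"
proof -
  have "C_k m (\<lambda>x::real^'n. x $ i)" for m
  proof (cases m)
    case (Suc k)
    have d: "((\<lambda>x::real^'n. x $ i) has_derivative (\<lambda>h. h $ i)) (at x)" for x
      by (rule bounded_linear.has_derivative[OF bounded_linear_vec_nth]) simp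
    have "partial_deriv j (\<lambda>x::real^'n. x $ i) = (\<lambda>x. axis j 1 $ i)" for j
      using partial_deriv_eq[OF d] by (auto simp: fun_eq_iff)
    with Suc d show ?thesis by (auto simp: C_k_const intro: differentiableI)
  qed (auto intro: continuous_intros)
  then show ?thesis by (simp add: smooth_def)
qed

text \<open>The extra factor \<open>s\<close> makes the right difference quotient at
  \<open>0\<close> equal to \<open>poly P (1 / h) * exp (- \<delta> / h)\<close>, which tends to
  \<open>0\<close>. The class is closed under differentiation and contains \<open>soft_pos\<close>,
  its derivative and the factors of the box bumps, so \<open>C_k_compose\<close> yields their
  smoothness.\<close>

definition exp_class :: "real \<Rightarrow> (real \<Rightarrow> real) set" where
  "exp_class \<delta> = range (\<lambda>P s. if s > 0 then s * poly P (1 / s) * exp (- \<delta> / s) else 0)"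

lemma poly_exp_tendsto_0:
  fixes P :: "real poly"
  assumes "\<delta> > 0"
  shows "((\<lambda>y. poly P y * exp (- \<delta> * y)) \<longlongrightarrow> 0) at_top"
proof -
  have pe: "((\<lambda>y::real. y ^ k * exp (- \<delta> * y)) \<longlongrightarrow> 0) at_top" for k
  proof -
    have "((\<lambda>y::real. (1 / \<delta>) ^ k * ((\<delta> * y) ^ k / exp (\<delta> * y))) \<longlongrightarrow> (1 / \<delta>) ^ k * 0) at_top"
      using assms by (intro tendsto_mult tendsto_const filterlim_compose[OF tendsto_power_div_exp_0]
          filterlim_tendsto_pos_mult_at_top[OF tendsto_const _ filterlim_ident])
    then show ?thesis using assms by (simp add: power_mult_distrib exp_minus field_simps)
  qed
  have "((\<lambda>y. \<Sum>i\<le>degree P. coeff P i * (y ^ i * exp (- \<delta> * y))) \<longlongrightarrow> (\<Sum>i\<le>degree P. coeff P i * 0)) at_top"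
    by (intro tendsto_sum tendsto_mult tendsto_const pe)
  then show ?thesis by (simp add: poly_altdef sum_distrib_right mult.assoc)
qed

lemma exp_class_closed:
  assumes \<delta>: "\<delta> > 0" and f: "f \<in> exp_class \<delta>"
  shows "\<exists>f'\<in>exp_class \<delta>. \<forall>s. (f has_real_derivative f' s) (at s)"
proof -
  obtain P where f: "f = (\<lambda>s. if s > 0 then s * poly P (1 / s) * exp (- \<delta> / s) else 0)"
    using f by (auto simp: exp_class_def)
  \<comment> \<open>With \<open>y = 1 / s\<close> the derivative of
    \<open>s P(y) exp (- \<delta> y)\<close> is
    \<open>(P - y P' + \<delta> y P) exp (- \<delta> y)\<close>. Writing the bracket as
    \<open>s Q(y)\<close> again multiplies it by \<open>y\<close>.\<close>
  define Q where "Q = [:0, 1:] * P - [:0, 0, 1:] * pderiv P + [:0, 0, \<delta>:] * P"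
  define f' where "f' = (\<lambda>s::real. if s > 0 then s * poly Q (1 / s) * exp (- \<delta> / s) else 0)"
  have "(f has_real_derivative f' s) (at s)" for s
  proof -
    consider "s > 0" | "s < 0" | "s = 0" by linarith
    then show ?thesis
    proof cases
      case 1
      have d: "((\<lambda>s. s * poly P (1 / s) * exp (- \<delta> / s)) has_real_derivative f' s) (at s)"
      proof -
        have "((\<lambda>s. poly P (1 / s)) has_real_derivative poly (pderiv P) (1 / s) * (- 1 / s\<^sup>2)) (at s)"
          by (rule DERIV_chain2[OF poly_DERIV])
            (use 1 in \<open>auto intro!: derivative_eq_intros simp: power2_eq_square\<close>)
        moreover have "((\<lambda>s. exp (- \<delta> / s)) has_real_derivative exp (- \<delta> / s) * (\<delta> / s\<^sup>2)) (at s)"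
          using 1 by (auto intro!: derivative_eq_intros simp: power2_eq_square)
        ultimately have "((\<lambda>s. s * poly P (1 / s) * exp (- \<delta> / s)) has_real_derivative
            (1 * poly P (1 / s) + poly (pderiv P) (1 / s) * (- 1 / s\<^sup>2) * s) * exp (- \<delta> / s)
            + exp (- \<delta> / s) * (\<delta> / s\<^sup>2) * (s * poly P (1 / s))) (at s)"
          by (intro DERIV_mult DERIV_ident)
        then show ?thesis
          by (rule DERIV_cong) (use 1 in \<open>simp add: f'_def Q_def field_simps power2_eq_square\<close>)
      qed
      show ?thesis
        by (rule has_field_derivative_transform_within_open[OF d, of "{0<..}"]) (use 1 f in auto)
    next
      case 2
      have d: "((\<lambda>s. 0) has_real_derivative f' s) (at s)" using 2 by (simp add: f'_def)
      show ?thesis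
        by (rule has_field_derivative_transform_within_open[OF d, of "{..<0}"]) (use 2 f in auto)
    next
      case 3
      have "((\<lambda>y. poly P y * exp (- \<delta> * y)) \<longlongrightarrow> 0) at_top"
        by (rule poly_exp_tendsto_0[OF \<delta>])
      then have "((\<lambda>h. poly P (inverse h) * exp (- \<delta> * inverse h)) \<longlongrightarrow> 0) (at_right 0)"
        by (rule filterlim_compose) (rule filterlim_inverse_at_top_right)
      then have r: "((\<lambda>h. f h / h) \<longlongrightarrow> 0) (at_right 0)"
        by (rule Lim_transform_eventually)
          (auto simp: f eventually_at_right_field divide_inverse intro!: exI[of _ 1])
      have l: "((\<lambda>h. f h / h) \<longlongrightarrow> 0) (at_left 0)"
        by (rule Lim_transform_eventually[OF tendsto_const])
          (auto simp: f eventually_at_left_field intro!: exI[of _ "-1"])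
      have "((\<lambda>h. f h / h) \<longlongrightarrow> 0) (at 0)" by (rule filterlim_split_at[OF l r])
      then show ?thesis using 3 by (simp add: has_field_derivative_iff f'_def f)
    qed
  qed
  moreover have "f' \<in> exp_class \<delta>" by (auto simp: f'_def exp_class_def)
  ultimately show ?thesis by blast
qed

lemma smooth_exp_class:
  fixes g :: "real^'n::finite \<Rightarrow> real"
  assumes "\<delta> > 0" "f \<in> exp_class \<delta>" "smooth g"
  shows "smooth (\<lambda>x. f (g x))"
  using C_k_compose[of "exp_class \<delta>" f _ g] exp_class_closed assms by (simp add: smooth_def)

text \<open>A smooth substitute for the positive part: it differs from \<open>max s 0\<close> by at most \<open>\<delta>\<close>, and its slope
  stays between \<open>0\<close> and \<open>1\<close> because \<open>1 + x \<le> exp x\<close>.\<close>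
definition soft_pos :: "real \<Rightarrow> real \<Rightarrow> real" where
  "soft_pos \<delta> s = (if s > 0 then s * exp (- \<delta> / s) else 0)"

definition soft_pos' :: "real \<Rightarrow> real \<Rightarrow> real" where
  "soft_pos' \<delta> s = (if s > 0 then (1 + \<delta> / s) * exp (- \<delta> / s) else 0)"

lemma soft_pos_mem: "soft_pos \<delta> \<in> exp_class \<delta>"
  unfolding exp_class_def soft_pos_def by (rule image_eqI[of _ _ 1]) auto

lemma soft_pos'_mem: "soft_pos' \<delta> \<in> exp_class \<delta>"
  unfolding exp_class_def soft_pos'_def
  by (rule image_eqI[of _ _ "[:0,1,\<delta>:]"]) (auto simp: fun_eq_iff field_simps)

lemma smooth_soft_pos: "\<delta> > 0 \<Longrightarrow> smooth g \<Longrightarrow> smooth (\<lambda>x. soft_pos \<delta> (g x))"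
  by (rule smooth_exp_class[OF _ soft_pos_mem])

lemma continuous_soft_pos':
  assumes "\<delta> > 0"
  shows "continuous_on UNIV (soft_pos' \<delta>)"
proof -
  obtain f' where "\<forall>s. (soft_pos' \<delta> has_real_derivative f' s) (at s)"
    using exp_class_closed[OF assms soft_pos'_mem] by blast
  then show ?thesis
    by (auto intro: DERIV_continuous_on has_field_derivative_at_within)
qed

lemma soft_pos_deriv:
  assumes "\<delta> > 0"
  shows "(soft_pos \<delta> has_real_derivative soft_pos' \<delta> s) (at s)"
proof -
  obtain f' where f': "f' \<in> exp_class \<delta>" "\<And>s. (soft_pos \<delta> has_real_derivative f' s) (at s)"
    using exp_class_closed[OF assms soft_pos_mem] by blast
  have "f' s = soft_pos' \<delta> s"
  proof (cases "s > 0")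
    case True
    have d: "((\<lambda>s. s * exp (- \<delta> / s)) has_real_derivative soft_pos' \<delta> s) (at s)"
      using True by (auto intro!: derivative_eq_intros simp: soft_pos'_def field_simps power2_eq_square)
    have "(soft_pos \<delta> has_real_derivative soft_pos' \<delta> s) (at s)"
      by (rule has_field_derivative_transform_within_open[OF d, of "{0<..}"])
        (use True in \<open>auto simp: soft_pos_def\<close>)
    then show ?thesis using f' DERIV_unique by blast
  next
    \<comment> \<open>All members of \<open>exp_class\<close> vanish on \<open>s \<le> 0\<close>, so
      the derivative supplied by \<open>exp_class_closed\<close> is \<open>0\<close> there,
      including at \<open>s = 0\<close>.\<close>
    case False
    then show ?thesis using f'(1) by (auto simp: exp_class_def soft_pos'_def)
  qed
  with f'(2)[of s] show ?thesis by simp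
qed

lemma soft_pos'_bounds:
  assumes "\<delta> > 0"
  shows "0 \<le> soft_pos' \<delta> s" "soft_pos' \<delta> s \<le> 1"
proof -
  show "0 \<le> soft_pos' \<delta> s" using assms by (simp add: soft_pos'_def)
  have "s > 0 \<Longrightarrow> (1 + \<delta> / s) * exp (- \<delta> / s) \<le> exp (\<delta> / s) * exp (- \<delta> / s)"
    using exp_ge_add_one_self by (intro mult_right_mono) auto
  then show "soft_pos' \<delta> s \<le> 1" by (simp add: soft_pos'_def flip: exp_add)
qed

lemma soft_pos_bounds:
  assumes "\<delta> > 0"
  shows "0 \<le> soft_pos \<delta> s" "s - \<delta> \<le> soft_pos \<delta> s" "soft_pos \<delta> s \<le> max s 0"
proof -
  show "0 \<le> soft_pos \<delta> s" using assms by (simp add: soft_pos_def)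
  show "soft_pos \<delta> s \<le> max s 0" using assms
    by (simp add: soft_pos_def mult_le_cancel_left1)
  show "s - \<delta> \<le> soft_pos \<delta> s"
  proof (cases "s > 0")
    case True
    have "s - \<delta> = s * (1 + (- \<delta> / s))" using True by (simp add: field_simps)
    also have "\<dots> \<le> s * exp (- \<delta> / s)"
      using True by (intro mult_left_mono exp_ge_add_one_self) auto
    finally show ?thesis using True by (simp add: soft_pos_def)
  qed (use assms in \<open>simp add: soft_pos_def\<close>)
qed

lemma soft_pos_lipschitz:
  assumes "\<delta> > 0"
  shows "\<bar>soft_pos \<delta> s - soft_pos \<delta> t\<bar> \<le> \<bar>s - t\<bar>"
proof -
  have "\<bar>soft_pos \<delta> s - soft_pos \<delta> t\<bar> \<le> \<bar>s - t\<bar>" if "s < t" for s t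
  proof -
    have "\<exists>z>s. z < t \<and> soft_pos \<delta> t - soft_pos \<delta> s = (t - s) * soft_pos' \<delta> z"
      by (rule MVT2[OF that]) (rule soft_pos_deriv[OF assms])
    then obtain z where "soft_pos \<delta> t - soft_pos \<delta> s = (t - s) * soft_pos' \<delta> z" by blast
    moreover have "\<bar>(t - s) * soft_pos' \<delta> z\<bar> \<le> \<bar>t - s\<bar> * 1"
      unfolding abs_mult using soft_pos'_bounds[OF assms, of z] by (intro mult_left_mono) auto
    ultimately show ?thesis by (simp add: abs_minus_commute)
  qed
  from this[of s t] this[of t s] show ?thesis by (cases s t rule: linorder_cases) auto
qed

text \<open>For fixed \<open>c\<close> and \<open>d\<close> the product tends to the indicator
  function of the open box as \<open>m\<close> tends to \<open>0\<close>; it supplies the test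
  functions of \<open>integral_box_zero\<close>.\<close>

lemma smooth_box_bump:
  fixes c d :: "real^'n::finite"
  assumes "m > 0"
  defines "\<zeta> \<equiv> \<lambda>i s. if c $ i < s \<and> s < d $ i then exp (- m / (s - c $ i)) * exp (- m / (d $ i - s)) else 0"
  shows "smooth (\<lambda>x. \<Prod>i\<in>UNIV. \<zeta> i (x $ i))"
proof (rule smooth_prod)
  fix i
  define e where "e = (\<lambda>s::real. if s > 0 then exp (- m / s) else 0)"
  have e: "e \<in> exp_class m"
    unfolding exp_class_def e_def by (rule image_eqI[of _ _ "[:0,1:]"]) (auto simp: fun_eq_iff)
  have a: "smooth (\<lambda>x::real^'n. x $ i + - c $ i)" "smooth (\<lambda>x::real^'n. d $ i + (-1) * x $ i)"
    by (intro smooth_add smooth_mult smooth_component smooth_const)+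
  have "smooth (\<lambda>x::real^'n. e (x $ i + - c $ i) * e (d $ i + (-1) * x $ i))"
    by (intro smooth_mult smooth_exp_class[OF assms(1) e] a)
  then show "smooth (\<lambda>x. \<zeta> i (x $ i))"
    by (rule back_subst[of smooth]) (auto simp: \<zeta>_def e_def fun_eq_iff)
qed simp

section \<open>Square integrable functions\<close>

lemma integrable_inner_L2:
  fixes f g :: "'a \<Rightarrow> 'b::euclidean_space"
  assumes "f \<in> borel_measurable M" "g \<in> borel_measurable M"
    "integrable M (\<lambda>x. (norm (f x))\<^sup>2)" "integrable M (\<lambda>x. (norm (g x))\<^sup>2)"
  shows "integrable M (\<lambda>x. f x \<bullet> g x)"
proof (rule Bochner_Integration.integrable_bound)
  show "integrable M (\<lambda>x. (norm (f x))\<^sup>2 + (norm (g x))\<^sup>2)" using assms by simp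
  show "AE x in M. norm (f x \<bullet> g x) \<le> norm ((norm (f x))\<^sup>2 + (norm (g x))\<^sup>2)"
  proof (intro AE_I2)
    fix x
    have "norm (f x \<bullet> g x) \<le> norm (f x) * norm (g x)" using Cauchy_Schwarz_ineq2 by simp
    also have "\<dots> \<le> (norm (f x))\<^sup>2 + (norm (g x))\<^sup>2"
      using sum_squares_bound[of "norm (f x)" "norm (g x)"] mult_nonneg_nonneg[of "norm (f x)" "norm (g x)"]
        norm_ge_zero[of "f x"] norm_ge_zero[of "g x"] by linarith
    finally show "norm (f x \<bullet> g x) \<le> norm ((norm (f x))\<^sup>2 + (norm (g x))\<^sup>2)" by simp
  qed
qed (use assms in measurable)

lemma norm_lincomb_squared:
  fixes x y :: "'b::real_inner"
  shows "(norm (a *\<^sub>R x + b *\<^sub>R y))\<^sup>2 = a\<^sup>2 * (norm x)\<^sup>2 + 2 * a * b * (x \<bullet> y) + b\<^sup>2 * (norm y)\<^sup>2"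
  unfolding power2_norm_eq_inner by (simp add: algebra_simps inner_commute power2_eq_square)

lemma integrable_lincomb_L2:
  fixes f g :: "'a \<Rightarrow> 'b::euclidean_space"
  assumes "f \<in> borel_measurable M" "g \<in> borel_measurable M"
    "integrable M (\<lambda>x. (norm (f x))\<^sup>2)" "integrable M (\<lambda>x. (norm (g x))\<^sup>2)"
  shows "integrable M (\<lambda>x. (norm (a *\<^sub>R f x + b *\<^sub>R g x))\<^sup>2)"
  unfolding norm_lincomb_squared
  using assms integrable_inner_L2[OF assms] by simp

lemma integral_lincomb_L2:
  fixes f g :: "'a \<Rightarrow> 'b::euclidean_space"
  assumes "f \<in> borel_measurable M" "g \<in> borel_measurable M"
    "integrable M (\<lambda>x. (norm (f x))\<^sup>2)" "integrable M (\<lambda>x. (norm (g x))\<^sup>2)"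
  shows "(\<integral>x. (norm (a *\<^sub>R f x + b *\<^sub>R g x))\<^sup>2 \<partial>M)
    = a\<^sup>2 * (\<integral>x. (norm (f x))\<^sup>2 \<partial>M) + 2 * a * b * (\<integral>x. f x \<bullet> g x \<partial>M) + b\<^sup>2 * (\<integral>x. (norm (g x))\<^sup>2 \<partial>M)"
  unfolding norm_lincomb_squared
  using assms integrable_inner_L2[OF assms] by simp

lemma Cauchy_Schwarz_integral:
  fixes f g :: "'a \<Rightarrow> 'b::euclidean_space"
  assumes "f \<in> borel_measurable M" "g \<in> borel_measurable M"
    "integrable M (\<lambda>x. (norm (f x))\<^sup>2)" "integrable M (\<lambda>x. (norm (g x))\<^sup>2)"
  shows "(\<integral>x. f x \<bullet> g x \<partial>M)\<^sup>2 \<le> (\<integral>x. (norm (f x))\<^sup>2 \<partial>M) * (\<integral>x. (norm (g x))\<^sup>2 \<partial>M)"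
proof -
  define A B I where "A = (\<integral>x. (norm (f x))\<^sup>2 \<partial>M)" and "B = (\<integral>x. (norm (g x))\<^sup>2 \<partial>M)"
    and "I = (\<integral>x. f x \<bullet> g x \<partial>M)"
  have q: "0 \<le> a\<^sup>2 * A + 2 * a * b * I + b\<^sup>2 * B" for a b
    unfolding A_def B_def I_def integral_lincomb_L2[OF assms, symmetric] by simp
  have AB: "A \<ge> 0" "B \<ge> 0" by (simp_all add: A_def B_def)
  show ?thesis unfolding A_def[symmetric] B_def[symmetric] I_def[symmetric]
  proof (cases "B = 0")
    case True
    have "I = 0"
    proof (rule ccontr)
      assume "I \<noteq> 0"
      \<comment> \<open>For \<open>B = 0\<close> and \<open>a = 1\<close> the quadratic form is
        \<open>A + 2 b I\<close>, and this \<open>b\<close> gives it the value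
        \<open>-1\<close>.\<close>
      then show False using q[of 1 "- (A + 1) / (2 * I)"] True AB by (simp add: field_simps)
    qed
    then show "I\<^sup>2 \<le> A * B" using True by simp
  next
    case False
    with AB have "B > 0" by simp
    have "0 \<le> B * (A * B - I\<^sup>2)"
      \<comment> \<open>The form at \<open>(B, - I)\<close> is
        \<open>B\<^sup>2 A - 2 B I\<^sup>2 + I\<^sup>2 B\<close>, that is, \<open>B\<close> times
        the discriminant.\<close>
      using q[of B "- I"] by (simp add: algebra_simps power2_eq_square)
    with \<open>B > 0\<close> show "I\<^sup>2 \<le> A * B" by (simp add: zero_le_mult_iff)
  qed
qed

lemma tendsto_integral_inner_L2:
  fixes f g :: "'a \<Rightarrow> 'b::euclidean_space" and F :: "nat \<Rightarrow> 'a \<Rightarrow> 'b"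
  assumes "f \<in> borel_measurable M" "g \<in> borel_measurable M" "\<And>m. F m \<in> borel_measurable M"
    and "integrable M (\<lambda>x. (norm (f x))\<^sup>2)" "integrable M (\<lambda>x. (norm (g x))\<^sup>2)"
      "\<And>m. integrable M (\<lambda>x. (norm (F m x))\<^sup>2)"
    and lim: "(\<lambda>m. \<integral>x. (norm (f x - F m x))\<^sup>2 \<partial>M) \<longlonglongrightarrow> 0"
  shows "(\<lambda>m. \<integral>x. F m x \<bullet> g x \<partial>M) \<longlonglongrightarrow> (\<integral>x. f x \<bullet> g x \<partial>M)"
proof -
  let ?d = "\<lambda>m x. f x - F m x"
  have d: "?d m \<in> borel_measurable M" "integrable M (\<lambda>x. (norm (?d m x))\<^sup>2)" for m
    using assms integrable_lincomb_L2[of f M "F m" 1 "-1"] by auto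
  have "(\<lambda>m. (\<integral>x. ?d m x \<bullet> g x \<partial>M)\<^sup>2) \<longlonglongrightarrow> 0"
  proof (rule tendsto_sandwich[of "\<lambda>_. 0"])
    show "\<forall>\<^sub>F m in sequentially. (\<integral>x. ?d m x \<bullet> g x \<partial>M)\<^sup>2
        \<le> (\<integral>x. (norm (?d m x))\<^sup>2 \<partial>M) * (\<integral>x. (norm (g x))\<^sup>2 \<partial>M)"
      using Cauchy_Schwarz_integral[OF d(1) assms(2) d(2) assms(5)] by simp
    show "(\<lambda>m. (\<integral>x. (norm (?d m x))\<^sup>2 \<partial>M) * (\<integral>x. (norm (g x))\<^sup>2 \<partial>M)) \<longlonglongrightarrow> 0"
      using tendsto_mult_left_zero[OF lim] by simp
  qed auto
  then have "(\<lambda>m. sqrt ((\<integral>x. ?d m x \<bullet> g x \<partial>M)\<^sup>2)) \<longlonglongrightarrow> sqrt 0" by (rule tendsto_real_sqrt)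
  then have "(\<lambda>m. \<integral>x. ?d m x \<bullet> g x \<partial>M) \<longlonglongrightarrow> 0" by (simp add: tendsto_rabs_zero_iff)
  moreover have "(\<integral>x. ?d m x \<bullet> g x \<partial>M) = (\<integral>x. f x \<bullet> g x \<partial>M) - (\<integral>x. F m x \<bullet> g x \<partial>M)" for m
    using assms by (simp add: inner_diff_left integrable_inner_L2)
  ultimately have "(\<lambda>m. (\<integral>x. f x \<bullet> g x \<partial>M) - ((\<integral>x. f x \<bullet> g x \<partial>M) - (\<integral>x. F m x \<bullet> g x \<partial>M)))
      \<longlonglongrightarrow> (\<integral>x. f x \<bullet> g x \<partial>M) - 0"
    by (intro tendsto_diff tendsto_const) simp
  then show ?thesis by simp
qed

lemma L2_UNIV: "f \<in> L2 UNIV \<longleftrightarrow> f \<in> borel_measurable lebesgue \<and> integrable lebesgue (\<lambda>x. (norm (f x))\<^sup>2)"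
  by (simp add: L2_def lebesgue_on_UNIV_eq)

lemma L2_lincomb:
  assumes "f \<in> L2 UNIV" "g \<in> L2 UNIV"
  shows "(\<lambda>x. a *\<^sub>R f x + b *\<^sub>R g x) \<in> L2 UNIV"
  using assms integrable_lincomb_L2[of f lebesgue g a b] by (auto simp: L2_UNIV)

lemma L2_diff: "f \<in> L2 UNIV \<Longrightarrow> g \<in> L2 UNIV \<Longrightarrow> (\<lambda>x. f x - g x) \<in> L2 UNIV"
  using L2_lincomb[of f g 1 "-1"] by simp

lemma L2_inner: "f \<in> L2 UNIV \<Longrightarrow> g \<in> L2 UNIV \<Longrightarrow> integrable lebesgue (\<lambda>x. f x \<bullet> g x)"
  using integrable_inner_L2[of f lebesgue g] by (auto simp: L2_UNIV)

lemma norm_add_squared_le: "(norm (x + y))\<^sup>2 \<le> 2 * (norm x)\<^sup>2 + 2 * (norm (y::'b::real_inner))\<^sup>2"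
proof -
  have "0 \<le> (norm (x - y))\<^sup>2" by simp
  then show ?thesis unfolding power2_norm_eq_inner by (simp add: algebra_simps inner_commute)
qed

lemma integral_norm_add_squared_le:
  assumes "f \<in> L2 UNIV" "g \<in> L2 UNIV"
  shows "(\<integral>x. (norm (f x + g x))\<^sup>2 \<partial>lebesgue)
    \<le> 2 * (\<integral>x. (norm (f x))\<^sup>2 \<partial>lebesgue) + 2 * (\<integral>x. (norm (g x))\<^sup>2 \<partial>lebesgue)"
proof -
  have "(\<integral>x. (norm (f x + g x))\<^sup>2 \<partial>lebesgue)
      \<le> (\<integral>x. 2 * (norm (f x))\<^sup>2 + 2 * (norm (g x))\<^sup>2 \<partial>lebesgue)"
    using assms L2_lincomb[OF assms, of 1 1]
    by (intro integral_mono norm_add_squared_le) (auto simp: L2_UNIV)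
  also have "\<dots> = 2 * (\<integral>x. (norm (f x))\<^sup>2 \<partial>lebesgue) + 2 * (\<integral>x. (norm (g x))\<^sup>2 \<partial>lebesgue)"
    using assms by (subst Bochner_Integration.integral_add) (auto simp: L2_UNIV)
  finally show ?thesis .
qed

section \<open>Zero extension from a subdomain to the whole space\<close>

lemma integral_lebesgue_on:
  fixes f :: "'a::euclidean_space \<Rightarrow> 'b::euclidean_space"
  assumes "U \<in> sets lebesgue"
  shows "(\<integral>x. f x \<partial>lebesgue_on U) = (\<integral>x. (if x \<in> U then f x else 0) \<partial>lebesgue)"
  using assms by (simp add: integral_restrict_space indicator_scaleR_eq_if)

lemma integrable_lebesgue_on_iff:
  fixes f :: "'a::euclidean_space \<Rightarrow> 'b::euclidean_space"
  assumes "U \<in> sets lebesgue"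
  shows "integrable (lebesgue_on U) f \<longleftrightarrow> integrable lebesgue (\<lambda>x. if x \<in> U then f x else 0)"
  using assms by (simp add: integrable_restrict_space indicator_scaleR_eq_if)

lemma measurable_lebesgue_on_iff:
  fixes f :: "'a::euclidean_space \<Rightarrow> 'b::euclidean_space"
  assumes "U \<in> sets lebesgue"
  shows "f \<in> borel_measurable (lebesgue_on U) \<longleftrightarrow> (\<lambda>x. if x \<in> U then f x else 0) \<in> borel_measurable lebesgue"
  using borel_measurable_if_lebesgue_on[OF assms, of UNIV f] by (simp add: lebesgue_on_UNIV_eq)

lemma L2_zero_extension:
  assumes "U \<in> sets lebesgue"
  shows "f \<in> L2 U \<longleftrightarrow> (\<lambda>x. if x \<in> U then f x else 0) \<in> L2 UNIV"
proof -
  have "(\<lambda>x. (norm (if x \<in> U then f x else 0))\<^sup>2) = (\<lambda>x. if x \<in> U then (norm (f x))\<^sup>2 else 0)" by auto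
  then show ?thesis
    using integrable_lebesgue_on_iff[OF assms, of "\<lambda>x. (norm (f x))\<^sup>2"] measurable_lebesgue_on_iff[OF assms, of f]
    unfolding L2_UNIV by (simp add: L2_def)
qed

section \<open>Test functions and weak gradients\<close>

lemma integrable_continuous_compact_support:
  fixes f :: "'a::euclidean_space \<Rightarrow> 'b::euclidean_space"
  assumes "compact K" "continuous_on UNIV f" "\<And>x. x \<notin> K \<Longrightarrow> f x = 0"
  shows "integrable lborel f" "integrable lebesgue f"
proof -
  have "integrable lborel (\<lambda>x. indicator K x *\<^sub>R f x)"
    using assms by (intro borel_integrable_compact) (auto intro: continuous_on_subset)
  moreover have "(\<lambda>x. indicator K x *\<^sub>R f x) = f" using assms by (auto simp: indicator_def)
  ultimately show "integrable lborel f" by simp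
  then show "integrable lebesgue f"
    using assms(2) by (subst integrable_completion) (auto intro: borel_measurable_continuous_onI)
qed

lemma continuous_measurable_lebesgue:
  fixes f :: "'a::euclidean_space \<Rightarrow> 'b::euclidean_space"
  assumes "continuous_on UNIV f"
  shows "f \<in> borel_measurable lebesgue"
  using borel_measurable_continuous_onI[OF assms] by (auto intro: measurable_completion)

lemma L2_continuous_compact_support:
  fixes f :: "real^'n::finite \<Rightarrow> 'b::euclidean_space"
  assumes "compact K" "continuous_on UNIV f" "\<And>x. x \<notin> K \<Longrightarrow> f x = 0"
  shows "f \<in> L2 UNIV"
  using assms
  by (auto simp: L2_UNIV intro!: continuous_measurable_lebesgue integrable_continuous_compact_support[of K]
      continuous_intros)

lemma test_function_support:
  assumes "\<phi> \<in> test_functions U"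
  obtains K where "compact K" "K \<subseteq> U" "\<And>x. x \<notin> K \<Longrightarrow> \<phi> x = 0" "\<And>x. x \<notin> K \<Longrightarrow> gradient \<phi> x = 0"
proof
  let ?K = "closure {x. \<phi> x \<noteq> 0}"
  show "compact ?K" "?K \<subseteq> U" using assms by (auto simp: test_functions_def)
  show 0: "\<phi> x = 0" if "x \<notin> ?K" for x using that closure_subset[of "{x. \<phi> x \<noteq> 0}"] by auto
  show "gradient \<phi> x = 0" if "x \<notin> ?K" for x
  proof (rule gradient_eqI)
    have "((\<lambda>x. 0) has_derivative (\<lambda>h. 0 \<bullet> h)) (at x)" by simp
    then show "(\<phi> has_derivative (\<lambda>h. 0 \<bullet> h)) (at x)"
    proof (rule has_derivative_transform_within_open)
      show "open (- ?K)" by (rule open_Compl) simp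
      show "x \<in> - ?K" using that by simp
      show "0 = \<phi> y" if "y \<in> - ?K" for y using 0[of y] that by simp
    qed
  qed
qed

lemma test_function_smooth: "\<phi> \<in> test_functions U \<Longrightarrow> smooth \<phi>"
  by (simp add: test_functions_def)

lemma test_functionI:
  assumes "smooth \<phi>" "compact K" "K \<subseteq> U" "\<And>x. x \<notin> K \<Longrightarrow> \<phi> x = 0"
  shows "\<phi> \<in> test_functions U"
proof -
  have K: "closure {x. \<phi> x \<noteq> 0} \<subseteq> K"
    using assms by (intro closure_minimal) (auto intro: compact_imp_closed)
  then have "compact (closure {x. \<phi> x \<noteq> 0})"
    using compact_Int_closed[OF assms(2) closed_closure, of "{x. \<phi> x \<noteq> 0}"] by (simp add: Int_absorb1)
  with K assms show ?thesis unfolding test_functions_def by auto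
qed

lemma test_function_zero: "\<phi> \<in> test_functions U \<Longrightarrow> x \<notin> U \<Longrightarrow> \<phi> x = 0 \<and> gradient \<phi> x = 0"
proof -
  assume a: "\<phi> \<in> test_functions U" "x \<notin> U"
  obtain K where "K \<subseteq> U" "\<And>x. x \<notin> K \<Longrightarrow> \<phi> x = 0" "\<And>x. x \<notin> K \<Longrightarrow> gradient \<phi> x = 0"
    using test_function_support[OF a(1)] by metis
  with a(2) show "\<phi> x = 0 \<and> gradient \<phi> x = 0" by auto
qed

lemma test_function_L2:
  assumes "\<phi> \<in> test_functions U"
  shows "\<phi> \<in> L2 UNIV" "gradient \<phi> \<in> L2 UNIV"
proof -
  obtain K where "compact K" "\<And>x. x \<notin> K \<Longrightarrow> \<phi> x = 0" "\<And>x. x \<notin> K \<Longrightarrow> gradient \<phi> x = 0"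
    using test_function_support[OF assms] by metis
  then show "\<phi> \<in> L2 UNIV" "gradient \<phi> \<in> L2 UNIV"
    using test_function_smooth[OF assms]
    by (auto intro!: L2_continuous_compact_support[of K] smooth_continuous continuous_on_gradient)
qed

lemma test_function_lincomb:
  assumes "\<phi> \<in> test_functions U" "\<psi> \<in> test_functions U"
  shows "(\<lambda>x. a * \<phi> x + b * \<psi> x) \<in> test_functions U"
    "gradient (\<lambda>x. a * \<phi> x + b * \<psi> x) x = a *\<^sub>R gradient \<phi> x + b *\<^sub>R gradient \<psi> x"
proof -
  obtain K where K: "compact K" "K \<subseteq> U" "\<And>x. x \<notin> K \<Longrightarrow> \<phi> x = 0"
    using test_function_support[OF assms(1)] by metis
  obtain K' where K': "compact K'" "K' \<subseteq> U" "\<And>x. x \<notin> K' \<Longrightarrow> \<psi> x = 0"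
    using test_function_support[OF assms(2)] by metis
  show "(\<lambda>x. a * \<phi> x + b * \<psi> x) \<in> test_functions U"
    using K K' assms by (intro test_functionI[of _ "K \<union> K'"] smooth_add smooth_mult smooth_const)
      (auto simp: test_function_smooth)
  have "((\<lambda>x. a * \<phi> x + b * \<psi> x) has_derivative
      (\<lambda>h. a * (gradient \<phi> x \<bullet> h) + b * (gradient \<psi> x \<bullet> h))) (at x)"
    using assms[THEN test_function_smooth, THEN smooth_has_derivative]
    by (intro has_derivative_add has_derivative_mult_right)
  then show "gradient (\<lambda>x. a * \<phi> x + b * \<psi> x) x = a *\<^sub>R gradient \<phi> x + b *\<^sub>R gradient \<psi> x"
    by (intro gradient_eqI) (simp add: inner_add_left)
qed

lemma test_function_mult:
  assumes "\<phi> \<in> test_functions U" "smooth \<psi>"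
  shows "(\<lambda>x. \<phi> x * \<psi> x) \<in> test_functions U"
    "gradient (\<lambda>x. \<phi> x * \<psi> x) x = \<phi> x *\<^sub>R gradient \<psi> x + \<psi> x *\<^sub>R gradient \<phi> x"
proof -
  obtain K where K: "compact K" "K \<subseteq> U" "\<And>x. x \<notin> K \<Longrightarrow> \<phi> x = 0"
    using test_function_support[OF assms(1)] by metis
  show "(\<lambda>x. \<phi> x * \<psi> x) \<in> test_functions U"
    using K assms by (intro test_functionI[of _ K] smooth_mult) (auto simp: test_function_smooth)
  have "((\<lambda>x. \<phi> x * \<psi> x) has_derivative
      (\<lambda>h. \<phi> x * (gradient \<psi> x \<bullet> h) + (gradient \<phi> x \<bullet> h) * \<psi> x)) (at x)"
    using assms test_function_smooth smooth_has_derivative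
    by (intro has_derivative_mult) auto
  then show "gradient (\<lambda>x. \<phi> x * \<psi> x) x = \<phi> x *\<^sub>R gradient \<psi> x + \<psi> x *\<^sub>R gradient \<phi> x"
    by (intro gradient_eqI) (simp add: inner_add_left mult.commute)
qed

lemma smooth_line_deriv:
  assumes "smooth \<phi>"
  shows "((\<lambda>t. \<phi> (x + t *\<^sub>R e)) has_real_derivative gradient \<phi> (x + t *\<^sub>R e) \<bullet> e) (at t within S)"
proof -
  have "((\<lambda>t. \<phi> (x + t *\<^sub>R e)) has_derivative (\<lambda>h. gradient \<phi> (x + t *\<^sub>R e) \<bullet> (h *\<^sub>R e))) (at t)"
    by (rule has_derivative_compose[OF _ smooth_has_derivative[OF assms], of "\<lambda>t. x + t *\<^sub>R e"])
      (auto intro!: derivative_eq_intros)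
  then have "((\<lambda>t. \<phi> (x + t *\<^sub>R e)) has_derivative (\<lambda>h. gradient \<phi> (x + t *\<^sub>R e) \<bullet> (h *\<^sub>R e))) (at t within S)"
    by (rule has_derivative_at_withinI)
  moreover have "(\<lambda>h. gradient \<phi> (x + t *\<^sub>R e) \<bullet> (h *\<^sub>R e)) = (*) (gradient \<phi> (x + t *\<^sub>R e) \<bullet> e)"
    by (auto simp: fun_eq_iff)
  ultimately show ?thesis unfolding has_field_derivative_def by simp
qed

lemma gradient_component: "gradient f x $ i = partial_deriv i f x"
  by (simp add: gradient_def)

text \<open>The difference quotients of a test function have integral zero by translation invariance.\<close>
lemma integral_partial_deriv_test_function:
  fixes \<phi> :: "real^'n::finite \<Rightarrow> real"
  assumes "\<phi> \<in> test_functions U"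
  shows "(\<integral>x. partial_deriv i \<phi> x \<partial>lebesgue) = 0"
proof -
  obtain K where K: "compact K" "\<And>x. x \<notin> K \<Longrightarrow> \<phi> x = 0" "\<And>x. x \<notin> K \<Longrightarrow> gradient \<phi> x = 0"
    using test_function_support[OF assms] by metis
  have sm: "smooth \<phi>" using assms by (rule test_function_smooth)
  have cont: "continuous_on UNIV \<phi>" "continuous_on UNIV (gradient \<phi>)"
    "continuous_on UNIV (partial_deriv i \<phi>)"
    using sm by (auto intro: smooth_continuous continuous_on_gradient smooth_partial_deriv)
  define e :: "real^'n" where "e = axis i 1"
  have [simp]: "norm e = 1" by (simp add: e_def norm_axis_1)
  have "compact (gradient \<phi> ` K)"
    using K cont(2) by (intro compact_continuous_image) (auto intro: continuous_on_subset)
  then obtain B where "\<And>x. x \<in> K \<Longrightarrow> norm (gradient \<phi> x) \<le> B"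
    using compact_imp_bounded[of "gradient \<phi> ` K"] unfolding bounded_iff by auto
  then have B: "norm (gradient \<phi> x) \<le> max B 0" for x
    using K(3)[of x] by (cases "x \<in> K") (auto simp: max.coboundedI1)
  \<comment> \<open>A point outside \<open>K'\<close> has no translate by \<open>t e\<close> with
    \<open>\<bar>t\<bar> \<le> 1\<close> in \<open>K\<close>, so all difference quotients vanish
    there. This makes the dominating function integrable.\<close>
  define K' where "K' = {x + y | x y. x \<in> K \<and> y \<in> cball 0 1}"
  have K': "compact K'" unfolding K'_def using K(1) by (intro compact_sums) auto
  have K'I: "x \<in> K'" if "x + t *\<^sub>R e \<in> K" "\<bar>t\<bar> \<le> 1" for x t
  proof -
    have "x = (x + t *\<^sub>R e) + (- (t *\<^sub>R e))" "- (t *\<^sub>R e) \<in> cball 0 1" using that by auto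
    then show ?thesis unfolding K'_def using that(1) by blast
  qed
  define q where "q = (\<lambda>m x. (\<phi> (x + (1 / Suc m) *\<^sub>R e) - \<phi> x) * Suc m)"
  have meas: "q m \<in> borel_measurable lborel" for m
    using cont(1) unfolding q_def
    by (auto intro!: borel_measurable_continuous_onI continuous_intros intro: continuous_on_compose2[OF cont(1)])
  have "(\<lambda>m. \<integral>x. q m x \<partial>lborel) \<longlonglongrightarrow> (\<integral>x. partial_deriv i \<phi> x \<partial>lborel)"
  proof (rule integral_dominated_convergence)
    show "integrable lborel (\<lambda>x. indicator K' x *\<^sub>R max B 0)"
      using K' by (intro borel_integrable_compact) auto
    show "partial_deriv i \<phi> \<in> borel_measurable lborel"
      using cont(3) by (auto intro: borel_measurable_continuous_onI)
    show "AE x in lborel. (\<lambda>m. q m x) \<longlonglongrightarrow> partial_deriv i \<phi> x"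
    proof (intro AE_I2)
      fix x
      have "((\<lambda>t. \<phi> (x + t *\<^sub>R e)) has_real_derivative gradient \<phi> (x + 0 *\<^sub>R e) \<bullet> e) (at 0)"
        by (rule smooth_line_deriv[OF sm])
      then have "((\<lambda>h. (\<phi> (x + h *\<^sub>R e) - \<phi> x) / h) \<longlongrightarrow> partial_deriv i \<phi> x) (at 0)"
        by (simp add: has_field_derivative_iff e_def inner_axis gradient_component)
      moreover have "filterlim (\<lambda>m. 1 / real (Suc m)) (at 0) sequentially"
        using LIMSEQ_inverse_real_of_nat by (auto simp: filterlim_at inverse_eq_divide)
      ultimately have "(\<lambda>m. (\<phi> (x + (1 / real (Suc m)) *\<^sub>R e) - \<phi> x) / (1 / real (Suc m)))
          \<longlonglongrightarrow> partial_deriv i \<phi> x"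
        by (rule filterlim_compose)
      then show "(\<lambda>m. q m x) \<longlonglongrightarrow> partial_deriv i \<phi> x" by (simp add: q_def)
    qed
    show "AE x in lborel. norm (q m x) \<le> indicator K' x *\<^sub>R max B 0" for m
    proof (intro AE_I2)
      fix x
      let ?t = "1 / real (Suc m)"
      show "norm (q m x) \<le> indicator K' x *\<^sub>R max B 0"
      proof (cases "x \<in> K'")
        case True
        have "\<exists>z>0. z < ?t \<and> \<phi> (x + ?t *\<^sub>R e) - \<phi> (x + 0 *\<^sub>R e) = (?t - 0) * (gradient \<phi> (x + z *\<^sub>R e) \<bullet> e)"
          by (rule MVT2) (auto intro: smooth_line_deriv[OF sm])
        then obtain z where "q m x = gradient \<phi> (x + z *\<^sub>R e) \<bullet> e"
          by (auto simp: q_def field_simps)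
        then have "norm (q m x) \<le> norm (gradient \<phi> (x + z *\<^sub>R e))"
          using Cauchy_Schwarz_ineq2[of "gradient \<phi> (x + z *\<^sub>R e)" e] by simp
        also have "\<dots> \<le> max B 0" by (rule B)
        finally show ?thesis using True by simp
      next
        case False
        then have "x + ?t *\<^sub>R e \<notin> K" "x + 0 *\<^sub>R e \<notin> K"
          using K'I[of x ?t] K'I[of x 0] by auto
        then show ?thesis using K(2) False by (simp add: q_def)
      qed
    qed
  qed (use meas in auto)
  moreover have "(\<integral>x. q m x \<partial>lborel) = 0" for m
  proof -
    let ?c = "(1 / real (Suc m)) *\<^sub>R e"
    have i: "integrable lborel \<phi>" using integrable_continuous_compact_support(1)[OF K(1) cont(1) K(2)] .
    have bm: "\<phi> \<in> borel_measurable borel" using cont(1) by (rule borel_measurable_continuous_onI)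
    have "integrable (distr lborel borel ((+) ?c)) \<phi>" using i by (simp only: lborel_distr_plus)
    then have i': "integrable lborel (\<lambda>x. \<phi> (?c + x))"
      by (subst (asm) integrable_distr_eq) (auto simp: bm)
    have "(\<integral>x. \<phi> (?c + x) \<partial>lborel) = (\<integral>x. \<phi> x \<partial>distr lborel borel ((+) ?c))"
      by (subst integral_distr) (auto simp: bm)
    then have "(\<integral>x. \<phi> (?c + x) \<partial>lborel) = (\<integral>x. \<phi> x \<partial>lborel)" by (simp only: lborel_distr_plus)
    moreover have eq: "(\<lambda>x. \<phi> (?c + x)) = (\<lambda>x. \<phi> (x + ?c))" by (simp add: add.commute)
    ultimately show ?thesis
      using Bochner_Integration.integral_diff[OF i'[unfolded eq] i] unfolding q_def eq by simp
  qed
  ultimately have "(\<lambda>m::nat. 0) \<longlonglongrightarrow> (\<integral>x. partial_deriv i \<phi> x \<partial>lborel)"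
    by simp
  then have "(\<integral>x. partial_deriv i \<phi> x \<partial>lborel) = 0"
    by (rule LIMSEQ_unique[OF _ tendsto_const])
  then show ?thesis
    using cont(3) by (subst integral_completion) (auto intro: borel_measurable_continuous_onI)
qed

lemma L2_component:
  fixes g :: "real^'n::finite \<Rightarrow> real^'n"
  assumes "g \<in> L2 UNIV"
  shows "(\<lambda>x. g x $ i) \<in> L2 UNIV"
proof -
  have m: "(\<lambda>x. g x $ i) \<in> borel_measurable lebesgue"
    using assms by (auto simp: L2_UNIV intro: borel_measurable_continuous_onI
        measurable_compose[where f = g and g = "\<lambda>y. y $ i" and N = borel] continuous_intros)
  have "integrable lebesgue (\<lambda>x. (g x $ i)\<^sup>2)"
  proof (rule Bochner_Integration.integrable_bound)
    show "integrable lebesgue (\<lambda>x. (norm (g x))\<^sup>2)" using assms by (simp add: L2_UNIV)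
    show "AE x in lebesgue. norm ((g x $ i)\<^sup>2) \<le> norm ((norm (g x))\<^sup>2)"
      by (intro AE_I2) (simp add: abs_le_square_iff[symmetric] component_le_norm_cart)
  qed (use m in measurable)
  with m show ?thesis by (simp add: L2_UNIV)
qed

lemma integration_by_parts:
  fixes \<phi> \<psi> :: "real^'n::finite \<Rightarrow> real"
  assumes "\<phi> \<in> test_functions U" "\<psi> \<in> test_functions V"
  shows "(\<integral>x. \<phi> x * partial_deriv i \<psi> x \<partial>lebesgue) = - (\<integral>x. partial_deriv i \<phi> x * \<psi> x \<partial>lebesgue)"
proof -
  have "(\<integral>x. partial_deriv i (\<lambda>x. \<phi> x * \<psi> x) x \<partial>lebesgue) = 0"
    using assms by (intro integral_partial_deriv_test_function test_function_mult(1) test_function_smooth)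
  moreover have "partial_deriv i (\<lambda>x. \<phi> x * \<psi> x) x = \<phi> x * partial_deriv i \<psi> x + partial_deriv i \<phi> x * \<psi> x" for x
    using test_function_mult(2)[OF assms(1) test_function_smooth[OF assms(2)], of x]
    by (simp add: vec_eq_iff gradient_component[symmetric] mult.commute)
  moreover have "integrable lebesgue (\<lambda>x. \<phi> x * partial_deriv i \<psi> x)"
    "integrable lebesgue (\<lambda>x. partial_deriv i \<phi> x * \<psi> x)"
    using L2_inner[OF test_function_L2(1)[OF assms(1)] L2_component[OF test_function_L2(2)[OF assms(2)]]]
      L2_inner[OF L2_component[OF test_function_L2(2)[OF assms(1)]] test_function_L2(1)[OF assms(2)]]
    by (simp_all add: gradient_component)
  ultimately show ?thesis by simp
qed

text \<open>Boxes are an intersection-stable generator of the Borel sets, and the sets over which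
  \<open>f\<close> integrates to \<open>0\<close> form a Dynkin system; \<open>tot\<close> is what
  handles complements.\<close>

lemma lborel_box_integrals_zero:
  fixes f :: "real^'n::finite \<Rightarrow> real"
  assumes f: "integrable lborel f" and 0: "\<And>a b. (\<integral>x. indicator (box a b) x * f x \<partial>lborel) = 0"
    and tot: "(\<integral>x. f x \<partial>lborel) = 0"
  shows "AE x in lborel. f x = 0"
proof (rule sigma_finite_measure.density_zero[OF sigma_finite_lborel f])
  fix A :: "(real^'n) set" assume "A \<in> sets lborel"
  then have A: "A \<in> sigma_sets UNIV (range (\<lambda>(a, b). box a b))"
    by (simp add: borel_eq_box)
  have st: "Int_stable (range (\<lambda>(a, b). box a b :: (real^'n) set))"
    by (auto simp: Int_stable_def box_Int_box)
  have meas: "A \<in> sets lborel" if "A \<in> sigma_sets UNIV (range (\<lambda>(a, b). box a b :: (real^'n) set))" for A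
    using that by (simp add: borel_eq_box)
  have int: "integrable lborel (\<lambda>x. indicator A x *\<^sub>R f x)" if "A \<in> sets lborel" for A
    using f that by (intro integrable_mult_indicator)
  have "range (\<lambda>(a, b). box a b :: (real^'n) set) \<subseteq> Pow UNIV" by simp
  from st this A show "set_lebesgue_integral lborel A f = 0"
  proof (induction rule: sigma_sets_induct_disjoint)
    case (basic A)
    then show ?case using 0 by (auto simp: set_lebesgue_integral_def)
  next
    case (compl A)
    have "(\<integral>x. indicator (UNIV - A) x *\<^sub>R f x \<partial>lborel)
        = (\<integral>x. f x - indicator A x *\<^sub>R f x \<partial>lborel)"
      by (intro Bochner_Integration.integral_cong) (auto simp: indicator_def)
    also have "\<dots> = 0"
      using f int[OF meas[OF compl(1)]] tot compl(2)
      by (subst Bochner_Integration.integral_diff) (auto simp: set_lebesgue_integral_def)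
    finally show ?case by (simp add: set_lebesgue_integral_def)
  next
    case (union A)
    have A: "A i \<in> sets lborel" for i using union(2) by (intro meas) auto
    then have "(\<Union>i. A i) \<in> sets lborel" by blast
    then have "(LINT x:(\<Union>i. A i)|lborel. f x) = (\<Sum>i. (LINT x:(A i)|lborel. f x))"
      using A int union(1) by (intro lebesgue_integral_countable_add)
        (auto simp: set_integrable_def disjoint_family_on_def)
    then show ?case using union by simp
  qed (auto simp: set_lebesgue_integral_def)
qed

text \<open>Test functions converge boundedly to the indicator function of any box.\<close>
lemma integral_box_zero:
  fixes f :: "real^'n::finite \<Rightarrow> real"
  assumes f: "integrable lebesgue (\<lambda>x. if x \<in> box a b then f x else 0)" and sub: "cbox a b \<subseteq> V"
    and 0: "\<And>\<phi>. \<phi> \<in> test_functions V \<Longrightarrow> (\<integral>x. f x * \<phi> x \<partial>lebesgue) = 0"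
  shows "(\<integral>x. (if x \<in> box a b then f x else 0) \<partial>lebesgue) = 0"
proof -
  define \<zeta> where "\<zeta> = (\<lambda>m i s. if a $ i < s \<and> s < b $ i
      then exp (- m / (s - a $ i)) * exp (- m / (b $ i - s)) else (0::real))"
  define \<phi> where "\<phi> = (\<lambda>(m::nat) x. \<Prod>i\<in>UNIV. \<zeta> (1 / Suc m) i (x $ i))"
  have mem: "x \<in> box a b \<longleftrightarrow> (\<forall>i. a $ i < x $ i \<and> x $ i < b $ i)" for x
    by (simp add: mem_box_cart)
  have out: "\<phi> m x = 0" if "x \<notin> box a b" for m x
    using that by (auto simp: mem \<phi>_def \<zeta>_def intro!: prod_zero)
  have test: "\<phi> m \<in> test_functions V" for m
  proof (rule test_functionI)
    show "smooth (\<phi> m)"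
      unfolding \<phi>_def \<zeta>_def by (rule smooth_box_bump) simp
    show "\<phi> m x = 0" if "x \<notin> cbox a b" for x using that out box_subset_cbox by blast
  qed (use sub in auto)
  have bd: "\<bar>\<phi> m x\<bar> \<le> 1" for m x
    unfolding \<phi>_def abs_prod
  proof (intro prod_le_1 conjI)
    show "\<bar>\<zeta> (1 / real (Suc m)) i (x $ i)\<bar> \<le> 1" for i
      unfolding \<zeta>_def using mult_le_one[of "exp (- (1 / real (Suc m)) / (x $ i - a $ i))" "exp (- (1 / real (Suc m)) / (b $ i - x $ i))"]
      by (auto simp: abs_mult)
  qed simp
  have lim: "(\<lambda>m. \<phi> m x) \<longlonglongrightarrow> indicator (box a b) x" for x
  proof (cases "x \<in> box a b")
    case True
    have "(\<lambda>m. \<zeta> (1 / Suc m) i (x $ i)) \<longlonglongrightarrow> 1" for i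
    proof -
      have "(\<lambda>m. exp (- (1 / real (Suc m)) / (x $ i - a $ i)) * exp (- (1 / real (Suc m)) / (b $ i - x $ i)))
          \<longlonglongrightarrow> exp (- 0 / (x $ i - a $ i)) * exp (- 0 / (b $ i - x $ i))"
        using LIMSEQ_inverse_real_of_nat True
        by (intro tendsto_intros) (auto simp: inverse_eq_divide mem less_imp_neq[symmetric] dest!: spec[of _ i])
      then show ?thesis using True by (simp add: \<zeta>_def mem)
    qed
    then have "(\<lambda>m. \<phi> m x) \<longlonglongrightarrow> (\<Prod>i\<in>(UNIV::'n set). 1)"
      unfolding \<phi>_def by (intro tendsto_prod)
    then show ?thesis using True by simp
  qed (simp add: out)
  let ?F = "\<lambda>x. if x \<in> box a b then f x else 0"
  have "(\<lambda>m. \<integral>x. ?F x * \<phi> m x \<partial>lebesgue) \<longlonglongrightarrow> (\<integral>x. ?F x \<partial>lebesgue)"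
  proof (rule integral_dominated_convergence)
    show "integrable lebesgue (\<lambda>x. \<bar>?F x\<bar>)" using f by (rule integrable_abs)
    show "?F \<in> borel_measurable lebesgue" using f by auto
    show "(\<lambda>x. ?F x * \<phi> m x) \<in> borel_measurable lebesgue" for m
      using f test_function_L2(1)[OF test, of m] by (intro borel_measurable_times) (auto simp: L2_UNIV)
    show "AE x in lebesgue. (\<lambda>m. ?F x * \<phi> m x) \<longlonglongrightarrow> ?F x"
    proof (intro AE_I2)
      fix x show "(\<lambda>m. ?F x * \<phi> m x) \<longlonglongrightarrow> ?F x"
        using tendsto_mult_left[OF lim[of x], of "?F x"] by (auto simp: indicator_def)
    qed
    show "AE x in lebesgue. norm (?F x * \<phi> m x) \<le> \<bar>?F x\<bar>" for m
      using bd[of m] by (intro AE_I2) (auto simp: abs_mult intro!: mult_left_le)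
  qed
  moreover have "(\<integral>x. ?F x * \<phi> m x \<partial>lebesgue) = 0" for m
  proof -
    have "(\<integral>x. ?F x * \<phi> m x \<partial>lebesgue) = (\<integral>x. f x * \<phi> m x \<partial>lebesgue)"
      by (intro Bochner_Integration.integral_cong) (auto simp: out)
    then show ?thesis using 0[OF test] by simp
  qed
  ultimately have "(\<lambda>m::nat. 0) \<longlonglongrightarrow> (\<integral>x. ?F x \<partial>lebesgue)" by simp
  then show ?thesis by (rule LIMSEQ_unique[OF _ tendsto_const])
qed

lemma integrable_indicator_L2:
  fixes f :: "real^'n::finite \<Rightarrow> real"
  assumes "f \<in> L2 UNIV" "A \<in> lmeasurable"
  shows "integrable lebesgue (\<lambda>x. indicator A x * f x)"
proof -
  have "indicat_real A \<in> L2 UNIV"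
  proof -
    have "(\<lambda>x. (norm (indicat_real A x))\<^sup>2) = indicat_real A" by (auto simp: indicator_def)
    moreover have "integrable lebesgue (indicat_real A)"
      using assms(2) by (intro integrable_real_indicator) (auto simp: fmeasurable_def)
    ultimately show ?thesis by (auto simp: L2_UNIV)
  qed
  from L2_inner[OF this assms(1)] show ?thesis by simp
qed

text \<open>On each closed box inside \<open>V\<close> the vanishing against test functions becomes
  vanishing integrals over all smaller boxes, and countably many closed boxes exhaust
  \<open>V\<close>. The passage to a Borel version \<open>f'\<close> is made because the argument
  with generators lives on Borel sets, while \<open>f\<close> is only Lebesgue measurable.\<close>

lemma fundamental_lemma:
  fixes f :: "real^'n::finite \<Rightarrow> real"
  assumes V: "open V" and f: "f \<in> L2 UNIV"
    and 0: "\<And>\<phi>. \<phi> \<in> test_functions V \<Longrightarrow> (\<integral>x. f x * \<phi> x \<partial>lebesgue) = 0"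
  shows "AE x in lebesgue. x \<in> V \<longrightarrow> f x = 0"
proof -
  obtain f' where f': "f' \<in> borel_measurable lborel" "AE x in lborel. f x = f' x"
    using f completion_ex_borel_measurable_real[of f lborel] by (auto simp: L2_UNIV)
  have ff': "AE x in lebesgue. f x = f' x" using f'(2) by (rule AE_completion)
  have box: "AE x in lebesgue. x \<in> cbox c d \<longrightarrow> f x = 0" if cd: "cbox c d \<subseteq> V" for c d
  proof -
    let ?F = "\<lambda>x. indicator (box c d) x * f' x"
    have i: "integrable lebesgue (\<lambda>x. indicator (box a b) x * f x)" for a b
      using f by (intro integrable_indicator_L2) auto
    have ifeq: "(\<lambda>x. if x \<in> box a b then f x else 0) = (\<lambda>x. indicator (box a b) x * f x)" for a b
      by (auto simp: indicator_def)
    have 00: "(\<integral>x. indicator (box a b) x * f' x \<partial>lborel) = 0" if "cbox a b \<subseteq> cbox c d" for a b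
    proof -
      have "(\<integral>x. indicator (box a b) x * f' x \<partial>lborel) = (\<integral>x. indicator (box a b) x * f' x \<partial>lebesgue)"
        using f'(1) by (subst integral_completion) auto
      also have "\<dots> = (\<integral>x. indicator (box a b) x * f x \<partial>lebesgue)"
        using ff' f f'(1) by (intro integral_cong_AE) (auto simp: L2_UNIV intro!: borel_measurable_times intro: measurable_completion)
      also have "\<dots> = 0"
        using integral_box_zero[of a b f V] i[of a b] 0 that cd unfolding ifeq by auto
      finally show ?thesis .
    qed
    have iF: "integrable lborel ?F"
    proof -
      have "integrable lebesgue ?F"
        by (rule integrable_cong_AE_imp[OF i[of c d]])
          (use ff' f'(1) in \<open>auto intro!: borel_measurable_times intro: measurable_completion\<close>)
      then show ?thesis using f'(1) by (subst (asm) integrable_completion) auto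
    qed
    have "AE x in lborel. ?F x = 0"
    proof (rule lborel_box_integrals_zero[OF iF])
      show "(\<integral>x. ?F x \<partial>lborel) = 0" by (rule 00) simp
      fix a b :: "real^'n"
      \<comment> \<open>The intersection of two boxes is again a box. With coordinatewise maxima and
        minima its closed version stays inside \<open>cbox c d\<close>, so \<open>00\<close> applies
        to it.\<close>
      obtain a' b' where *: "box a b \<inter> box c d = box a' b'" "cbox a' b' \<subseteq> cbox c d"
        by (rule that[of "\<chi> i. max (a $ i) (c $ i)" "\<chi> i. min (b $ i) (d $ i)"])
          (auto simp: mem_box_cart set_eq_iff)
      have "(\<integral>x. indicator (box a b) x * ?F x \<partial>lborel) = (\<integral>x. indicator (box a' b') x * f' x \<partial>lborel)"
        unfolding *(1)[symmetric] by (intro Bochner_Integration.integral_cong) (auto simp: indicator_def)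
      then show "(\<integral>x. indicator (box a b) x * ?F x \<partial>lborel) = 0" using 00[OF *(2)] by simp
    qed
    then have "AE x in lebesgue. ?F x = 0" by (rule AE_completion)
    moreover have "AE x in lebesgue. x \<notin> cbox c d - box c d"
      using negligible_frontier_interval[of c d] by (intro AE_not_in) (simp add: negligible_iff_null_sets)
    ultimately show ?thesis using ff' by eventually_elim (auto simp: indicator_def)
  qed
  obtain D where D: "countable D" "\<And>X. X \<in> D \<Longrightarrow> X \<subseteq> V" "\<And>X. X \<in> D \<Longrightarrow> \<exists>a b. X = cbox a b" "\<Union>D = V"
    using open_countable_Union_open_cbox[OF V] by (metis Pow_iff subsetD)
  have "AE x in lebesgue. \<forall>X\<in>D. x \<in> X \<longrightarrow> f x = 0"
    using D box by (subst AE_ball_countable) metis+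
  then show ?thesis by eventually_elim (use D(4) in blast)
qed

section \<open>The space of functions with zero boundary values\<close>

text \<open>The function \<open>g\<close> is the weak gradient of \<open>u\<close>, and both are extended by zero. All integrals over
  subdomains become integrals over the whole space in this way.\<close>
definition sobolev0 :: "(real^'n::finite) set \<Rightarrow> (real^'n \<Rightarrow> real) \<Rightarrow> (real^'n \<Rightarrow> real^'n) \<Rightarrow> bool" where
  "sobolev0 U u g \<longleftrightarrow> u \<in> L2 UNIV \<and> g \<in> L2 UNIV \<and> (\<forall>x. x \<notin> U \<longrightarrow> u x = 0 \<and> g x = 0) \<and>
    (\<exists>\<phi>. (\<forall>m::nat. \<phi> m \<in> test_functions U) \<and>
      (\<lambda>m. \<integral>x. (norm (u x - \<phi> m x))\<^sup>2 \<partial>lebesgue) \<longlonglongrightarrow> 0 \<and>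
      (\<lambda>m. \<integral>x. (norm (g x - gradient (\<phi> m) x))\<^sup>2 \<partial>lebesgue) \<longlonglongrightarrow> 0)"

lemma sobolev0_lincomb:
  assumes "sobolev0 U u g" "sobolev0 U v h"
  shows "sobolev0 U (\<lambda>x. a * u x + b * v x) (\<lambda>x. a *\<^sub>R g x + b *\<^sub>R h x)"
proof -
  obtain \<phi> where \<phi>: "\<And>m::nat. \<phi> m \<in> test_functions U"
    "(\<lambda>m. \<integral>x. (norm (u x - \<phi> m x))\<^sup>2 \<partial>lebesgue) \<longlonglongrightarrow> 0"
    "(\<lambda>m. \<integral>x. (norm (g x - gradient (\<phi> m) x))\<^sup>2 \<partial>lebesgue) \<longlonglongrightarrow> 0"
    using assms(1) by (auto simp: sobolev0_def)
  obtain \<psi> where \<psi>: "\<And>m::nat. \<psi> m \<in> test_functions U"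
    "(\<lambda>m. \<integral>x. (norm (v x - \<psi> m x))\<^sup>2 \<partial>lebesgue) \<longlonglongrightarrow> 0"
    "(\<lambda>m. \<integral>x. (norm (h x - gradient (\<psi> m) x))\<^sup>2 \<partial>lebesgue) \<longlonglongrightarrow> 0"
    using assms(2) by (auto simp: sobolev0_def)
  \<comment> \<open>The codomain is left general so that the estimate serves both for the functions
    and for their gradients.\<close>
  have gen: "(\<lambda>m. \<integral>x. (norm ((a *\<^sub>R F x + b *\<^sub>R G x) - (a *\<^sub>R P m x + b *\<^sub>R Q m x)))\<^sup>2 \<partial>lebesgue) \<longlonglongrightarrow> 0"
    if "F \<in> L2 UNIV" "G \<in> L2 UNIV" "\<And>m. P m \<in> L2 UNIV" "\<And>m. Q m \<in> L2 UNIV"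
      "(\<lambda>m. \<integral>x. (norm (F x - P m x))\<^sup>2 \<partial>lebesgue) \<longlonglongrightarrow> 0"
      "(\<lambda>m. \<integral>x. (norm (G x - Q m x))\<^sup>2 \<partial>lebesgue) \<longlonglongrightarrow> 0"
    for F G :: "real^'n \<Rightarrow> 'b::euclidean_space" and P Q :: "nat \<Rightarrow> real^'n \<Rightarrow> 'b"
  proof (rule tendsto_sandwich[of "\<lambda>_. 0"])
    have FP: "(\<lambda>x. F x - P m x) \<in> L2 UNIV" "(\<lambda>x. G x - Q m x) \<in> L2 UNIV" for m
      using that by (auto intro: L2_diff)
    have *: "(\<lambda>x. a *\<^sub>R (F x - P m x)) \<in> L2 UNIV" "(\<lambda>x. b *\<^sub>R (G x - Q m x)) \<in> L2 UNIV" for m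
      using L2_lincomb[OF FP(1)[of m] FP(1)[of m], of a 0] L2_lincomb[OF FP(2)[of m] FP(2)[of m], of b 0] by simp_all
    show "\<forall>\<^sub>F m in sequentially. (\<integral>x. (norm ((a *\<^sub>R F x + b *\<^sub>R G x) - (a *\<^sub>R P m x + b *\<^sub>R Q m x)))\<^sup>2 \<partial>lebesgue)
      \<le> 2 * (a\<^sup>2 * (\<integral>x. (norm (F x - P m x))\<^sup>2 \<partial>lebesgue)) + 2 * (b\<^sup>2 * (\<integral>x. (norm (G x - Q m x))\<^sup>2 \<partial>lebesgue))"
    proof (intro always_eventually allI)
      fix m
      have "(a *\<^sub>R F x + b *\<^sub>R G x) - (a *\<^sub>R P m x + b *\<^sub>R Q m x)
          = a *\<^sub>R (F x - P m x) + b *\<^sub>R (G x - Q m x)" for x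
        by (simp add: algebra_simps)
      then show "(\<integral>x. (norm ((a *\<^sub>R F x + b *\<^sub>R G x) - (a *\<^sub>R P m x + b *\<^sub>R Q m x)))\<^sup>2 \<partial>lebesgue)
        \<le> 2 * (a\<^sup>2 * (\<integral>x. (norm (F x - P m x))\<^sup>2 \<partial>lebesgue)) + 2 * (b\<^sup>2 * (\<integral>x. (norm (G x - Q m x))\<^sup>2 \<partial>lebesgue))"
        using integral_norm_add_squared_le[OF *, of m m] by (simp add: power_mult_distrib)
    qed
    show "(\<lambda>m. 2 * (a\<^sup>2 * (\<integral>x. (norm (F x - P m x))\<^sup>2 \<partial>lebesgue))
      + 2 * (b\<^sup>2 * (\<integral>x. (norm (G x - Q m x))\<^sup>2 \<partial>lebesgue))) \<longlonglongrightarrow> 0"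
      using that by (auto intro!: tendsto_add_zero tendsto_mult_right_zero)
  qed auto
  have "u \<in> L2 UNIV" "v \<in> L2 UNIV" "g \<in> L2 UNIV" "h \<in> L2 UNIV"
    using assms by (auto simp: sobolev0_def)
  note L = this
  have "(\<lambda>x. a * u x + b * v x) \<in> L2 UNIV" "(\<lambda>x. a *\<^sub>R g x + b *\<^sub>R h x) \<in> L2 UNIV"
    using L2_lincomb[OF L(1,2), of a b] L2_lincomb[OF L(3,4), of a b] by simp_all
  moreover have "\<exists>\<phi>. (\<forall>m::nat. \<phi> m \<in> test_functions U) \<and>
      (\<lambda>m. \<integral>x. (norm ((a * u x + b * v x) - \<phi> m x))\<^sup>2 \<partial>lebesgue) \<longlonglongrightarrow> 0 \<and>
      (\<lambda>m. \<integral>x. (norm ((a *\<^sub>R g x + b *\<^sub>R h x) - gradient (\<phi> m) x))\<^sup>2 \<partial>lebesgue) \<longlonglongrightarrow> 0"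
    using gen[OF L(1,2) test_function_L2(1)[OF \<phi>(1)] test_function_L2(1)[OF \<psi>(1)] \<phi>(2) \<psi>(2)]
      gen[OF L(3,4) test_function_L2(2)[OF \<phi>(1)] test_function_L2(2)[OF \<psi>(1)] \<phi>(3) \<psi>(3)]
      \<phi>(1) \<psi>(1) test_function_lincomb[OF \<phi>(1) \<psi>(1), of a _ b]
    by (intro exI[of _ "\<lambda>m x. a * \<phi> m x + b * \<psi> m x"]) simp
  ultimately show ?thesis using assms by (simp add: sobolev0_def)
qed

text \<open>Integration by parts holds for the approximating test functions and survives
  \<open>L2\<close> limits. Allowing a larger \<open>V\<close> is essential for the application: the
  energy is formed with the weak gradient on the whole domain, while the functions live on the image
  of one cube.\<close>

lemma sobolev0_is_weak_gradient:
  fixes u :: "real^'n::finite \<Rightarrow> real"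
  assumes u: "sobolev0 U u g" and "U \<subseteq> V" "open V"
  shows "is_weak_gradient V u g"
proof -
  have L: "u \<in> L2 UNIV" "g \<in> L2 UNIV" and z: "\<And>x. x \<notin> V \<Longrightarrow> u x = 0 \<and> g x = 0"
    using assms by (auto simp: sobolev0_def)
  obtain \<phi> where \<phi>: "\<And>m::nat. \<phi> m \<in> test_functions U"
    "(\<lambda>m. \<integral>x. (norm (u x - \<phi> m x))\<^sup>2 \<partial>lebesgue) \<longlonglongrightarrow> 0"
    "(\<lambda>m. \<integral>x. (norm (g x - gradient (\<phi> m) x))\<^sup>2 \<partial>lebesgue) \<longlonglongrightarrow> 0"
    using u by (auto simp: sobolev0_def)
  have V: "V \<in> sets lebesgue" using assms by auto
  have e: "(\<lambda>x. if x \<in> V then u x else 0) = u" "(\<lambda>x. if x \<in> V then g x else 0) = g" using z by auto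
  have "(\<integral>x. u x * partial_deriv i \<psi> x \<partial>lebesgue_on V) = - (\<integral>x. g x $ i * \<psi> x \<partial>lebesgue_on V)"
    if \<psi>: "\<psi> \<in> test_functions V" for \<psi> i
  proof -
    have L\<psi>: "(\<lambda>x. partial_deriv i \<psi> x) \<in> L2 UNIV" "(\<lambda>x. \<psi> x *\<^sub>R axis i (1::real)) \<in> L2 UNIV"
    proof -
      obtain K where "compact K" "\<And>x. x \<notin> K \<Longrightarrow> \<psi> x = 0" "\<And>x. x \<notin> K \<Longrightarrow> gradient \<psi> x = 0"
        using test_function_support[OF \<psi>] by metis
      then show "(\<lambda>x. partial_deriv i \<psi> x) \<in> L2 UNIV" "(\<lambda>x. \<psi> x *\<^sub>R axis i (1::real)) \<in> L2 UNIV"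
        using test_function_smooth[OF \<psi>]
        by (auto intro!: L2_continuous_compact_support[of K] continuous_intros smooth_continuous smooth_partial_deriv)
          (metis gradient_component zero_index)
    qed
    have "(\<lambda>m. \<integral>x. \<phi> m x \<bullet> partial_deriv i \<psi> x \<partial>lebesgue) \<longlonglongrightarrow> (\<integral>x. u x \<bullet> partial_deriv i \<psi> x \<partial>lebesgue)"
      using L L\<psi> \<phi> test_function_L2[OF \<phi>(1)] by (intro tendsto_integral_inner_L2) (auto simp: L2_UNIV)
    moreover have "(\<lambda>m. \<integral>x. gradient (\<phi> m) x \<bullet> (\<psi> x *\<^sub>R axis i 1) \<partial>lebesgue) \<longlonglongrightarrow> (\<integral>x. g x \<bullet> (\<psi> x *\<^sub>R axis i 1) \<partial>lebesgue)"
      using L L\<psi> \<phi> test_function_L2[OF \<phi>(1)] by (intro tendsto_integral_inner_L2) (auto simp: L2_UNIV)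
    moreover have "(\<integral>x. \<phi> m x \<bullet> partial_deriv i \<psi> x \<partial>lebesgue)
        = - (\<integral>x. gradient (\<phi> m) x \<bullet> (\<psi> x *\<^sub>R axis i 1) \<partial>lebesgue)" for m
      using integration_by_parts[OF \<phi>(1) \<psi>, of m i] by (simp add: inner_axis gradient_component mult.commute)
    ultimately have "(\<integral>x. u x \<bullet> partial_deriv i \<psi> x \<partial>lebesgue) = - (\<integral>x. g x \<bullet> (\<psi> x *\<^sub>R axis i 1) \<partial>lebesgue)"
      by (intro LIMSEQ_unique[of "\<lambda>m. \<integral>x. \<phi> m x \<bullet> partial_deriv i \<psi> x \<partial>lebesgue"]) (simp_all add: tendsto_minus)
    moreover have "(\<lambda>x. if x \<in> V then u x * partial_deriv i \<psi> x else 0) = (\<lambda>x. u x \<bullet> partial_deriv i \<psi> x)"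
      "(\<lambda>x. if x \<in> V then g x $ i * \<psi> x else 0) = (\<lambda>x. g x \<bullet> (\<psi> x *\<^sub>R axis i 1))"
      using z by (auto simp: inner_axis fun_eq_iff)
    ultimately show ?thesis by (simp add: integral_lebesgue_on[OF V])
  qed
  then show ?thesis using L unfolding is_weak_gradient_def L2_zero_extension[OF V, of u] L2_zero_extension[OF V, of g] e by simp
qed

text \<open>The fundamental lemma applied to each component. It removes the ambiguity in
  \<open>weak_gradient\<close>, which is defined by a choice.\<close>

lemma weak_gradient_unique:
  fixes u :: "real^'n::finite \<Rightarrow> real"
  assumes "open V" "is_weak_gradient V u g" "is_weak_gradient V u h"
  shows "AE x in lebesgue. x \<in> V \<longrightarrow> g x = h x"
proof -
  have V: "V \<in> sets lebesgue" using assms by auto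
  let ?g = "\<lambda>x. if x \<in> V then g x else 0" and ?h = "\<lambda>x. if x \<in> V then h x else 0"
  have L: "?g \<in> L2 UNIV" "?h \<in> L2 UNIV"
    using assms L2_zero_extension[OF V] by (auto simp: is_weak_gradient_def)
  have "AE x in lebesgue. x \<in> V \<longrightarrow> ?g x $ i - ?h x $ i = 0" for i
  proof (rule fundamental_lemma[OF assms(1)])
    show "(\<lambda>x. ?g x $ i - ?h x $ i) \<in> L2 UNIV" using L by (intro L2_diff L2_component)
    fix \<phi> assume \<phi>: "\<phi> \<in> test_functions V"
    have "(\<integral>x. g x $ i * \<phi> x \<partial>lebesgue_on V) = (\<integral>x. h x $ i * \<phi> x \<partial>lebesgue_on V)"
      using assms(2,3) \<phi> by (auto simp: is_weak_gradient_def)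
    moreover have "(\<lambda>x. if x \<in> V then g x $ i * \<phi> x else 0) = (\<lambda>x. ?g x $ i * \<phi> x)" "(\<lambda>x. if x \<in> V then h x $ i * \<phi> x else 0) = (\<lambda>x. ?h x $ i * \<phi> x)"
      by auto
    moreover have "integrable lebesgue (\<lambda>x. ?g x $ i * \<phi> x)" "integrable lebesgue (\<lambda>x. ?h x $ i * \<phi> x)"
      using L2_inner[OF L2_component[OF L(1)] test_function_L2(1)[OF \<phi>]]
        L2_inner[OF L2_component[OF L(2)] test_function_L2(1)[OF \<phi>]] by simp_all
    ultimately show "(\<integral>x. (?g x $ i - ?h x $ i) * \<phi> x \<partial>lebesgue) = 0"
      by (simp add: integral_lebesgue_on[OF V] left_diff_distrib)
  qed
  then have "AE x in lebesgue. \<forall>i\<in>UNIV. x \<in> V \<longrightarrow> ?g x $ i - ?h x $ i = 0"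
    by (intro AE_finite_allI) auto
  then show ?thesis by eventually_elim (auto simp: vec_eq_iff)
qed

lemma weak_gradient_works: "u \<in> H1 V \<Longrightarrow> is_weak_gradient V u (weak_gradient V u)"
  unfolding H1_def weak_gradient_def mem_Collect_eq by (rule someI_ex[of "is_weak_gradient V u"])

lemma sobolev0_weak_gradient:
  fixes u :: "real^'n::finite \<Rightarrow> real"
  assumes "sobolev0 U u g" "U \<subseteq> V" "open V"
  shows "AE x in lebesgue. x \<in> V \<longrightarrow> weak_gradient V u x = g x"
proof -
  have g: "is_weak_gradient V u g" using sobolev0_is_weak_gradient[OF assms] .
  then have "u \<in> H1 V" by (auto simp: H1_def)
  from weak_gradient_unique[OF assms(3) weak_gradient_works[OF this] g] show ?thesis .
qed

lemma integral_weak_gradient_squared: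
  fixes u :: "real^'n::finite \<Rightarrow> real"
  assumes u: "sobolev0 U u g" and "U \<subseteq> V" "open V"
  shows "(\<integral>x. (norm (weak_gradient V u x))\<^sup>2 \<partial>lebesgue_on V) = (\<integral>x. (norm (g x))\<^sup>2 \<partial>lebesgue)"
proof -
  have V: "V \<in> sets lebesgue" using assms by auto
  have z: "\<And>x. x \<notin> V \<Longrightarrow> g x = 0" using assms by (auto simp: sobolev0_def)
  have g: "is_weak_gradient V u g" using sobolev0_is_weak_gradient[OF assms] .
  then have "weak_gradient V u \<in> L2 V"
    using weak_gradient_works[of u V] by (auto simp: H1_def is_weak_gradient_def)
  then have w: "(\<lambda>x. if x \<in> V then weak_gradient V u x else 0) \<in> L2 UNIV" using L2_zero_extension[OF V] by auto
  have e: "(if x \<in> V then (norm (weak_gradient V u x))\<^sup>2 else 0) = (norm (if x \<in> V then weak_gradient V u x else 0))\<^sup>2" for x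
    by simp
  show ?thesis unfolding integral_lebesgue_on[OF V] e
  proof (rule integral_cong_AE)
    show "AE x in lebesgue. (norm (if x \<in> V then weak_gradient V u x else 0))\<^sup>2 = (norm (g x))\<^sup>2"
      using sobolev0_weak_gradient[OF assms] by eventually_elim (auto simp: z)
    show "(\<lambda>x. (norm (if x \<in> V then weak_gradient V u x else 0))\<^sup>2) \<in> borel_measurable lebesgue"
      using w by (auto simp: L2_UNIV)
    show "(\<lambda>x. (norm (g x))\<^sup>2) \<in> borel_measurable lebesgue" using u by (auto simp: sobolev0_def L2_UNIV)
  qed
qed

lemma integral_weak_gradient_inner:
  fixes u :: "real^'n::finite \<Rightarrow> real"
  assumes u: "sobolev0 U u g" and v: "sobolev0 U v h" and U: "open U"
  shows "(\<integral>x. weak_gradient U u x \<bullet> weak_gradient U v x \<partial>lebesgue_on U) = (\<integral>x. g x \<bullet> h x \<partial>lebesgue)"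
proof -
  have V: "U \<in> sets lebesgue" using assms by auto
  have z: "\<And>x. x \<notin> U \<Longrightarrow> g x = 0" using assms by (auto simp: sobolev0_def)
  have w: "(\<lambda>x. if x \<in> U then weak_gradient U u x else 0) \<in> borel_measurable lebesgue"
    if "sobolev0 U u g" for u g
  proof -
    have "is_weak_gradient U u g" using sobolev0_is_weak_gradient[OF that _ U] by simp
    then have "weak_gradient U u \<in> L2 U"
      using weak_gradient_works[of u U] by (auto simp: H1_def is_weak_gradient_def)
    then show ?thesis using L2_zero_extension[OF V] by (auto simp: L2_UNIV)
  qed
  have e: "(if x \<in> U then weak_gradient U u x \<bullet> weak_gradient U v x else 0)
    = (if x \<in> U then weak_gradient U u x else 0) \<bullet> (if x \<in> U then weak_gradient U v x else 0)" for x
    by simp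
  show ?thesis unfolding integral_lebesgue_on[OF V] e
  proof (rule integral_cong_AE)
    show "AE x in lebesgue. (if x \<in> U then weak_gradient U u x else 0) \<bullet> (if x \<in> U then weak_gradient U v x else 0) = g x \<bullet> h x"
      using sobolev0_weak_gradient[OF u _ U, simplified] sobolev0_weak_gradient[OF v _ U, simplified]
      by eventually_elim (auto simp: z)
    show "(\<lambda>x. g x \<bullet> h x) \<in> borel_measurable lebesgue"
      using u v by (auto simp: sobolev0_def L2_UNIV)
  qed (intro borel_measurable_inner w[OF u] w[OF v])
qed

text \<open>From here on a member of \<open>H10\<close> comes with a concrete gradient that is
  \<open>0\<close> outside \<open>U\<close>, instead of the chosen one. The two agree almost
  everywhere on \<open>U\<close>, so the approximation conditions coincide.\<close>

lemma H10_iff_sobolev0: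
  fixes u :: "real^'n::finite \<Rightarrow> real"
  assumes U: "open U"
  shows "u \<in> H10 U \<longleftrightarrow> (\<exists>g. sobolev0 U u g)"
proof
  have V: "U \<in> sets lebesgue" using assms by auto
  {
    fix u g \<phi> assume g: "is_weak_gradient U u g" and \<phi>: "\<phi> \<in> test_functions U" and z: "\<forall>x. x \<notin> U \<longrightarrow> u x = 0"
    have "(\<lambda>x. if x \<in> U then (u x - \<phi> x)\<^sup>2 else 0) = (\<lambda>x. (norm (u x - \<phi> x))\<^sup>2)"
      "(\<lambda>x. if x \<in> U then (norm (g x - gradient \<phi> x))\<^sup>2 else 0)
        = (\<lambda>x. (norm ((if x \<in> U then g x else 0) - gradient \<phi> x))\<^sup>2)"
      using test_function_zero[OF \<phi>] z by (auto simp: fun_eq_iff)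
    then have "(\<integral>x. (u x - \<phi> x)\<^sup>2 \<partial>lebesgue_on U) = (\<integral>x. (norm (u x - \<phi> x))\<^sup>2 \<partial>lebesgue)"
      "(\<integral>x. (norm (g x - gradient \<phi> x))\<^sup>2 \<partial>lebesgue_on U)
        = (\<integral>x. (norm ((if x \<in> U then g x else 0) - gradient \<phi> x))\<^sup>2 \<partial>lebesgue)"
      unfolding integral_lebesgue_on[OF V] by simp_all
  } note eq = this
  {
    assume u: "u \<in> H10 U"
    let ?g = "weak_gradient U u"
    have z: "\<forall>x. x \<notin> U \<longrightarrow> u x = 0" and g: "is_weak_gradient U u ?g"
      using u weak_gradient_works by (auto simp: H10_def)
    obtain \<phi> where \<phi>: "\<And>m::nat. \<phi> m \<in> test_functions U"
      and lim: "(\<lambda>m. (\<integral>x. (u x - \<phi> m x)\<^sup>2 \<partial>lebesgue_on U)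
            + (\<integral>x. (norm (?g x - gradient (\<phi> m) x))\<^sup>2 \<partial>lebesgue_on U)) \<longlonglongrightarrow> 0"
      using u by (auto simp: H10_def)
    let ?A = "\<lambda>m. (\<integral>x. (norm (u x - \<phi> m x))\<^sup>2 \<partial>lebesgue)"
    let ?B = "\<lambda>m. (\<integral>x. (norm ((if x \<in> U then ?g x else 0) - gradient (\<phi> m) x))\<^sup>2 \<partial>lebesgue)"
    have lim: "(\<lambda>m. ?A m + ?B m) \<longlonglongrightarrow> 0"
      using lim unfolding eq[OF g \<phi> z] .
    \<comment> \<open>Both terms are nonnegative, hence each is squeezed between \<open>0\<close>
      and their sum.\<close>
    have "?A \<longlonglongrightarrow> 0" "?B \<longlonglongrightarrow> 0"
      by (rule tendsto_sandwich[OF _ _ tendsto_const lim]; simp)+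
    moreover have "(\<lambda>x. if x \<in> U then u x else 0) = u" using z by auto
    then have "u \<in> L2 UNIV" "(\<lambda>x. if x \<in> U then ?g x else 0) \<in> L2 UNIV"
      using g L2_zero_extension[OF V, of u] L2_zero_extension[OF V, of ?g] by (auto simp: is_weak_gradient_def)
    ultimately have "sobolev0 U u (\<lambda>x. if x \<in> U then ?g x else 0)"
      unfolding sobolev0_def using z \<phi> by auto
    then show "\<exists>g. sobolev0 U u g" by blast
  }
  assume "\<exists>g. sobolev0 U u g"
  then obtain g where s: "sobolev0 U u g" by blast
  then have z: "\<forall>x. x \<notin> U \<longrightarrow> u x = 0 \<and> g x = 0" by (auto simp: sobolev0_def)
  have g: "is_weak_gradient U u g" using sobolev0_is_weak_gradient[OF s _ U] by simp
  then have h: "u \<in> H1 U" by (auto simp: H1_def)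
  then have w: "is_weak_gradient U u (weak_gradient U u)" by (rule weak_gradient_works)
  obtain \<phi> where \<phi>: "\<And>m::nat. \<phi> m \<in> test_functions U"
    "(\<lambda>m. \<integral>x. (norm (u x - \<phi> m x))\<^sup>2 \<partial>lebesgue) \<longlonglongrightarrow> 0"
    "(\<lambda>m. \<integral>x. (norm (g x - gradient (\<phi> m) x))\<^sup>2 \<partial>lebesgue) \<longlonglongrightarrow> 0"
    using s by (auto simp: sobolev0_def)
  let ?w = "\<lambda>x. if x \<in> U then weak_gradient U u x else 0"
  have "(\<integral>x. (norm (?w x - gradient (\<phi> m) x))\<^sup>2 \<partial>lebesgue) = (\<integral>x. (norm (g x - gradient (\<phi> m) x))\<^sup>2 \<partial>lebesgue)" for m
  proof (rule integral_cong_AE)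
    have "?w \<in> L2 UNIV" using w L2_zero_extension[OF V] by (auto simp: is_weak_gradient_def)
    then show "(\<lambda>x. (norm (?w x - gradient (\<phi> m) x))\<^sup>2) \<in> borel_measurable lebesgue"
      using borel_measurable_integrable L2_diff[OF _ test_function_L2(2)[OF \<phi>(1)[of m]], of ?w]
      unfolding L2_UNIV by blast
    show "(\<lambda>x. (norm (g x - gradient (\<phi> m) x))\<^sup>2) \<in> borel_measurable lebesgue"
      using s test_function_L2(2)[OF \<phi>(1)[of m]] by (auto simp: L2_UNIV sobolev0_def)
    show "AE x in lebesgue. (norm (?w x - gradient (\<phi> m) x))\<^sup>2 = (norm (g x - gradient (\<phi> m) x))\<^sup>2"
      using sobolev0_weak_gradient[OF s _ U, simplified] by eventually_elim (use z in auto)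
  qed
  with \<phi>(3) have "(\<lambda>m. \<integral>x. (norm (?w x - gradient (\<phi> m) x))\<^sup>2 \<partial>lebesgue) \<longlonglongrightarrow> 0" by simp
  from tendsto_add[OF \<phi>(2) this]
  have "(\<lambda>m. (\<integral>x. (u x - \<phi> m x)\<^sup>2 \<partial>lebesgue_on U)
            + (\<integral>x. (norm (weak_gradient U u x - gradient (\<phi> m) x))\<^sup>2 \<partial>lebesgue_on U)) \<longlonglongrightarrow> 0"
    unfolding eq[OF w \<phi>(1)] using eq[OF w \<phi>(1)] z by simp
  then show "u \<in> H10 U" using h z \<phi>(1) unfolding H10_def by blast
qed

section \<open>Smooth truncation of Sobolev functions\<close>

lemma gradient_soft_pos:
  assumes "\<delta> > 0" "smooth \<phi>"
  shows "gradient (\<lambda>x. soft_pos \<delta> (\<phi> x)) x = soft_pos' \<delta> (\<phi> x) *\<^sub>R gradient \<phi> x"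
proof (rule gradient_eqI)
  have "((\<lambda>x. soft_pos \<delta> (\<phi> x)) has_derivative (\<lambda>h. (gradient \<phi> x \<bullet> h) * soft_pos' \<delta> (\<phi> x))) (at x)"
    by (rule DERIV_compose_FDERIV[OF soft_pos_deriv[OF assms(1)] smooth_has_derivative[OF assms(2)]])
  then show "((\<lambda>x. soft_pos \<delta> (\<phi> x)) has_derivative (\<lambda>h. (soft_pos' \<delta> (\<phi> x) *\<^sub>R gradient \<phi> x) \<bullet> h)) (at x)"
    by (simp add: mult.commute)
qed

text \<open>Pointwise convergence is what permits limits inside nonlinear expressions: the slope in
  \<open>sobolev0_soft_pos\<close> and the power in \<open>Sobolev_inequality\<close>.\<close>

lemma L2_AE_subsequence:
  fixes u :: "real^'n::finite \<Rightarrow> real"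
  assumes "u \<in> L2 UNIV" "\<And>m. \<phi> m \<in> L2 UNIV"
    "(\<lambda>m. \<integral>x. (norm (u x - \<phi> m x))\<^sup>2 \<partial>lebesgue) \<longlonglongrightarrow> 0"
  obtains r :: "nat \<Rightarrow> nat" where "strict_mono r" "AE x in lebesgue. (\<lambda>m. \<phi> (r m) x) \<longlonglongrightarrow> u x"
proof -
  obtain r :: "nat \<Rightarrow> nat" where r: "strict_mono r" "AE x in lebesgue. (\<lambda>m. (norm (u x - \<phi> (r m) x))\<^sup>2) \<longlonglongrightarrow> 0"
    using tendsto_L1_AE_subseq[of lebesgue "\<lambda>m x. (norm (u x - \<phi> m x))\<^sup>2"] L2_diff[OF assms(1,2)] assms(3)
    by (auto simp: L2_UNIV)
  from r(2) have "AE x in lebesgue. (\<lambda>m. \<phi> (r m) x) \<longlonglongrightarrow> u x"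
  proof eventually_elim
    case (elim x)
    then have "(\<lambda>m. sqrt ((norm (u x - \<phi> (r m) x))\<^sup>2)) \<longlonglongrightarrow> sqrt 0" by (rule tendsto_real_sqrt)
    then have "(\<lambda>m. u x - \<phi> (r m) x) \<longlonglongrightarrow> 0" by (simp add: tendsto_rabs_zero_iff)
    from tendsto_diff[OF tendsto_const[of "u x"] this] show ?case by simp
  qed
  with r(1) show thesis by (rule that)
qed

text \<open>Truncating the approximating test functions gives test functions again, since
  \<open>soft_pos\<close> is smooth and vanishes at \<open>0\<close>. Values converge by the
  Lipschitz bound. The gradient error splits into a part controlled by the slope bound
  \<open>1\<close> and the part \<open>?d\<close>, which tends to \<open>0\<close> by dominated
  convergence along an almost everywhere convergent subsequence.\<close>

lemma sobolev0_soft_pos: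
  fixes u :: "real^'n::finite \<Rightarrow> real"
  assumes \<delta>: "\<delta> > 0" and u: "sobolev0 U u g"
  shows "sobolev0 U (\<lambda>x. soft_pos \<delta> (u x)) (\<lambda>x. soft_pos' \<delta> (u x) *\<^sub>R g x)"
proof -
  let ?\<beta> = "soft_pos \<delta>" and ?\<beta>' = "soft_pos' \<delta>"
  have L: "u \<in> L2 UNIV" "g \<in> L2 UNIV" and z: "\<And>x. x \<notin> U \<Longrightarrow> u x = 0 \<and> g x = 0"
    using u by (auto simp: sobolev0_def)
  obtain \<phi>\<^sub>0 where \<phi>\<^sub>0: "\<And>m::nat. \<phi>\<^sub>0 m \<in> test_functions U"
    "(\<lambda>m. \<integral>x. (norm (u x - \<phi>\<^sub>0 m x))\<^sup>2 \<partial>lebesgue) \<longlonglongrightarrow> 0"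
    "(\<lambda>m. \<integral>x. (norm (g x - gradient (\<phi>\<^sub>0 m) x))\<^sup>2 \<partial>lebesgue) \<longlonglongrightarrow> 0"
    using u by (auto simp: sobolev0_def)
  obtain r :: "nat \<Rightarrow> nat" where r: "strict_mono r" "AE x in lebesgue. (\<lambda>m. \<phi>\<^sub>0 (r m) x) \<longlonglongrightarrow> u x"
    using L2_AE_subsequence[OF L(1) test_function_L2(1)[OF \<phi>\<^sub>0(1)] \<phi>\<^sub>0(2)] by blast
  define \<phi> where "\<phi> = (\<lambda>m. \<phi>\<^sub>0 (r m))"
  have \<phi>: "\<And>m. \<phi> m \<in> test_functions U"
    "(\<lambda>m. \<integral>x. (norm (u x - \<phi> m x))\<^sup>2 \<partial>lebesgue) \<longlonglongrightarrow> 0"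
    "(\<lambda>m. \<integral>x. (norm (g x - gradient (\<phi> m) x))\<^sup>2 \<partial>lebesgue) \<longlonglongrightarrow> 0"
    "AE x in lebesgue. (\<lambda>m. \<phi> m x) \<longlonglongrightarrow> u x"
    using \<phi>\<^sub>0 r LIMSEQ_subseq_LIMSEQ[OF \<phi>\<^sub>0(2) r(1)] LIMSEQ_subseq_LIMSEQ[OF \<phi>\<^sub>0(3) r(1)]
    by (auto simp: \<phi>_def o_def)
  have \<beta>0: "?\<beta> 0 = 0" by (simp add: soft_pos_def)
  have test: "(\<lambda>x. ?\<beta> (\<phi> m x)) \<in> test_functions U" for m
  proof -
    obtain K where "compact K" "K \<subseteq> U" "\<And>x. x \<notin> K \<Longrightarrow> \<phi> m x = 0"
      using test_function_support[OF \<phi>(1)] by metis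
    then show ?thesis using \<delta> test_function_smooth[OF \<phi>(1)[of m]]
      by (intro test_functionI[of _ K] smooth_soft_pos) (auto simp: \<beta>0)
  qed
  have grad: "gradient (\<lambda>x. ?\<beta> (\<phi> m x)) x = ?\<beta>' (\<phi> m x) *\<^sub>R gradient (\<phi> m) x" for m x
    by (rule gradient_soft_pos[OF \<delta> test_function_smooth[OF \<phi>(1)]])
  have \<beta>m: "?\<beta> \<in> borel_measurable borel" "?\<beta>' \<in> borel_measurable borel"
    using DERIV_continuous_on[of UNIV ?\<beta> ?\<beta>'] soft_pos_deriv[OF \<delta>] continuous_soft_pos'[OF \<delta>]
    by (simp_all add: borel_measurable_continuous_onI)
  have um: "u \<in> borel_measurable lebesgue" using L by (simp add: L2_UNIV)
  have \<beta>'1: "\<bar>?\<beta>' s\<bar> \<le> 1" for s using soft_pos'_bounds[OF \<delta>, of s] by auto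
  have L\<beta>: "(\<lambda>x. ?\<beta> (u x)) \<in> L2 UNIV"
  proof -
    have "integrable lebesgue (\<lambda>x. (?\<beta> (u x))\<^sup>2)"
    proof (rule Bochner_Integration.integrable_bound)
      show "integrable lebesgue (\<lambda>x. (u x)\<^sup>2)" using L by (simp add: L2_UNIV)
      show "(\<lambda>x. (?\<beta> (u x))\<^sup>2) \<in> borel_measurable lebesgue"
        using measurable_compose[OF um \<beta>m(1)] by simp
      show "AE x in lebesgue. norm ((?\<beta> (u x))\<^sup>2) \<le> norm ((u x)\<^sup>2)"
        using soft_pos_lipschitz[OF \<delta>, of _ 0] by (intro AE_I2) (simp add: \<beta>0 abs_le_square_iff[symmetric])
    qed
    then show ?thesis using measurable_compose[OF um \<beta>m(1)] by (simp add: L2_UNIV)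
  qed
  have Lm: "(\<lambda>x. ?\<beta>' (v x) *\<^sub>R h x) \<in> L2 UNIV" if "v \<in> borel_measurable lebesgue" "h \<in> L2 UNIV" for v and h :: "real^'n \<Rightarrow> real^'n"
  proof -
    have m: "(\<lambda>x. ?\<beta>' (v x) *\<^sub>R h x) \<in> borel_measurable lebesgue"
      using measurable_compose[OF that(1) \<beta>m(2)] that(2) by (auto simp: L2_UNIV)
    have "integrable lebesgue (\<lambda>x. (norm (?\<beta>' (v x) *\<^sub>R h x))\<^sup>2)"
    proof (rule Bochner_Integration.integrable_bound)
      show "integrable lebesgue (\<lambda>x. (norm (h x))\<^sup>2)" using that by (simp add: L2_UNIV)
      show "AE x in lebesgue. norm ((norm (?\<beta>' (v x) *\<^sub>R h x))\<^sup>2) \<le> norm ((norm (h x))\<^sup>2)"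
        using \<beta>'1 by (intro AE_I2) (auto intro!: power_mono mult_left_le_one_le)
    qed (use m in measurable)
    with m show ?thesis by (simp add: L2_UNIV)
  qed
  have l1: "(\<lambda>m. \<integral>x. (norm (?\<beta> (u x) - ?\<beta> (\<phi> m x)))\<^sup>2 \<partial>lebesgue) \<longlonglongrightarrow> 0"
  proof (rule tendsto_sandwich[OF _ _ tendsto_const \<phi>(2)])
    show "\<forall>\<^sub>F m in sequentially. (\<integral>x. (norm (?\<beta> (u x) - ?\<beta> (\<phi> m x)))\<^sup>2 \<partial>lebesgue)
        \<le> (\<integral>x. (norm (u x - \<phi> m x))\<^sup>2 \<partial>lebesgue)"
    proof (intro always_eventually allI integral_mono)
      fix m
      show "integrable lebesgue (\<lambda>x. (norm (?\<beta> (u x) - ?\<beta> (\<phi> m x)))\<^sup>2)"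
        using L2_diff[OF L\<beta> test_function_L2(1)[OF test[of m]]] by (simp add: L2_UNIV)
      show "integrable lebesgue (\<lambda>x. (norm (u x - \<phi> m x))\<^sup>2)"
        using L2_diff[OF L(1) test_function_L2(1)[OF \<phi>(1)[of m]]] by (simp add: L2_UNIV)
      show "(norm (?\<beta> (u x) - ?\<beta> (\<phi> m x)))\<^sup>2 \<le> (norm (u x - \<phi> m x))\<^sup>2" for x
        using soft_pos_lipschitz[OF \<delta>] by (intro power_mono) auto
    qed
  qed simp
  let ?d = "\<lambda>m x. (?\<beta>' (u x) - ?\<beta>' (\<phi> m x)) *\<^sub>R g x"
  have Lg: "(\<lambda>x. ?\<beta>' (\<phi> m x) *\<^sub>R g x) \<in> L2 UNIV" "(\<lambda>x. ?\<beta>' (u x) *\<^sub>R g x) \<in> L2 UNIV" "?d m \<in> L2 UNIV" for m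
  proof -
    show "(\<lambda>x. ?\<beta>' (\<phi> m x) *\<^sub>R g x) \<in> L2 UNIV" "(\<lambda>x. ?\<beta>' (u x) *\<^sub>R g x) \<in> L2 UNIV"
      using um L test_function_L2(1)[OF \<phi>(1)[of m]] by (intro Lm; simp add: L2_UNIV)+
    from L2_diff[OF this(2,1)] show "?d m \<in> L2 UNIV" by (simp add: scaleR_left_diff_distrib)
  qed
  have l2: "(\<lambda>m. \<integral>x. (norm (?d m x))\<^sup>2 \<partial>lebesgue) \<longlonglongrightarrow> (\<integral>x. 0 \<partial>(lebesgue :: (real^'n) measure))"
  proof (rule integral_dominated_convergence)
    show "integrable lebesgue (\<lambda>x. 4 * (norm (g x))\<^sup>2)" using L by (simp add: L2_UNIV)
    show "(\<lambda>x. (norm (?d m x))\<^sup>2) \<in> borel_measurable lebesgue" for m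
      using Lg(3)[of m] unfolding L2_UNIV by (blast intro: borel_measurable_integrable)
    show "AE x in lebesgue. (\<lambda>m. (norm (?d m x))\<^sup>2) \<longlonglongrightarrow> 0"
      using \<phi>(4)
    proof eventually_elim
      case (elim x)
      have "isCont ?\<beta>' (u x)"
        using continuous_soft_pos'[OF \<delta>] by (simp add: continuous_on_eq_continuous_at)
      then have "(\<lambda>m. ?\<beta>' (\<phi> m x)) \<longlonglongrightarrow> ?\<beta>' (u x)" using elim by (rule isCont_tendsto_compose)
      then have "(\<lambda>m. (norm (?d m x))\<^sup>2) \<longlonglongrightarrow> (norm ((?\<beta>' (u x) - ?\<beta>' (u x)) *\<^sub>R g x))\<^sup>2"
        by (intro tendsto_intros)
      then show ?case by simp
    qed
    show "AE x in lebesgue. norm ((norm (?d m x))\<^sup>2) \<le> 4 * (norm (g x))\<^sup>2" for m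
    proof (intro AE_I2)
      fix x
      have "\<bar>?\<beta>' (u x) - ?\<beta>' (\<phi> m x)\<bar> \<le> 2"
        using \<beta>'1[of "u x"] \<beta>'1[of "\<phi> m x"] by linarith
      then have "norm (?d m x) \<le> 2 * norm (g x)" by (simp add: mult_right_mono)
      then have "(norm (?d m x))\<^sup>2 \<le> (2 * norm (g x))\<^sup>2" by (intro power_mono) auto
      then show "norm ((norm (?d m x))\<^sup>2) \<le> 4 * (norm (g x))\<^sup>2" by (simp add: power_mult_distrib)
    qed
  qed simp
  have l3: "(\<lambda>m. \<integral>x. (norm (?\<beta>' (u x) *\<^sub>R g x - gradient (\<lambda>x. ?\<beta> (\<phi> m x)) x))\<^sup>2 \<partial>lebesgue) \<longlonglongrightarrow> 0"
  proof (rule tendsto_sandwich[OF _ _ tendsto_const])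
    let ?e = "\<lambda>m x. ?\<beta>' (\<phi> m x) *\<^sub>R (g x - gradient (\<phi> m) x)"
    have Ld: "(\<lambda>x. g x - gradient (\<phi> m) x) \<in> L2 UNIV" for m
      by (intro L2_diff L test_function_L2(2)[OF \<phi>(1)])
    have Le: "?e m \<in> L2 UNIV" for m
      using Ld[of m] test_function_L2(1)[OF \<phi>(1)[of m]] by (intro Lm) (auto simp: L2_UNIV)
    show "\<forall>\<^sub>F m in sequentially. (\<integral>x. (norm (?\<beta>' (u x) *\<^sub>R g x - gradient (\<lambda>x. ?\<beta> (\<phi> m x)) x))\<^sup>2 \<partial>lebesgue)
      \<le> 2 * (\<integral>x. (norm (?d m x))\<^sup>2 \<partial>lebesgue) + 2 * (\<integral>x. (norm (g x - gradient (\<phi> m) x))\<^sup>2 \<partial>lebesgue)"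
    proof (intro always_eventually allI)
      fix m
      have "?\<beta>' (u x) *\<^sub>R g x - gradient (\<lambda>x. ?\<beta> (\<phi> m x)) x = ?d m x + ?e m x" for x
        by (simp add: grad algebra_simps)
      then have "(\<integral>x. (norm (?\<beta>' (u x) *\<^sub>R g x - gradient (\<lambda>x. ?\<beta> (\<phi> m x)) x))\<^sup>2 \<partial>lebesgue)
        \<le> 2 * (\<integral>x. (norm (?d m x))\<^sup>2 \<partial>lebesgue) + 2 * (\<integral>x. (norm (?e m x))\<^sup>2 \<partial>lebesgue)"
        using integral_norm_add_squared_le[OF Lg(3)[of m] Le[of m]] by simp
      moreover have "(\<integral>x. (norm (?e m x))\<^sup>2 \<partial>lebesgue) \<le> (\<integral>x. (norm (g x - gradient (\<phi> m) x))\<^sup>2 \<partial>lebesgue)"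
        using Le[of m] Ld[of m] \<beta>'1
        by (intro integral_mono) (auto simp: L2_UNIV intro!: power_mono mult_left_le_one_le)
      ultimately show "(\<integral>x. (norm (?\<beta>' (u x) *\<^sub>R g x - gradient (\<lambda>x. ?\<beta> (\<phi> m x)) x))\<^sup>2 \<partial>lebesgue)
        \<le> 2 * (\<integral>x. (norm (?d m x))\<^sup>2 \<partial>lebesgue) + 2 * (\<integral>x. (norm (g x - gradient (\<phi> m) x))\<^sup>2 \<partial>lebesgue)"
        by linarith
    qed
    show "(\<lambda>m. 2 * (\<integral>x. (norm (?d m x))\<^sup>2 \<partial>lebesgue) + 2 * (\<integral>x. (norm (g x - gradient (\<phi> m) x))\<^sup>2 \<partial>lebesgue)) \<longlonglongrightarrow> 0"
      using l2 \<phi>(3) by (auto intro!: tendsto_add_zero tendsto_mult_right_zero)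
  qed simp
  show ?thesis unfolding sobolev0_def
    using L\<beta> Lg(2) z \<beta>0 test l1 l3 by (auto intro!: exI[of _ "\<lambda>m x. ?\<beta> (\<phi> m x)"])
qed

section \<open>The Sobolev inequality\<close>

lemma nn_integral_affine_lborel:
  fixes f :: "'a::euclidean_space \<Rightarrow> ennreal"
  assumes [measurable]: "f \<in> borel_measurable borel" and r: "r > 0"
  shows "(\<integral>\<^sup>+e. f (x + r *\<^sub>R e) \<partial>lborel) = ennreal (1 / r ^ DIM('a)) * (\<integral>\<^sup>+y. f y \<partial>lborel)"
proof -
  have "(\<integral>\<^sup>+y. f y \<partial>lborel)
      = (\<integral>\<^sup>+y. f y \<partial>density (distr lborel borel (\<lambda>e. x + r *\<^sub>R e)) (\<lambda>_. \<bar>r\<bar> ^ DIM('a)))"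
    using r by (subst lborel_affine[of r x]) auto
  also have "\<dots> = ennreal (r ^ DIM('a)) * (\<integral>\<^sup>+e. f (x + r *\<^sub>R e) \<partial>lborel)"
    using r by (simp add: nn_integral_density nn_integral_distr nn_integral_cmult)
  finally have "ennreal (1 / r ^ DIM('a)) * (\<integral>\<^sup>+y. f y \<partial>lborel)
      = ennreal (1 / r ^ DIM('a)) * ennreal (r ^ DIM('a)) * (\<integral>\<^sup>+e. f (x + r *\<^sub>R e) \<partial>lborel)"
    by (simp add: mult.assoc)
  then show ?thesis using r by (simp add: ennreal_mult[symmetric])
qed

text \<open>The concave function \<open>y powr (1 / q)\<close> lies below its tangent at
  \<open>m\<close>. A bound linear in \<open>y\<close> can be integrated term by term, and so plays
  the role of Jensen's inequality in the Sobolev estimate.\<close>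

lemma tangent_powr:
  fixes y m q :: real
  assumes "y \<ge> 0" "m > 0" "q > 1"
  shows "y powr (1 / q) \<le> (1 / q) * y * m powr (1 / q - 1) + (1 - 1 / q) * m powr (1 / q)"
proof (cases "y = 0")
  case True
  then show ?thesis using assms by simp
next
  case False
  have "y powr (1 / q) * m powr (1 - 1 / q) \<le> 1 / q * y + (1 - 1 / q) * m"
    using assms False by (intro Youngs_inequality_0) auto
  then have "y powr (1 / q) * m powr (1 - 1 / q) * m powr (1 / q - 1)
      \<le> (1 / q * y + (1 - 1 / q) * m) * m powr (1 / q - 1)"
    by (intro mult_right_mono) auto
  moreover have "m powr (1 - 1 / q) * m powr (1 / q - 1) = 1" "m * m powr (1 / q - 1) = m powr (1 / q)"
    using assms by (simp_all flip: powr_add add: powr_mult_base)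
  ultimately show ?thesis by (simp add: algebra_simps)
qed

text \<open>Only the factor \<open>y powr (1/2 - 1/q)\<close> of the square root is estimated by the
  crude bound on \<open>y\<close>; the rest is kept. This is the origin of the singular weight with
  exponent \<open>n (1/2 - 1/q)\<close>.\<close>

lemma powr_half_split:
  fixes y G r q :: real
  assumes "0 \<le> y" "y \<le> (1 / r ^ n) * G" "r > 0" "q > 2" "0 \<le> G"
  shows "sqrt y \<le> r powr - (n * (1/2 - 1/q)) * G powr (1/2 - 1/q) * y powr (1 / q)"
proof -
  have "sqrt y = y powr (1/2 - 1/q) * y powr (1/q)"
    using assms by (simp flip: powr_add add: powr_half_sqrt)
  also have "\<dots> \<le> ((1 / r ^ n) * G) powr (1/2 - 1/q) * y powr (1/q)"
    using assms by (intro mult_right_mono powr_mono2) (auto simp: field_simps)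
  also have "((1 / r ^ n) * G) powr (1/2 - 1/q) = r powr - (n * (1/2 - 1/q)) * G powr (1/2 - 1/q)"
  proof -
    have "1 / r ^ n = r powr - real n" using assms by (simp add: powr_minus powr_realpow field_simps)
    then show ?thesis using assms by (simp add: powr_mult powr_powr)
  qed
  finally show ?thesis .
qed

text \<open>Integrability of the weight at \<open>0\<close> is the point where
  \<open>\<alpha> < 1\<close>, and thereby subcriticality, enters. The value tends to
  \<open>0\<close> with \<open>R\<close>.\<close>

lemma nn_integral_powr:
  assumes "\<alpha> < 1" "R > 0"
  shows "(\<integral>\<^sup>+r. ennreal (r powr - \<alpha>) * indicator {0<..<R} r \<partial>lborel) = ennreal (R powr (1 - \<alpha>) / (1 - \<alpha>))"
proof -
  have "((\<lambda>r. r powr - \<alpha>) has_integral R powr (- \<alpha> + 1) / (- \<alpha> + 1)) {0..R}"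
    using assms by (intro has_integral_powr_from_0) auto
  then have "(\<integral>\<^sup>+r. ennreal (r powr - \<alpha>) * indicator {0..R} r \<partial>lborel) = ennreal (R powr (- \<alpha> + 1) / (- \<alpha> + 1))"
    using nn_integral_has_integral_lebesgue'[of "{0..R}" "\<lambda>r. r powr - \<alpha>"]
    by (simp add: nn_integral_completion)
  moreover have "(\<integral>\<^sup>+r. ennreal (r powr - \<alpha>) * indicator {0..R} r \<partial>lborel)
      = (\<integral>\<^sup>+r. ennreal (r powr - \<alpha>) * indicator {0<..<R} r \<partial>lborel)"
  proof (rule nn_integral_cong_AE)
    show "AE r in lborel. ennreal (r powr - \<alpha>) * indicator {0..R} r = ennreal (r powr - \<alpha>) * indicator {0<..<R} r"
      using AE_lborel_singleton[of 0] AE_lborel_singleton[of R]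
      by eventually_elim (auto simp: indicator_def)
  qed
  ultimately show ?thesis by (simp add: add.commute)
qed


lemma emeasure_unit_cbox: "emeasure lborel (cbox (\<chi> i. 1) (\<chi> i. 2) :: (real^'n::finite) set) = 1"
  by (subst emeasure_lborel_cbox_eq) (auto simp: Basis_vec_def inner_axis prod.UNION_disjoint intro!: prod.neutral)

text \<open>The values of a test function are bounded by averages of its gradient over the cones
  \<open>{x + r *\<^sub>R e | e. e \<in> cbox 1 2}\<close>, which leave the domain when \<open>r\<close> exceeds its diameter.\<close>
lemma test_function_le_cone_average:
  fixes \<phi> :: "real^'n::finite \<Rightarrow> real"
  assumes \<phi>: "\<phi> \<in> test_functions U" and R: "R > 0" "\<And>x y. x \<in> U \<Longrightarrow> y \<in> U \<Longrightarrow> dist x y < R"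
  defines "B \<equiv> cbox (\<chi> i. 1) (\<chi> i. 2) :: (real^'n) set"
  shows "ennreal \<bar>\<phi> x\<bar> \<le> ennreal (2 * real CARD('n)) *
    (\<integral>\<^sup>+r. (\<integral>\<^sup>+e. ennreal (norm (gradient \<phi> (x + r *\<^sub>R e))) * indicator B e \<partial>lborel) * indicator {0<..<R} r \<partial>lborel)"
proof -
  have sm: "smooth \<phi>" using \<phi> by (rule test_function_smooth)
  have gc: "continuous_on UNIV (gradient \<phi>)" using sm by (rule continuous_on_gradient)
  then have [measurable]: "gradient \<phi> \<in> borel_measurable borel" by (rule borel_measurable_continuous_onI)
  let ?c = "ennreal (2 * real CARD('n))"
  have Bm: "emeasure lborel B = 1"
    unfolding B_def by (rule emeasure_unit_cbox)
  \<comment> \<open>The lower bound makes \<open>x + R *\<^sub>R e\<close> leave \<open>U\<close>;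
    the upper bound compares the derivative along \<open>e\<close> with the norm of the gradient and
    produces the factor \<open>2 n\<close>.\<close>
  have le: "norm e \<le> 2 * real CARD('n)" "1 \<le> norm e" if "e \<in> B" for e
  proof -
    have c: "1 \<le> e $ i" "e $ i \<le> 2" for i using that by (auto simp: B_def mem_box_cart)
    have "norm e \<le> (\<Sum>i\<in>UNIV. \<bar>e $ i\<bar>)" by (rule norm_le_l1_cart)
    also have "\<dots> \<le> (\<Sum>i\<in>(UNIV::'n set). 2)" using c by (intro sum_mono) (smt (verit))
    finally show "norm e \<le> 2 * real CARD('n)" by simp
    obtain i :: 'n where True by simp
    have "1 \<le> \<bar>e $ i\<bar>" using c[of i] by simp
    also have "\<dots> \<le> norm e" by (rule component_le_norm_cart)
    finally show "1 \<le> norm e" .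
  qed
  have line: "ennreal \<bar>\<phi> x\<bar> \<le> ?c * (\<integral>\<^sup>+r. ennreal (norm (gradient \<phi> (x + r *\<^sub>R e))) * indicator {0<..<R} r \<partial>lborel)"
    if e: "e \<in> B" for e
  proof (cases "x \<in> U")
    case True
    have "x + R *\<^sub>R e \<notin> U"
    proof
      assume "x + R *\<^sub>R e \<in> U"
      then have "dist x (x + R *\<^sub>R e) < R" by (rule R(2)[OF True])
      then have "R * norm e < R" using R by (simp add: dist_norm)
      then show False using R le(2)[OF e] by simp
    qed
    then have 0: "\<phi> (x + R *\<^sub>R e) = 0" using test_function_zero[OF \<phi>] by blast
    let ?f = "\<lambda>r. gradient \<phi> (x + r *\<^sub>R e) \<bullet> e"
    have "(\<integral>r. indicator {0..R} r *\<^sub>R ?f r \<partial>lborel) = \<phi> (x + R *\<^sub>R e) - \<phi> (x + 0 *\<^sub>R e)"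
      using R by (intro integral_FTC_Icc)
        (auto intro!: continuous_intros continuous_on_compose2[OF gc] smooth_line_deriv[OF sm]
          simp flip: has_real_derivative_iff_has_vector_derivative)
    then have "ennreal \<bar>\<phi> x\<bar> = ennreal (norm (\<integral>r. indicator {0..R} r *\<^sub>R ?f r \<partial>lborel))" using 0 by simp
    also have "\<dots> \<le> (\<integral>\<^sup>+r. norm (indicator {0..R} r *\<^sub>R ?f r) \<partial>lborel)"
      by (rule integral_norm_bound_ennreal)
        (intro borel_integrable_compact continuous_intros continuous_on_compose2[OF gc]; simp)
    also have "\<dots> \<le> (\<integral>\<^sup>+r. ?c * (ennreal (norm (gradient \<phi> (x + r *\<^sub>R e))) * indicator {0<..<R} r) \<partial>lborel)"
    proof (rule nn_integral_mono_AE)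
      show "AE r in lborel. ennreal (norm (indicator {0..R} r *\<^sub>R ?f r))
          \<le> ?c * (ennreal (norm (gradient \<phi> (x + r *\<^sub>R e))) * indicator {0<..<R} r)"
        using AE_lborel_singleton[of 0] AE_lborel_singleton[of R]
      proof eventually_elim
        case (elim r)
        have "\<bar>?f r\<bar> \<le> norm (gradient \<phi> (x + r *\<^sub>R e)) * norm e" by (rule Cauchy_Schwarz_ineq2)
        also have "\<dots> \<le> norm (gradient \<phi> (x + r *\<^sub>R e)) * (2 * real CARD('n))"
          using le[OF e] by (intro mult_left_mono) auto
        finally have "ennreal \<bar>?f r\<bar> \<le> ?c * ennreal (norm (gradient \<phi> (x + r *\<^sub>R e)))"
          by (simp add: ennreal_mult[symmetric] mult.commute ennreal_leI)
        then show ?case using elim by (auto simp: indicator_def)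
      qed
    qed
    also have "\<dots> = ?c * (\<integral>\<^sup>+r. ennreal (norm (gradient \<phi> (x + r *\<^sub>R e))) * indicator {0<..<R} r \<partial>lborel)"
      by (intro nn_integral_cmult) measurable
    finally show ?thesis .
  next
    case False
    then show ?thesis using test_function_zero[OF \<phi>] by simp
  qed
  have "ennreal \<bar>\<phi> x\<bar> = (\<integral>\<^sup>+e. ennreal \<bar>\<phi> x\<bar> * indicator B e \<partial>lborel)"
    using Bm by (subst nn_integral_cmult_indicator) (auto simp: B_def)
  also have "\<dots> \<le> (\<integral>\<^sup>+e. ?c * (\<integral>\<^sup>+r. ennreal (norm (gradient \<phi> (x + r *\<^sub>R e))) * indicator {0<..<R} r * indicator B e \<partial>lborel) \<partial>lborel)"
    using line by (intro nn_integral_mono) (auto simp: indicator_def)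
  also have "\<dots> = ?c * (\<integral>\<^sup>+e. (\<integral>\<^sup>+r. ennreal (norm (gradient \<phi> (x + r *\<^sub>R e))) * indicator {0<..<R} r * indicator B e \<partial>lborel) \<partial>lborel)"
    by (intro nn_integral_cmult) (simp add: B_def)
  also have "(\<integral>\<^sup>+e. (\<integral>\<^sup>+r. ennreal (norm (gradient \<phi> (x + r *\<^sub>R e))) * indicator {0<..<R} r * indicator B e \<partial>lborel) \<partial>lborel)
      = (\<integral>\<^sup>+r. (\<integral>\<^sup>+e. ennreal (norm (gradient \<phi> (x + r *\<^sub>R e))) * indicator {0<..<R} r * indicator B e \<partial>lborel) \<partial>lborel)"
    by (rule lborel_pair.Fubini') (simp add: B_def)
  also have "\<dots> = (\<integral>\<^sup>+r. (\<integral>\<^sup>+e. ennreal (norm (gradient \<phi> (x + r *\<^sub>R e))) * indicator B e \<partial>lborel) * indicator {0<..<R} r \<partial>lborel)"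
    by (intro nn_integral_cong) (auto simp: indicator_def)
  finally show ?thesis .
qed

text \<open>Young's inequality for the convolution of the gradient with a cone kernel: on the scale \<open>r\<close> the cone
  average \<open>X r\<close> of the gradient is bounded both by its mean square \<open>Y r\<close> and by \<open>r\<^sup>-\<^sup>n G\<close>.\<close>
lemma Sobolev_test_function:
  fixes \<phi> :: "real^'n::finite \<Rightarrow> real"
  assumes \<phi>: "\<phi> \<in> test_functions U" and R: "R > 0" "\<And>x y. x \<in> U \<Longrightarrow> y \<in> U \<Longrightarrow> dist x y < R"
    and q: "q > 2" and \<alpha>: "real CARD('n) * (1/2 - 1/q) < 1"
  defines "K \<equiv> R powr (1 - real CARD('n) * (1/2 - 1/q)) / (1 - real CARD('n) * (1/2 - 1/q))"
  shows "(\<integral>x. \<bar>\<phi> x\<bar> powr q \<partial>lebesgue)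
    \<le> ((2 * real CARD('n) * K)\<^sup>2 * (\<integral>x. (norm (gradient \<phi> x))\<^sup>2 \<partial>lebesgue)) powr (q / 2)"
proof -
  define \<alpha> where "\<alpha> = real CARD('n) * (1/2 - 1/q)"
  define B :: "(real^'n) set" where "B = cbox (\<chi> i. 1) (\<chi> i. 2)"
  define \<gamma> where "\<gamma> = 1/2 - 1/q"
  have \<alpha>1: "\<alpha> < 1" using \<alpha> by (simp add: \<alpha>_def)
  have \<gamma>: "\<gamma> > 0" using q by (simp add: \<gamma>_def field_simps)
  have K: "K > 0" using R \<alpha>1 by (simp add: K_def \<alpha>_def)
  have IK: "(\<integral>\<^sup>+r. ennreal (r powr - \<alpha>) * indicator {0<..<R} r \<partial>lborel) = ennreal K"
    using nn_integral_powr[OF \<alpha>1 R(1)] by (simp add: K_def \<alpha>_def)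
  have sm: "smooth \<phi>" using \<phi> by (rule test_function_smooth)
  have gc: "continuous_on UNIV (gradient \<phi>)" using sm by (rule continuous_on_gradient)
  then have [measurable]: "gradient \<phi> \<in> borel_measurable borel" by (rule borel_measurable_continuous_onI)
  have [measurable]: "\<phi> \<in> borel_measurable borel" using smooth_continuous[OF sm] by (rule borel_measurable_continuous_onI)
  have [measurable]: "B \<in> sets borel" by (simp add: B_def)
  define G where "G = (\<integral>x. (norm (gradient \<phi> x))\<^sup>2 \<partial>lebesgue)"
  have G0: "G \<ge> 0" by (simp add: G_def)
  have G: "(\<integral>\<^sup>+y. ennreal ((norm (gradient \<phi> y))\<^sup>2) \<partial>lborel) = ennreal G"
  proof -
    have "integrable lebesgue (\<lambda>y. (norm (gradient \<phi> y))\<^sup>2)"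
      using test_function_L2(2)[OF \<phi>] by (simp add: L2_UNIV)
    then show ?thesis unfolding G_def
      by (subst nn_integral_eq_integral[symmetric]) (auto simp: nn_integral_completion)
  qed
  have Bm: "emeasure lborel B = 1"
    unfolding B_def by (rule emeasure_unit_cbox)
  define X where "X = (\<lambda>x r. \<integral>\<^sup>+e. ennreal (norm (gradient \<phi> (x + r *\<^sub>R e))) * indicator B e \<partial>lborel)"
  define Y where "Y = (\<lambda>x r. \<integral>\<^sup>+e. ennreal ((norm (gradient \<phi> (x + r *\<^sub>R e)))\<^sup>2) * indicator B e \<partial>lborel)"
  define N where "N = (\<lambda>x. \<integral>\<^sup>+r. ennreal (r powr - \<alpha>) * indicator {0<..<R} r * Y x r \<partial>lborel)"
  have Xm[measurable]: "(\<lambda>(x, r). X x r) \<in> borel_measurable (lborel \<Otimes>\<^sub>M lborel)" unfolding X_def by measurable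
  have Ym[measurable]: "(\<lambda>(x, r). Y x r) \<in> borel_measurable (lborel \<Otimes>\<^sub>M lborel)" unfolding Y_def by measurable
  have Nm[measurable]: "N \<in> borel_measurable borel" unfolding N_def by measurable
  have XY: "X x r ^ 2 \<le> Y x r" for x r
  proof -
    have "(\<integral>\<^sup>+e. (ennreal (norm (gradient \<phi> (x + r *\<^sub>R e))) * indicator B e) * indicator B e \<partial>lborel)\<^sup>2
      \<le> (\<integral>\<^sup>+e. (ennreal (norm (gradient \<phi> (x + r *\<^sub>R e))) * indicator B e)\<^sup>2 \<partial>lborel) * (\<integral>\<^sup>+e. (indicator B e)\<^sup>2 \<partial>lborel)"
      by (rule Cauchy_Schwarz_nn_integral) measurable
    moreover have "(\<integral>\<^sup>+e. (indicator B e)\<^sup>2 \<partial>lborel) = (\<integral>\<^sup>+e. indicator B e \<partial>lborel)"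
      by (intro nn_integral_cong) (auto simp: indicator_def)
    moreover have "(\<integral>\<^sup>+e. (ennreal (norm (gradient \<phi> (x + r *\<^sub>R e))) * indicator B e) * indicator B e \<partial>lborel) = X x r"
      unfolding X_def by (intro nn_integral_cong) (auto simp: indicator_def)
    moreover have "(\<integral>\<^sup>+e. (ennreal (norm (gradient \<phi> (x + r *\<^sub>R e))) * indicator B e)\<^sup>2 \<partial>lborel) = Y x r"
      unfolding Y_def by (intro nn_integral_cong) (auto simp: indicator_def ennreal_power)
    ultimately show ?thesis using Bm by simp
  qed
  have Yle: "Y x r \<le> ennreal ((1 / r ^ CARD('n)) * G)" if "r > 0" for x r
  proof -
    have "Y x r \<le> (\<integral>\<^sup>+e. ennreal ((norm (gradient \<phi> (x + r *\<^sub>R e)))\<^sup>2) \<partial>lborel)"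
      unfolding Y_def by (intro nn_integral_mono) (auto simp: indicator_def)
    also have "\<dots> = ennreal (1 / r ^ CARD('n)) * ennreal G"
      using nn_integral_affine_lborel[of "\<lambda>y. ennreal ((norm (gradient \<phi> y))\<^sup>2)" r x] that G by simp
    also have "\<dots> = ennreal ((1 / r ^ CARD('n)) * G)"
      using that G0 by (intro ennreal_mult[symmetric]) auto
    finally show ?thesis .
  qed
  \<comment> \<open>By translation invariance, and because \<open>B\<close> has measure
    \<open>1\<close>, each \<open>Y x r\<close> integrates to \<open>G\<close> in \<open>x\<close>;
    the weight then contributes \<open>K\<close>.\<close>
  have NG: "(\<integral>\<^sup>+x. N x \<partial>lborel) = ennreal (K * G)"
  proof -
    have YG: "(\<integral>\<^sup>+x. Y x r \<partial>lborel) = ennreal G" for r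
    proof -
      have "(\<integral>\<^sup>+x. Y x r \<partial>lborel)
          = (\<integral>\<^sup>+e. (\<integral>\<^sup>+x. ennreal ((norm (gradient \<phi> (x + r *\<^sub>R e)))\<^sup>2) * indicator B e \<partial>lborel) \<partial>lborel)"
        unfolding Y_def by (rule lborel_pair.Fubini') simp
      also have "\<dots> = (\<integral>\<^sup>+e. ennreal G * indicator B e \<partial>lborel)"
      proof (intro nn_integral_cong)
        fix e
        have "(\<integral>\<^sup>+x. ennreal ((norm (gradient \<phi> (r *\<^sub>R e + 1 *\<^sub>R x)))\<^sup>2) \<partial>lborel) = ennreal (1 / 1 ^ CARD('n)) * ennreal G"
          using nn_integral_affine_lborel[of "\<lambda>y. ennreal ((norm (gradient \<phi> y))\<^sup>2)" 1 "r *\<^sub>R e"] G by simp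
        then have "(\<integral>\<^sup>+x. ennreal ((norm (gradient \<phi> (x + r *\<^sub>R e)))\<^sup>2) \<partial>lborel) = ennreal G"
          by (simp add: add.commute)
        then show "(\<integral>\<^sup>+x. ennreal ((norm (gradient \<phi> (x + r *\<^sub>R e)))\<^sup>2) * indicator B e \<partial>lborel) = ennreal G * indicator B e"
          by (subst nn_integral_multc) auto
      qed
      also have "\<dots> = ennreal G" using Bm by (subst nn_integral_cmult_indicator) auto
      finally show ?thesis .
    qed
    have "(\<integral>\<^sup>+x. N x \<partial>lborel) = (\<integral>\<^sup>+r. (\<integral>\<^sup>+x. ennreal (r powr - \<alpha>) * indicator {0<..<R} r * Y x r \<partial>lborel) \<partial>lborel)"
      unfolding N_def by (rule lborel_pair.Fubini') simp
    also have "\<dots> = (\<integral>\<^sup>+r. ennreal (r powr - \<alpha>) * indicator {0<..<R} r * ennreal G \<partial>lborel)"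
      by (intro nn_integral_cong, subst nn_integral_cmult) (auto simp: YG)
    also have "\<dots> = (\<integral>\<^sup>+r. ennreal (r powr - \<alpha>) * indicator {0<..<R} r \<partial>lborel) * ennreal G"
      by (rule nn_integral_multc) simp
    also have "\<dots> = ennreal (K * G)"
      unfolding IK using K G0 by (intro ennreal_mult[symmetric]) auto
    finally show ?thesis .
  qed
  define C where "C = 2 * real CARD('n) * G powr \<gamma> * K"
  have C0: "C \<ge> 0" using K by (simp add: C_def)
  \<comment> \<open>Here \<open>\<nu> / K\<close> is the mean of \<open>Y x r\<close> for the weight
    \<open>r powr - \<alpha>\<close> on the interval from \<open>0\<close> to \<open>R\<close>. The
    tangent is taken at a positive \<open>m\<close> above this mean, so that integration reproduces
    \<open>m powr (1/q)\<close>; a separate \<open>m\<close> also covers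
    \<open>\<nu> = 0\<close>.\<close>
  have pt: "\<bar>\<phi> x\<bar> \<le> C * m powr (1/q)" if \<nu>: "N x = ennreal \<nu>" "\<nu> \<ge> 0" and m: "m > 0" "\<nu> \<le> m * K" for x \<nu> m
  proof -
    define a b where "a = G powr \<gamma> * ((1 / q) * m powr (1 / q - 1))" and "b = G powr \<gamma> * ((1 - 1 / q) * m powr (1 / q))"
    have ab: "a \<ge> 0" "b \<ge> 0" using q by (auto simp: a_def b_def)
    have Xle: "X x r \<le> ennreal a * (ennreal (r powr - \<alpha>) * Y x r) + ennreal b * ennreal (r powr - \<alpha>)" if r: "r > 0" for r
    proof -
      obtain y where y: "Y x r = ennreal y" "0 \<le> y" "y \<le> (1 / r ^ CARD('n)) * G"
        using Yle[OF r, of x] G0 r by (cases "Y x r") (auto simp: top_unique ennreal_le_iff2 zero_le_mult_iff)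
      obtain X' where X': "X x r = ennreal X'" "0 \<le> X'"
        using XY[of x r] y by (cases "X x r") (auto simp: top_unique ennreal_top_eq_mult_iff power2_eq_square)
      have "X'\<^sup>2 \<le> y" using XY[of x r] y X' by (simp add: ennreal_power)
      then have "X' \<le> sqrt y" by (rule real_le_rsqrt)
      also have "\<dots> \<le> r powr - \<alpha> * G powr \<gamma> * y powr (1 / q)"
        using powr_half_split[OF y(2,3) r q G0] by (simp add: \<alpha>_def \<gamma>_def)
      also have "\<dots> \<le> r powr - \<alpha> * G powr \<gamma> * ((1 / q) * y * m powr (1 / q - 1) + (1 - 1 / q) * m powr (1 / q))"
        using q y m by (intro mult_left_mono tangent_powr) auto
      also have "\<dots> = a * (r powr - \<alpha> * y) + b * r powr - \<alpha>" by (simp add: a_def b_def algebra_simps)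
      finally have "X x r \<le> ennreal (a * (r powr - \<alpha> * y) + b * r powr - \<alpha>)" using X' by (simp add: ennreal_leI)
      also have "\<dots> = ennreal a * (ennreal (r powr - \<alpha>) * Y x r) + ennreal b * ennreal (r powr - \<alpha>)"
        using ab y by (simp add: ennreal_mult ennreal_plus mult_nonneg_nonneg)
      finally show ?thesis .
    qed
    have "(\<integral>\<^sup>+r. X x r * indicator {0<..<R} r \<partial>lborel)
      \<le> (\<integral>\<^sup>+r. ennreal a * (ennreal (r powr - \<alpha>) * indicator {0<..<R} r * Y x r)
          + ennreal b * (ennreal (r powr - \<alpha>) * indicator {0<..<R} r) \<partial>lborel)"
      using Xle by (intro nn_integral_mono) (auto simp: indicator_def)
    also have "\<dots> = ennreal a * N x + ennreal b * ennreal K"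
      unfolding N_def by (subst nn_integral_add) (simp_all add: nn_integral_cmult IK)
    also have "\<dots> = ennreal (a * \<nu> + b * K)"
      using ab \<nu> K by (simp add: ennreal_mult ennreal_plus mult_nonneg_nonneg)
    finally have "(\<integral>\<^sup>+r. X x r * indicator {0<..<R} r \<partial>lborel) \<le> ennreal (a * \<nu> + b * K)" .
    then have "ennreal (2 * real CARD('n)) * (\<integral>\<^sup>+r. X x r * indicator {0<..<R} r \<partial>lborel)
      \<le> ennreal (2 * real CARD('n)) * ennreal (a * \<nu> + b * K)"
      by (intro mult_left_mono) auto
    with test_function_le_cone_average[OF \<phi> R, of x]
    have "ennreal \<bar>\<phi> x\<bar> \<le> ennreal (2 * real CARD('n) * (a * \<nu> + b * K))"
      using ab K \<nu> unfolding X_def B_def by (simp add: ennreal_mult)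
    then have "\<bar>\<phi> x\<bar> \<le> 2 * real CARD('n) * (a * \<nu> + b * K)"
      using ab K \<nu> by (subst (asm) ennreal_le_iff) (auto intro!: mult_nonneg_nonneg add_nonneg_nonneg)
    also have "\<dots> \<le> 2 * real CARD('n) * (a * (m * K) + b * K)"
      using ab m by (intro mult_left_mono add_right_mono) auto
    also have "a * (m * K) + b * K = G powr \<gamma> * K * m powr (1 / q)"
    proof -
      have "m * m powr (1 / q - 1) = m powr (1 / q)" using m by (simp add: powr_mult_base)
      then have "a * (m * K) = G powr \<gamma> * ((1 / q) * m powr (1 / q)) * K"
        by (simp add: a_def flip: mult.assoc) (simp add: mult_ac)
      then show ?thesis by (simp add: b_def algebra_simps)
    qed
    finally show ?thesis by (simp add: C_def mult_ac)
  qed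
  have ptq: "ennreal (\<bar>\<phi> x\<bar> powr q) \<le> ennreal (C powr q / K) * N x" if Nx: "N x \<noteq> \<infinity>" for x
  proof -
    obtain \<nu> where \<nu>: "N x = ennreal \<nu>" "\<nu> \<ge> 0" using Nx by (cases "N x") auto
    have "\<bar>\<phi> x\<bar> powr q \<le> C powr q / K * \<nu> + \<eta>" if "\<eta> > 0" for \<eta>
    proof -
      \<comment> \<open>The excess of \<open>m\<close> over \<open>\<nu> / K\<close> costs
        \<open>C powr q / K * \<theta>\<close>, which this choice keeps below \<open>\<eta>\<close>;
        the summand \<open>1\<close> excludes division by \<open>0\<close>.\<close>
      define \<theta> where "\<theta> = \<eta> / (C powr q / K + 1)"
      have D: "C powr q / K \<ge> 0" using K by simp
      have \<theta>: "\<theta> > 0" unfolding \<theta>_def using that D by (intro divide_pos_pos) auto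
      define m where "m = (\<nu> + \<theta>) / K"
      have m: "m > 0" "\<nu> \<le> m * K" using \<theta> \<nu> K by (auto simp: m_def)
      have "\<bar>\<phi> x\<bar> powr q \<le> (C * m powr (1/q)) powr q"
        using pt[OF \<nu> m] q by (intro powr_mono2) auto
      also have "\<dots> = C powr q * m" using C0 m q by (simp add: powr_mult powr_powr)
      also have "\<dots> = C powr q / K * \<nu> + C powr q / K * \<theta>" by (simp add: m_def distrib_left add_divide_distrib)
      also have "C powr q / K * \<theta> \<le> \<eta>"
      proof -
        have "C powr q / K * \<theta> \<le> (C powr q / K + 1) * \<theta>" using \<theta> by (intro mult_right_mono) auto
        also have "\<dots> = \<eta>" unfolding \<theta>_def using D by (intro nonzero_mult_div_cancel_left[of "C powr q / K + 1" \<eta>, unfolded times_divide_eq_right[symmetric]]) linarith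
        finally show ?thesis .
      qed
      finally show ?thesis by simp
    qed
    then have "\<bar>\<phi> x\<bar> powr q \<le> C powr q / K * \<nu>" by (rule field_le_epsilon)
    then show ?thesis using \<nu> K by (simp add: ennreal_mult[symmetric] ennreal_leI)
  qed
  have "(\<integral>\<^sup>+x. ennreal (\<bar>\<phi> x\<bar> powr q) \<partial>lborel) \<le> (\<integral>\<^sup>+x. ennreal (C powr q / K) * N x \<partial>lborel)"
  proof (rule nn_integral_mono_AE)
    have "AE x in lborel. N x \<noteq> \<infinity>" using NG by (intro nn_integral_noteq_infinite) auto
    then show "AE x in lborel. ennreal (\<bar>\<phi> x\<bar> powr q) \<le> ennreal (C powr q / K) * N x"
      by eventually_elim (rule ptq)
  qed
  also have "\<dots> = ennreal (C powr q / K) * ennreal (K * G)" by (subst nn_integral_cmult) (auto simp: NG)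
  also have "\<dots> = ennreal (C powr q * G)" using K G0 by (simp add: ennreal_mult[symmetric])
  also have "C powr q * G = ((2 * real CARD('n) * K)\<^sup>2 * G) powr (q / 2)"
  proof (cases "G = 0")
    case False
    with G0 have "G > 0" by simp
    have "C powr q * G = (2 * real CARD('n) * K) powr q * (G powr (\<gamma> * q) * G)"
      using K G0 by (simp add: C_def powr_mult powr_powr mult_ac)
    also have "G powr (\<gamma> * q) * G = G powr (\<gamma> * q + 1)" using \<open>G > 0\<close> by (simp add: powr_add)
    also have "\<gamma> * q + 1 = q / 2" using q by (simp add: \<gamma>_def field_simps)
    also have "(2 * real CARD('n) * K) powr q = ((2 * real CARD('n) * K)\<^sup>2) powr (q / 2)"
      using K by (simp add: powr_powr flip: powr_numeral)
    finally show ?thesis using K G0 by (simp add: powr_mult)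
  qed simp
  finally have fin: "(\<integral>\<^sup>+x. ennreal (\<bar>\<phi> x\<bar> powr q) \<partial>lborel) \<le> ennreal (((2 * real CARD('n) * K)\<^sup>2 * G) powr (q / 2))" .
  have "(\<integral>x. \<bar>\<phi> x\<bar> powr q \<partial>lebesgue) = enn2real (\<integral>\<^sup>+x. ennreal (\<bar>\<phi> x\<bar> powr q) \<partial>lborel)"
    by (subst integral_eq_nn_integral) (auto simp: nn_integral_completion intro!: measurable_completion)
  also have "\<dots> \<le> ((2 * real CARD('n) * K)\<^sup>2 * G) powr (q / 2)"
    using fin by (intro enn2real_leI) auto
  finally show ?thesis by (simp add: G_def)
qed

text \<open>Fatou's lemma along an almost everywhere convergent subsequence transfers the inequality
  from test functions; integrability is obtained at the same time.\<close>

lemma Sobolev_inequality: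
  fixes u :: "real^'n::finite \<Rightarrow> real"
  assumes u: "sobolev0 U u g" and R: "R > 0" "\<And>x y. x \<in> U \<Longrightarrow> y \<in> U \<Longrightarrow> dist x y < R"
    and q: "q > 2" and \<alpha>: "real CARD('n) * (1/2 - 1/q) < 1"
  defines "K \<equiv> R powr (1 - real CARD('n) * (1/2 - 1/q)) / (1 - real CARD('n) * (1/2 - 1/q))"
  shows "integrable lebesgue (\<lambda>x. \<bar>u x\<bar> powr q)"
    and "(\<integral>x. \<bar>u x\<bar> powr q \<partial>lebesgue)
      \<le> ((2 * real CARD('n) * K)\<^sup>2 * (\<integral>x. (norm (g x))\<^sup>2 \<partial>lebesgue)) powr (q / 2)"
proof -
  let ?S = "(2 * real CARD('n) * K)\<^sup>2"
  have L: "u \<in> L2 UNIV" "g \<in> L2 UNIV" using u by (auto simp: sobolev0_def)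
  have um: "u \<in> borel_measurable lebesgue" using L by (simp add: L2_UNIV)
  obtain \<phi>\<^sub>0 where \<phi>\<^sub>0: "\<And>m::nat. \<phi>\<^sub>0 m \<in> test_functions U"
    "(\<lambda>m. \<integral>x. (norm (u x - \<phi>\<^sub>0 m x))\<^sup>2 \<partial>lebesgue) \<longlonglongrightarrow> 0"
    "(\<lambda>m. \<integral>x. (norm (g x - gradient (\<phi>\<^sub>0 m) x))\<^sup>2 \<partial>lebesgue) \<longlonglongrightarrow> 0"
    using u by (auto simp: sobolev0_def)
  obtain r :: "nat \<Rightarrow> nat" where r: "strict_mono r" "AE x in lebesgue. (\<lambda>m. \<phi>\<^sub>0 (r m) x) \<longlonglongrightarrow> u x"
    using L2_AE_subsequence[OF L(1) test_function_L2(1)[OF \<phi>\<^sub>0(1)] \<phi>\<^sub>0(2)] by blast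
  define \<phi> where "\<phi> = (\<lambda>m. \<phi>\<^sub>0 (r m))"
  have \<phi>: "\<And>m. \<phi> m \<in> test_functions U" "AE x in lebesgue. (\<lambda>m. \<phi> m x) \<longlonglongrightarrow> u x"
    using \<phi>\<^sub>0(1) r(2) by (auto simp: \<phi>_def)
  have lim: "(\<lambda>m. \<integral>x. (norm (g x - gradient (\<phi> m) x))\<^sup>2 \<partial>lebesgue) \<longlonglongrightarrow> 0"
    using LIMSEQ_subseq_LIMSEQ[OF \<phi>\<^sub>0(3) r(1)] by (simp add: \<phi>_def o_def)
  have Gm: "gradient (\<phi> m) \<in> L2 UNIV" for m by (rule test_function_L2(2)[OF \<phi>(1)])
  \<comment> \<open>The squared norm of the approximating gradient is written as this combination,
    all of whose terms have known limits; hence the Dirichlet integrals converge.\<close>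
  have "(\<lambda>m. (\<integral>x. (norm (g x - gradient (\<phi> m) x))\<^sup>2 \<partial>lebesgue)
      + 2 * (\<integral>x. gradient (\<phi> m) x \<bullet> g x \<partial>lebesgue) - (\<integral>x. (norm (g x))\<^sup>2 \<partial>lebesgue))
    \<longlonglongrightarrow> 0 + 2 * (\<integral>x. g x \<bullet> g x \<partial>lebesgue) - (\<integral>x. (norm (g x))\<^sup>2 \<partial>lebesgue)"
    using lim L Gm by (intro tendsto_intros tendsto_integral_inner_L2) (auto simp: L2_UNIV)
  moreover have "(\<integral>x. (norm (g x - gradient (\<phi> m) x))\<^sup>2 \<partial>lebesgue)
      + 2 * (\<integral>x. gradient (\<phi> m) x \<bullet> g x \<partial>lebesgue) - (\<integral>x. (norm (g x))\<^sup>2 \<partial>lebesgue)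
      = (\<integral>x. (norm (gradient (\<phi> m) x))\<^sup>2 \<partial>lebesgue)" for m
    using integral_lincomb_L2[of g lebesgue "gradient (\<phi> m)" 1 "-1"] L Gm[of m]
    by (simp add: L2_UNIV inner_commute)
  ultimately have lim': "(\<lambda>m. \<integral>x. (norm (gradient (\<phi> m) x))\<^sup>2 \<partial>lebesgue) \<longlonglongrightarrow> (\<integral>x. (norm (g x))\<^sup>2 \<partial>lebesgue)"
    by (simp add: power2_norm_eq_inner)
  have pm: "(\<lambda>x. \<bar>\<phi> m x\<bar> powr q) \<in> borel_measurable lebesgue" for m
    using test_function_L2(1)[OF \<phi>(1)[of m]] by (auto simp: L2_UNIV)
  have nn: "(\<integral>\<^sup>+x. ennreal (\<bar>\<phi> m x\<bar> powr q) \<partial>lebesgue)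
      \<le> ennreal ((?S * (\<integral>x. (norm (gradient (\<phi> m) x))\<^sup>2 \<partial>lebesgue)) powr (q / 2))" for m
  proof -
    obtain K' where K': "compact K'" "\<And>x. x \<notin> K' \<Longrightarrow> \<phi> m x = 0"
      using test_function_support[OF \<phi>(1)] by metis
    have "integrable lebesgue (\<lambda>x. \<bar>\<phi> m x\<bar> powr q)"
    proof (rule integrable_continuous_compact_support[OF K'(1)])
      show "continuous_on UNIV (\<lambda>x. \<bar>\<phi> m x\<bar> powr q)"
        using smooth_continuous[OF test_function_smooth[OF \<phi>(1)[of m]]] q
        by (intro continuous_on_powr') (auto intro: continuous_intros)
    qed (use K' in auto)
    then have "(\<integral>\<^sup>+x. ennreal (\<bar>\<phi> m x\<bar> powr q) \<partial>lebesgue) = ennreal (\<integral>x. \<bar>\<phi> m x\<bar> powr q \<partial>lebesgue)"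
      by (intro nn_integral_eq_integral) auto
    also have "\<dots> \<le> ennreal ((?S * (\<integral>x. (norm (gradient (\<phi> m) x))\<^sup>2 \<partial>lebesgue)) powr (q / 2))"
      unfolding K_def by (intro ennreal_leI Sobolev_test_function[OF \<phi>(1) R q \<alpha>])
    finally show ?thesis .
  qed
  have "(\<integral>\<^sup>+x. ennreal (\<bar>u x\<bar> powr q) \<partial>lebesgue) = (\<integral>\<^sup>+x. liminf (\<lambda>m. ennreal (\<bar>\<phi> m x\<bar> powr q)) \<partial>lebesgue)"
  proof (rule nn_integral_cong_AE)
    show "AE x in lebesgue. ennreal (\<bar>u x\<bar> powr q) = liminf (\<lambda>m. ennreal (\<bar>\<phi> m x\<bar> powr q))"
      using \<phi>(2)
    proof eventually_elim
      case (elim x)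
      have "(\<lambda>m. ennreal (\<bar>\<phi> m x\<bar> powr q)) \<longlonglongrightarrow> ennreal (\<bar>u x\<bar> powr q)"
        using elim q by (intro tendsto_ennrealI tendsto_powr' tendsto_rabs) auto
      then show ?case by (intro lim_imp_Liminf[symmetric]) auto
    qed
  qed
  also have "\<dots> \<le> liminf (\<lambda>m. \<integral>\<^sup>+x. ennreal (\<bar>\<phi> m x\<bar> powr q) \<partial>lebesgue)"
    using pm by (intro nn_integral_liminf) auto
  also have "\<dots> \<le> liminf (\<lambda>m. ennreal ((?S * (\<integral>x. (norm (gradient (\<phi> m) x))\<^sup>2 \<partial>lebesgue)) powr (q / 2)))"
    using nn by (intro Liminf_mono) auto
  also have "\<dots> = ennreal ((?S * (\<integral>x. (norm (g x))\<^sup>2 \<partial>lebesgue)) powr (q / 2))"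
    using lim' q by (intro lim_imp_Liminf tendsto_ennrealI tendsto_powr' tendsto_mult tendsto_const) auto
  finally have fin: "(\<integral>\<^sup>+x. ennreal (\<bar>u x\<bar> powr q) \<partial>lebesgue)
      \<le> ennreal ((?S * (\<integral>x. (norm (g x))\<^sup>2 \<partial>lebesgue)) powr (q / 2))" .
  have m: "(\<lambda>x. \<bar>u x\<bar> powr q) \<in> borel_measurable lebesgue" using um by auto
  show "integrable lebesgue (\<lambda>x. \<bar>u x\<bar> powr q)"
    using fin m by (intro integrableI_bounded) (auto simp: top_unique less_top[symmetric])
  show "(\<integral>x. \<bar>u x\<bar> powr q \<partial>lebesgue) \<le> (?S * (\<integral>x. (norm (g x))\<^sup>2 \<partial>lebesgue)) powr (q / 2)"
    using fin m by (subst integral_eq_nn_integral) (auto intro!: enn2real_leI)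
qed

section \<open>The power nonlinearity\<close>

definition opow :: "real \<Rightarrow> real \<Rightarrow> real" where
  "opow p x = \<bar>x\<bar> powr (p - 1) * x"

lemma opow_minus: "opow p (- x) = - opow p x"
  by (simp add: opow_def)

lemma opow_0 [simp]: "opow p 0 = 0"
  by (simp add: opow_def)

lemma abs_opow: "\<bar>opow p x\<bar> = \<bar>x\<bar> powr p"
  by (cases "x = 0") (simp_all add: opow_def abs_mult powr_mult_base[of "\<bar>x\<bar>" "p - 1", simplified, symmetric] mult.commute)

lemma abs_powr_has_derivative:
  assumes "p > 0"
  shows "((\<lambda>x. \<bar>x\<bar> powr (p + 1)) has_real_derivative (p + 1) * opow p x) (at x)"
proof -
  consider "x > 0" | "x < 0" | "x = 0" by linarith
  then show ?thesis
  proof cases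
    case 1
    have "((\<lambda>x. x powr (p + 1)) has_real_derivative (p + 1) * x powr (p + 1 - 1)) (at x)"
      by (rule has_real_derivative_powr[OF 1])
    moreover have "x powr (p + 1 - 1) = opow p x"
      using 1 abs_opow[of p x] by (simp add: opow_def)
    ultimately have "((\<lambda>x. x powr (p + 1)) has_real_derivative (p + 1) * opow p x) (at x)" by simp
    then show ?thesis
      by (rule has_field_derivative_transform_within_open[of _ _ _ "{0<..}"]) (use 1 in auto)
  next
    case 2
    have "((\<lambda>x. (- x) powr (p + 1)) has_real_derivative (p + 1) * (- x) powr (p + 1 - 1) * (- 1)) (at x)"
      by (rule DERIV_chain'[where f = uminus and g = "\<lambda>x. x powr (p + 1)", unfolded o_def, THEN DERIV_cong])
        (use 2 in \<open>auto intro!: derivative_eq_intros has_real_derivative_powr\<close>)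
    moreover have "(- x) powr p = - opow p x" using 2 abs_opow[of p x] by (simp add: opow_def abs_mult)
    then have "(p + 1) * (- x) powr (p + 1 - 1) * (- 1) = (p + 1) * opow p x" by simp
    ultimately have "((\<lambda>x. (- x) powr (p + 1)) has_real_derivative (p + 1) * opow p x) (at x)" by (simp only:)
    then show ?thesis
      by (rule has_field_derivative_transform_within_open[of _ _ _ "{..<0}"]) (use 2 in auto)
  next
    case 3
    have "((\<lambda>h. \<bar>h\<bar> powr p) \<longlongrightarrow> \<bar>0\<bar> powr p) (at (0::real))"
      using assms by (intro tendsto_powr' tendsto_intros) auto
    then have "((\<lambda>h. \<bar>h\<bar> powr p) \<longlongrightarrow> 0) (at (0::real))" by simp
    then have "((\<lambda>h. \<bar>h\<bar> powr (p + 1) / h) \<longlongrightarrow> 0) (at 0)"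
    proof (rule Lim_null_comparison[rotated])
      show "\<forall>\<^sub>F h in at 0. norm (\<bar>h\<bar> powr (p + 1) / h) \<le> \<bar>h\<bar> powr p"
        by (intro always_eventually allI) (simp add: powr_add)
    qed
    then show ?thesis using 3 assms by (simp add: has_field_derivative_iff)
  qed
qed

lemma opow_has_derivative:
  assumes "p > 1"
  shows "(opow p has_real_derivative p * \<bar>x\<bar> powr (p - 1)) (at x)"
proof (cases "x = 0")
  case True
  have "((\<lambda>h. \<bar>h\<bar> powr (p - 1)) \<longlongrightarrow> \<bar>0\<bar> powr (p - 1)) (at (0::real))"
    using assms by (intro tendsto_powr' tendsto_intros) auto
  moreover have "\<forall>\<^sub>F h in at 0. \<bar>h\<bar> powr (p - 1) = opow p h / h"
    by (auto simp: opow_def eventually_at intro!: exI[of _ 1])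
  ultimately have "((\<lambda>h. opow p h / h) \<longlongrightarrow> \<bar>0\<bar> powr (p - 1)) (at 0)"
    by (rule Lim_transform_eventually)
  then show ?thesis using True assms by (simp add: has_field_derivative_iff opow_def)
next
  case False
  have pos: "opow p y = y powr p" if "y > 0" for y
    using that abs_opow[of p y] by (simp add: opow_def)
  have pd: "(opow p has_real_derivative p * y powr (p - 1)) (at y)" if "y > 0" for y
    by (rule has_field_derivative_transform_within_open[OF has_real_derivative_powr[OF that], of "{0<..}"])
      (use that pos in auto)
  show ?thesis
  proof (cases "x > 0")
    case True
    then show ?thesis using pd[of x] by simp
  next
    case neg: False
    then have "- x > 0" using False by simp
    have "((\<lambda>x. - opow p (- x)) has_real_derivative - (p * (- x) powr (p - 1) * (- 1))) (at x)"
      by (intro DERIV_minus DERIV_chain2[of "opow p" _ uminus, OF pd[OF \<open>- x > 0\<close>]]) (auto intro!: derivative_eq_intros)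
    then show ?thesis using neg by (simp add: opow_minus)
  qed
qed

lemma opow_mono:
  assumes "p > 1" "x \<le> y"
  shows "opow p x \<le> opow p y"
  by (rule DERIV_nonneg_imp_nondecreasing[OF assms(2)]) (use opow_has_derivative[OF assms(1)] assms in force)

lemma isCont_opow: "p > 1 \<Longrightarrow> isCont (opow p) x"
  using opow_has_derivative DERIV_isCont by blast

lemma measurable_opow [measurable]: "opow p \<in> borel_measurable borel"
  unfolding opow_def[abs_def] by measurable

lemma abs_powr_convex:
  assumes "p > 1"
  shows "(\<bar>y\<bar> powr (p + 1) - \<bar>x\<bar> powr (p + 1)) / (p + 1) \<ge> opow p x * (y - x)"
proof -
  have "((p + 1) * opow p x) * (y - x) \<le> \<bar>y\<bar> powr (p + 1) - \<bar>x\<bar> powr (p + 1)"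
  proof (rule convex_on_imp_above_tangent[of UNIV])
    show "convex_on UNIV (\<lambda>x. \<bar>x\<bar> powr (p + 1))"
    proof (rule convex_on_realI[where f' = "\<lambda>x. (p + 1) * opow p x"])
      show "((\<lambda>x. \<bar>x\<bar> powr (p + 1)) has_real_derivative (p + 1) * opow p x) (at x)" for x
        using assms by (intro abs_powr_has_derivative) auto
      show "(p + 1) * opow p x \<le> (p + 1) * opow p y" if "x \<le> y" for x y
        using assms that opow_mono by (intro mult_left_mono) auto
    qed simp
    show "((\<lambda>x. \<bar>x\<bar> powr (p + 1)) has_real_derivative (p + 1) * opow p x) (at x within UNIV)"
      using assms by (simp add: abs_powr_has_derivative)
  qed auto
  then show ?thesis using assms by (simp add: field_simps)
qed

section \<open>Estimates for the convexity remainder\<close>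

definition powr_rem :: "real \<Rightarrow> real \<Rightarrow> real \<Rightarrow> real" where
  "powr_rem p x y = (\<bar>x + y\<bar> powr (p + 1) - \<bar>x\<bar> powr (p + 1)) / (p + 1) - opow p x * y"

lemma powr_rem_nonneg: "p > 1 \<Longrightarrow> powr_rem p x y \<ge> 0"
  using abs_powr_convex[of p x "x + y"] by (simp add: powr_rem_def)

text \<open>The remainder is itself convex in its last argument, with slope
  \<open>opow p (x + y) - opow p x\<close>. This bounds the change of the energy from below when
  \<open>d\<close> is replaced by a competitor.\<close>

lemma powr_rem_diff:
  assumes "p > 1"
  shows "powr_rem p x z - powr_rem p x y \<ge> (opow p (x + y) - opow p x) * (z - y)"
  using abs_powr_convex[OF assms, of "x + y" "x + z"] by (simp add: powr_rem_def algebra_simps diff_divide_distrib)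

lemma powr_add_le:
  fixes x y r :: real
  assumes "x \<ge> 0" "y \<ge> 0" "r \<ge> 0"
  shows "(x + y) powr r \<le> 2 powr r * (x powr r + y powr r)"
proof -
  have "(x + y) powr r \<le> (2 * max x y) powr r" using assms by (intro powr_mono2) auto
  also have "\<dots> = 2 powr r * max x y powr r" using assms by (simp add: powr_mult)
  also have "\<dots> \<le> 2 powr r * (x powr r + y powr r)" by (intro mult_left_mono) (auto simp: max_def)
  finally show ?thesis .
qed

text \<open>A crude substitute for Young's inequality: both factors are estimated by powers of the
  larger base.\<close>

lemma powr_mult_le_sum:
  fixes x y :: real
  assumes "x \<ge> 0" "y \<ge> 0" "r \<ge> 0" "s \<ge> 0"
  shows "x powr r * y powr s \<le> x powr (r + s) + y powr (r + s)"
proof -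
  have "x powr r * y powr s \<le> max x y powr r * max x y powr s"
    using assms by (intro mult_mono powr_mono2) auto
  also have "\<dots> = max x y powr (r + s)" by (simp add: powr_add)
  also have "\<dots> \<le> x powr (r + s) + y powr (r + s)" by (auto simp: max_def)
  finally show ?thesis .
qed

lemma abs_opow_mult_le:
  assumes "p > 1"
  shows "\<bar>opow p x * y\<bar> \<le> \<bar>x\<bar> powr (p + 1) + \<bar>y\<bar> powr (p + 1)"
  using powr_mult_le_sum[of "\<bar>x\<bar>" "\<bar>y\<bar>" p 1] assms by (simp add: abs_mult abs_opow)

lemma abs_powr_rem_le:
  assumes "p > 1"
  shows "\<bar>powr_rem p x y\<bar> \<le> (2 powr (p + 1) + 2) * (\<bar>x\<bar> powr (p + 1) + \<bar>y\<bar> powr (p + 1))"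
proof -
  let ?X = "\<bar>x\<bar> powr (p + 1)" and ?Y = "\<bar>y\<bar> powr (p + 1)" and ?Z = "\<bar>x + y\<bar> powr (p + 1)"
  have Z: "?Z \<le> 2 powr (p + 1) * (?X + ?Y)"
  proof -
    have "?Z \<le> (\<bar>x\<bar> + \<bar>y\<bar>) powr (p + 1)" using assms by (intro powr_mono2) auto
    also have "\<dots> \<le> 2 powr (p + 1) * (?X + ?Y)" using assms by (intro powr_add_le) auto
    finally show ?thesis .
  qed
  have "powr_rem p x y \<le> ?Z / (p + 1) + \<bar>opow p x * y\<bar>"
  proof -
    have "0 \<le> ?X / (p + 1)" using assms by simp
    then show ?thesis
      using abs_ge_minus_self[of "opow p x * y"] unfolding powr_rem_def diff_divide_distrib by linarith
  qed
  also have "?Z / (p + 1) \<le> ?Z" using assms by (simp add: field_simps)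
  finally have "powr_rem p x y \<le> 2 powr (p + 1) * (?X + ?Y) + (?X + ?Y)"
    using Z abs_opow_mult_le[OF assms, of x y] by linarith
  also have "\<dots> \<le> (2 powr (p + 1) + 2) * (?X + ?Y)" by (simp add: algebra_simps)
  finally show ?thesis using powr_rem_nonneg[OF assms, of x y] by simp
qed

lemma abs_powr_square: "\<bar>y\<bar> powr (p - 1) * y\<^sup>2 = \<bar>y::real\<bar> powr (p + 1)"
  using powr_add[of "\<bar>y\<bar>" "p - 1" 2] by (cases "y = 0") (simp_all add: add.commute)

text \<open>The mean value theorem, with the derivative at the intermediate point estimated by
  \<open>powr_add_le\<close>. It bounds the Dirichlet integral from above once the first-order
  condition is known.\<close>

lemma opow_diff_le:
  assumes p: "p > 1"
  shows "(opow p (x + y) - opow p x) * y \<le> p * 2 powr (p - 1) * (\<bar>x\<bar> powr (p - 1) * y\<^sup>2 + \<bar>y\<bar> powr (p + 1))"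
proof -
  have mvt: "\<exists>\<xi>. \<bar>\<xi>\<bar> \<le> \<bar>x\<bar> + \<bar>y\<bar> \<and> opow p (x + y) - opow p x = y * (p * \<bar>\<xi>\<bar> powr (p - 1))"
  proof -
    consider "y > 0" | "y < 0" | "y = 0" by linarith
    then show ?thesis
    proof cases
      case 1
      have "\<exists>z>x. z < x + y \<and> opow p (x + y) - opow p x = (x + y - x) * (p * \<bar>z\<bar> powr (p - 1))"
        by (rule MVT2) (use 1 opow_has_derivative[OF p] in auto)
      then obtain z where "x < z" "z < x + y" "opow p (x + y) - opow p x = y * (p * \<bar>z\<bar> powr (p - 1))" by auto
      then show ?thesis by (intro exI[of _ z]) auto
    next
      case 2
      have "\<exists>z>x + y. z < x \<and> opow p x - opow p (x + y) = (x - (x + y)) * (p * \<bar>z\<bar> powr (p - 1))"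
        by (rule MVT2) (use 2 opow_has_derivative[OF p] in auto)
      then obtain z where "x + y < z" "z < x" "opow p x - opow p (x + y) = - y * (p * \<bar>z\<bar> powr (p - 1))" by auto
      then show ?thesis by (intro exI[of _ z]) auto
    qed (auto intro!: exI[of _ x])
  qed
  then obtain \<xi> where \<xi>: "\<bar>\<xi>\<bar> \<le> \<bar>x\<bar> + \<bar>y\<bar>" "opow p (x + y) - opow p x = y * (p * \<bar>\<xi>\<bar> powr (p - 1))" by blast
  have "\<bar>\<xi>\<bar> powr (p - 1) \<le> (\<bar>x\<bar> + \<bar>y\<bar>) powr (p - 1)" using p \<xi> by (intro powr_mono2) auto
  also have "\<dots> \<le> 2 powr (p - 1) * (\<bar>x\<bar> powr (p - 1) + \<bar>y\<bar> powr (p - 1))" using p by (intro powr_add_le) auto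
  finally have "p * \<bar>\<xi>\<bar> powr (p - 1) * y\<^sup>2 \<le> p * (2 powr (p - 1) * (\<bar>x\<bar> powr (p - 1) + \<bar>y\<bar> powr (p - 1))) * y\<^sup>2"
    using p by (intro mult_right_mono mult_left_mono) auto
  also have "\<dots> = p * 2 powr (p - 1) * (\<bar>x\<bar> powr (p - 1) * y\<^sup>2 + \<bar>y\<bar> powr (p + 1))"
    unfolding abs_powr_square[symmetric] by (simp add: algebra_simps)
  finally show ?thesis by (simp add: \<xi>(2) power2_eq_square mult_ac)
qed

text \<open>For \<open>x = 0\<close> the left-hand side below is \<open>(p - 1) \<bar>y\<bar>\<^sup>p\<^sup>+\<^sup>1\<close>; the general case is a perturbation of this
  one as long as \<open>\<bar>x\<bar>\<close> is small relative to \<open>\<bar>y\<bar>\<close>, and trivial otherwise.\<close>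
lemma opow_second_order:
  assumes p: "p > 1"
  obtains c C where "c > 0" "C \<ge> 0" "\<And>x y. p * \<bar>x + y\<bar> powr (p - 1) * y\<^sup>2 - (opow p (x + y) - opow p x) * y
    \<ge> c * \<bar>y\<bar> powr (p + 1) - C * (\<bar>x\<bar> powr (p - 1) * y\<^sup>2)"
proof -
  \<comment> \<open>The expression is the coefficient of \<open>\<bar>y\<bar> powr (p + 1)\<close>
    obtained when \<open>\<bar>x\<bar> \<le> \<delta> \<bar>y\<bar>\<close>. Its limit is
    \<open>p - 1\<close>, so half of that remains for some small \<open>\<delta>\<close>.\<close>
  have "((\<lambda>\<delta>. p * (1 - \<delta>) powr (p - 1) - (1 + \<delta>) powr p - \<delta> powr p)
      \<longlongrightarrow> p * (1 - 0) powr (p - 1) - (1 + 0) powr p - 0 powr p) (at_right 0)"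
    using p by (intro tendsto_intros tendsto_powr') (auto intro: eventually_mono[OF eventually_at_right_less])
  then have "\<forall>\<^sub>F \<delta> in at_right 0. p * (1 - \<delta>) powr (p - 1) - (1 + \<delta>) powr p - \<delta> powr p > (p - 1) / 2"
    using p by (intro order_tendstoD) (auto simp: field_simps)
  then have "\<forall>\<^sub>F \<delta> in at_right 0. p * (1 - \<delta>) powr (p - 1) - (1 + \<delta>) powr p - \<delta> powr p > (p - 1) / 2 \<and> 0 < \<delta> \<and> \<delta> < 1"
    using eventually_at_right_real[OF zero_less_one] by eventually_elim auto
  then obtain \<delta> where \<delta>: "0 < \<delta>" "\<delta> < 1" "p * (1 - \<delta>) powr (p - 1) - (1 + \<delta>) powr p - \<delta> powr p > (p - 1) / 2"
    using eventually_happens trivial_limit_at_right_real by blast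
  define c where "c = (p - 1) / 2"
  define C\<^sub>2 where "C\<^sub>2 = p * 2 powr (p - 1)"
  \<comment> \<open>If \<open>\<bar>x\<bar> > \<delta> \<bar>y\<bar>\<close>, then
    \<open>\<bar>y\<bar> powr (p + 1)\<close> is at most \<open>(1 / \<delta>) powr (p - 1)\<close>
    times \<open>\<bar>x\<bar> powr (p - 1) * y\<^sup>2\<close>. The constant absorbs both
    \<open>c\<close> and the upper bound of \<open>opow_diff_le\<close> in that case.\<close>
  define C where "C = C\<^sub>2 + (C\<^sub>2 + c) * (1 / \<delta>) powr (p - 1)"
  have pos: "c > 0" "C\<^sub>2 \<ge> 0" using p by (auto simp: c_def C\<^sub>2_def)
  then have C: "C \<ge> 0" by (simp add: C_def)
  have "p * \<bar>x + y\<bar> powr (p - 1) * y\<^sup>2 - (opow p (x + y) - opow p x) * y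
    \<ge> c * \<bar>y\<bar> powr (p + 1) - C * (\<bar>x\<bar> powr (p - 1) * y\<^sup>2)" for x y
  proof (cases "\<bar>x\<bar> \<le> \<delta> * \<bar>y\<bar>")
    case True
    let ?Y = "\<bar>y\<bar> powr (p + 1)"
    have "(1 - \<delta>) * \<bar>y\<bar> \<le> \<bar>x + y\<bar>" using True by (simp add: algebra_simps)
    then have "((1 - \<delta>) * \<bar>y\<bar>) powr (p - 1) \<le> \<bar>x + y\<bar> powr (p - 1)" using \<delta> p by (intro powr_mono2) auto
    then have "p * ((1 - \<delta>) * \<bar>y\<bar>) powr (p - 1) * y\<^sup>2 \<le> p * \<bar>x + y\<bar> powr (p - 1) * y\<^sup>2"
      using p by (intro mult_left_mono mult_right_mono) auto
    then have 1: "p * (1 - \<delta>) powr (p - 1) * ?Y \<le> p * \<bar>x + y\<bar> powr (p - 1) * y\<^sup>2"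
      using \<delta> by (simp add: powr_mult mult.assoc abs_powr_square)
    have "\<bar>opow p (x + y)\<bar> \<le> ((1 + \<delta>) * \<bar>y\<bar>) powr p"
      unfolding abs_opow using True p by (intro powr_mono2) (auto simp: algebra_simps)
    moreover have "\<bar>opow p x\<bar> \<le> (\<delta> * \<bar>y\<bar>) powr p"
      unfolding abs_opow using True p by (intro powr_mono2) auto
    ultimately have "\<bar>opow p (x + y) - opow p x\<bar> * \<bar>y\<bar> \<le> (((1 + \<delta>) * \<bar>y\<bar>) powr p + (\<delta> * \<bar>y\<bar>) powr p) * \<bar>y\<bar>"
      by (intro mult_right_mono) auto
    moreover have "\<bar>y\<bar> powr p * \<bar>y\<bar> = ?Y" by (simp add: powr_add)
    ultimately have "\<bar>opow p (x + y) - opow p x\<bar> * \<bar>y\<bar> \<le> ((1 + \<delta>) powr p + \<delta> powr p) * ?Y"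
      unfolding powr_mult by (simp only: distrib_right mult.assoc)
    then have 2: "(opow p (x + y) - opow p x) * y \<le> ((1 + \<delta>) powr p + \<delta> powr p) * ?Y"
      using abs_ge_self[of "(opow p (x + y) - opow p x) * y"] by (simp only: abs_mult)
    have "c * ?Y \<le> (p * (1 - \<delta>) powr (p - 1) - (1 + \<delta>) powr p - \<delta> powr p) * ?Y"
      using \<delta>(3) by (intro mult_right_mono) (auto simp: c_def)
    also have "\<dots> = p * (1 - \<delta>) powr (p - 1) * ?Y - ((1 + \<delta>) powr p + \<delta> powr p) * ?Y"
      by (simp add: algebra_simps)
    finally have "c * ?Y \<le> p * \<bar>x + y\<bar> powr (p - 1) * y\<^sup>2 - (opow p (x + y) - opow p x) * y"
      using 1 2 by linarith
    moreover have "0 \<le> C * (\<bar>x\<bar> powr (p - 1) * y\<^sup>2)" using C by simp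
    ultimately show ?thesis by linarith
  next
    case False
    let ?Y = "\<bar>y\<bar> powr (p + 1)" and ?Q = "\<bar>x\<bar> powr (p - 1) * y\<^sup>2"
    have "\<bar>y\<bar> powr (p - 1) \<le> ((1 / \<delta>) * \<bar>x\<bar>) powr (p - 1)"
      using False \<delta> p by (intro powr_mono2) (auto simp: field_simps)
    then have "\<bar>y\<bar> powr (p - 1) * y\<^sup>2 \<le> ((1 / \<delta>) powr (p - 1) * \<bar>x\<bar> powr (p - 1)) * y\<^sup>2"
      using \<delta> by (intro mult_right_mono) (auto simp: powr_mult[symmetric])
    then have Y: "?Y \<le> (1 / \<delta>) powr (p - 1) * ?Q" by (simp add: abs_powr_square mult.assoc)
    have "(opow p (x + y) - opow p x) * y \<le> C\<^sub>2 * (?Q + ?Y)"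
      using opow_diff_le[OF p] by (simp add: C\<^sub>2_def)
    moreover have "0 \<le> p * \<bar>x + y\<bar> powr (p - 1) * y\<^sup>2" using p by simp
    moreover have "(C\<^sub>2 + c) * ?Y \<le> (C\<^sub>2 + c) * ((1 / \<delta>) powr (p - 1) * ?Q)"
      using pos Y by (intro mult_left_mono) auto
    ultimately show ?thesis by (simp add: C_def algebra_simps)
  qed
  with pos C show thesis by (intro that[of c C]) auto
qed

text \<open>For \<open>x = 0\<close> the remainder is
  \<open>\<bar>y\<bar> powr (p + 1) / (p + 1)\<close>, and half of the coefficient survives when
  \<open>\<bar>x\<bar>\<close> is small relative to \<open>\<bar>y\<bar>\<close>. Otherwise
  \<open>C\<close> makes the lower bound nonpositive. This superquadratic growth drives the energy
  on a ray below zero.\<close>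

lemma powr_rem_coercive:
  assumes p: "p > 1"
  obtains c C where "c > 0" "C \<ge> 0" "\<And>x y. powr_rem p x y \<ge> c * \<bar>y\<bar> powr (p + 1) - C * \<bar>x\<bar> powr (p + 1)"
proof -
  have "((\<lambda>\<delta>. (1 - \<delta>) powr (p + 1) / (p + 1) - \<delta> powr (p + 1) / (p + 1) - \<delta> powr p)
      \<longlongrightarrow> (1 - 0) powr (p + 1) / (p + 1) - 0 powr (p + 1) / (p + 1) - 0 powr p) (at_right 0)"
    using p by (intro tendsto_intros tendsto_powr') (auto intro: eventually_mono[OF eventually_at_right_less])
  then have "\<forall>\<^sub>F \<delta> in at_right 0. (1 - \<delta>) powr (p + 1) / (p + 1) - \<delta> powr (p + 1) / (p + 1) - \<delta> powr p > 1 / (2 * (p + 1))"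
  proof (rule order_tendstoD)
    have "1 / (2 * (p + 1)) < 1 / (p + 1)" using p by (intro divide_strict_left_mono) auto
    then show "1 / (2 * (p + 1)) < (1 - 0) powr (p + 1) / (p + 1) - 0 powr (p + 1) / (p + 1) - 0 powr p" by simp
  qed
  then have "\<forall>\<^sub>F \<delta> in at_right 0. (1 - \<delta>) powr (p + 1) / (p + 1) - \<delta> powr (p + 1) / (p + 1) - \<delta> powr p > 1 / (2 * (p + 1)) \<and> 0 < \<delta> \<and> \<delta> < 1"
    using eventually_at_right_real[OF zero_less_one] by eventually_elim auto
  then obtain \<delta> where \<delta>: "0 < \<delta>" "\<delta> < 1"
    "(1 - \<delta>) powr (p + 1) / (p + 1) - \<delta> powr (p + 1) / (p + 1) - \<delta> powr p > 1 / (2 * (p + 1))"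
    using eventually_happens trivial_limit_at_right_real by blast
  define c where "c = 1 / (2 * (p + 1))"
  define C where "C = c * (1 / \<delta>) powr (p + 1)"
  have pos: "c > 0" "C \<ge> 0" using p by (auto simp: c_def C_def)
  have "powr_rem p x y \<ge> c * \<bar>y\<bar> powr (p + 1) - C * \<bar>x\<bar> powr (p + 1)" for x y
  proof (cases "\<bar>x\<bar> \<le> \<delta> * \<bar>y\<bar>")
    case True
    let ?Y = "\<bar>y\<bar> powr (p + 1)"
    have "(1 - \<delta>) * \<bar>y\<bar> \<le> \<bar>x + y\<bar>" using True by (simp add: algebra_simps)
    then have "((1 - \<delta>) * \<bar>y\<bar>) powr (p + 1) \<le> \<bar>x + y\<bar> powr (p + 1)" using \<delta> p by (intro powr_mono2) auto
    then have 1: "(1 - \<delta>) powr (p + 1) / (p + 1) * ?Y \<le> \<bar>x + y\<bar> powr (p + 1) / (p + 1)"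
      using \<delta> p by (simp add: powr_mult divide_right_mono)
    have "\<bar>x\<bar> powr (p + 1) \<le> (\<delta> * \<bar>y\<bar>) powr (p + 1)" using True p by (intro powr_mono2) auto
    then have 2: "\<bar>x\<bar> powr (p + 1) / (p + 1) \<le> \<delta> powr (p + 1) / (p + 1) * ?Y"
      using \<delta> p by (simp add: powr_mult divide_right_mono)
    have "\<bar>opow p x\<bar> \<le> (\<delta> * \<bar>y\<bar>) powr p" unfolding abs_opow using True p by (intro powr_mono2) auto
    then have "\<bar>opow p x\<bar> * \<bar>y\<bar> \<le> (\<delta> * \<bar>y\<bar>) powr p * \<bar>y\<bar>" by (intro mult_right_mono) auto
    moreover have "\<bar>y\<bar> powr p * \<bar>y\<bar> = ?Y" by (simp add: powr_add)
    ultimately have 3: "opow p x * y \<le> \<delta> powr p * ?Y"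
      using \<delta> abs_ge_self[of "opow p x * y"] by (simp add: powr_mult mult.assoc abs_mult)
    have "c * ?Y \<le> ((1 - \<delta>) powr (p + 1) / (p + 1) - \<delta> powr (p + 1) / (p + 1) - \<delta> powr p) * ?Y"
      using \<delta>(3) by (intro mult_right_mono) (auto simp: c_def)
    also have "\<dots> = (1 - \<delta>) powr (p + 1) / (p + 1) * ?Y - \<delta> powr (p + 1) / (p + 1) * ?Y - \<delta> powr p * ?Y"
      by (simp add: algebra_simps)
    also have "\<dots> \<le> powr_rem p x y"
      using 1 2 3 unfolding powr_rem_def diff_divide_distrib by linarith
    finally show ?thesis using pos by (smt (verit) mult_nonneg_nonneg powr_ge_zero)
  next
    case False
    have "\<bar>y\<bar> powr (p + 1) \<le> ((1 / \<delta>) * \<bar>x\<bar>) powr (p + 1)"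
      using False \<delta> p by (intro powr_mono2) (auto simp: field_simps)
    also have "\<dots> = (1 / \<delta>) powr (p + 1) * \<bar>x\<bar> powr (p + 1)" using \<delta> by (intro powr_mult) 
    finally have "c * \<bar>y\<bar> powr (p + 1) \<le> C * \<bar>x\<bar> powr (p + 1)"
      using pos by (simp add: C_def mult.assoc)
    then show ?thesis using powr_rem_nonneg[OF p, of x y] by linarith
  qed
  with pos show thesis by (intro that) auto
qed

text \<open>Value and first derivative of the remainder along \<open>t * y\<close> vanish at
  \<open>t = 0\<close>, so only the Lagrange term of order two is left. Its explicit form allows
  dominated convergence of the second difference quotients.\<close>

lemma powr_rem_Taylor:
  assumes p: "p > 1" and \<epsilon>: "\<epsilon> > 0"
  obtains \<theta> where "0 < \<theta>" "\<theta> < \<epsilon>" "powr_rem p x (\<epsilon> * y) = p * \<bar>x + \<theta> * y\<bar> powr (p - 1) * y\<^sup>2 / 2 * \<epsilon>\<^sup>2"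
proof -
  define D where "D = (\<lambda>m t. if m = 0 then powr_rem p x (t * y) else if m = Suc 0 then (opow p (x + t * y) - opow p x) * y
    else p * \<bar>x + t * y\<bar> powr (p - 1) * y\<^sup>2)"
  have d: "((\<lambda>t. x + t * y) has_real_derivative y) (at t)" for t by (auto intro!: derivative_eq_intros)
  have d0: "((\<lambda>t. powr_rem p x (t * y)) has_real_derivative (opow p (x + t * y) - opow p x) * y) (at t)" for t
  proof -
    have "((\<lambda>t. \<bar>x + t * y\<bar> powr (p + 1)) has_real_derivative (p + 1) * opow p (x + t * y) * y) (at t)"
      using p by (intro DERIV_chain2[OF abs_powr_has_derivative d]) auto
    then have "((\<lambda>t. (\<bar>x + t * y\<bar> powr (p + 1) - \<bar>x\<bar> powr (p + 1)) / (p + 1) - opow p x * (t * y))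
        has_real_derivative ((p + 1) * opow p (x + t * y) * y - 0) / (p + 1) - opow p x * (1 * y)) (at t)"
      by (intro DERIV_diff DERIV_cdivide DERIV_const DERIV_cmult DERIV_cmult_right DERIV_ident)
    moreover have "((p + 1) * opow p (x + t * y) * y - 0) / (p + 1) - opow p x * (1 * y) = (opow p (x + t * y) - opow p x) * y"
      using p by (simp add: field_simps)
    ultimately show ?thesis by (simp add: powr_rem_def)
  qed
  have d1: "((\<lambda>t. (opow p (x + t * y) - opow p x) * y) has_real_derivative p * \<bar>x + t * y\<bar> powr (p - 1) * y\<^sup>2) (at t)" for t
  proof -
    have "((\<lambda>t. (opow p (x + t * y) - opow p x) * y) has_real_derivative (p * \<bar>x + t * y\<bar> powr (p - 1) * y - 0) * y) (at t)"
      by (intro DERIV_cmult_right DERIV_diff DERIV_const DERIV_chain2[OF opow_has_derivative[OF p] d])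
    then show ?thesis by (simp add: power2_eq_square mult.assoc)
  qed
  have "\<exists>t>0. t < \<epsilon> \<and> powr_rem p x (\<epsilon> * y) = (\<Sum>m<2. D m 0 / fact m * \<epsilon> ^ m) + D 2 t / fact 2 * \<epsilon>\<^sup>2"
  proof (rule Maclaurin[OF \<epsilon>])
    show "D 0 = (\<lambda>t. powr_rem p x (t * y))" by (simp add: D_def)
    show "\<forall>m t. m < 2 \<and> 0 \<le> t \<and> t \<le> \<epsilon> \<longrightarrow> (D m has_real_derivative D (Suc m) t) (at t)"
      using d0 d1 by (auto simp: D_def less_2_cases_iff)
  qed auto
  then obtain t where t: "0 < t" "t < \<epsilon>" "powr_rem p x (\<epsilon> * y) = (\<Sum>m<2. D m 0 / fact m * \<epsilon> ^ m) + D 2 t / fact 2 * \<epsilon>\<^sup>2" by blast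
  have "(\<Sum>m<2. D m 0 / fact m * \<epsilon> ^ m) = 0" by (simp add: D_def numeral_2_eq_2 powr_rem_def)
  then show thesis using t by (intro that[of t]) (auto simp: D_def)
qed

section \<open>The minimax characterization\<close>

text \<open>The Lebesgue space of exponent \<open>p + 1\<close> on the whole space, the exponent of
  the energy rather than that of the nonlinearity.\<close>

definition Lpow :: "real \<Rightarrow> (real^'n::finite \<Rightarrow> real) set" where
  "Lpow p = {u \<in> borel_measurable lebesgue. integrable lebesgue (\<lambda>x. \<bar>u x\<bar> powr (p + 1))}"

lemma Lpow_bound:
  assumes "m \<in> Lpow p" "u \<in> borel_measurable lebesgue" "AE x in lebesgue. \<bar>u x\<bar> \<le> m x" "p > 1"
  shows "u \<in> Lpow p"
proof -
  have "integrable lebesgue (\<lambda>x. \<bar>u x\<bar> powr (p + 1))"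
  proof (rule Bochner_Integration.integrable_bound)
    show "integrable lebesgue (\<lambda>x. \<bar>m x\<bar> powr (p + 1))" using assms by (simp add: Lpow_def)
    show "AE x in lebesgue. norm (\<bar>u x\<bar> powr (p + 1)) \<le> norm (\<bar>m x\<bar> powr (p + 1))"
      using assms(3) by eventually_elim (use assms(4) in \<open>auto intro!: powr_mono2\<close>)
  qed (use assms in measurable)
  with assms show ?thesis by (simp add: Lpow_def)
qed

text \<open>Combinations of absolute values serve as dominating functions in the limits along rays
  and competitors.\<close>

lemma Lpow_abs_lincomb:
  assumes "u \<in> Lpow p" "v \<in> Lpow p" "p > 1" "s \<ge> 0" "t \<ge> 0"
  shows "(\<lambda>x. s * \<bar>u x\<bar> + t * \<bar>v x\<bar>) \<in> Lpow p"
proof -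
  have m[measurable]: "u \<in> borel_measurable lebesgue" "v \<in> borel_measurable lebesgue" using assms by (auto simp: Lpow_def)
  have "integrable lebesgue (\<lambda>x. \<bar>s * \<bar>u x\<bar> + t * \<bar>v x\<bar>\<bar> powr (p + 1))"
  proof (rule Bochner_Integration.integrable_bound)
    show "integrable lebesgue (\<lambda>x. 2 powr (p + 1) * (s powr (p + 1) * \<bar>u x\<bar> powr (p + 1) + t powr (p + 1) * \<bar>v x\<bar> powr (p + 1)))"
      using assms by (auto simp: Lpow_def)
    show "AE x in lebesgue. norm (\<bar>s * \<bar>u x\<bar> + t * \<bar>v x\<bar>\<bar> powr (p + 1))
        \<le> norm (2 powr (p + 1) * (s powr (p + 1) * \<bar>u x\<bar> powr (p + 1) + t powr (p + 1) * \<bar>v x\<bar> powr (p + 1)))"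
    proof (intro AE_I2)
      fix x
      have "\<bar>s * \<bar>u x\<bar> + t * \<bar>v x\<bar>\<bar> powr (p + 1) = (s * \<bar>u x\<bar> + t * \<bar>v x\<bar>) powr (p + 1)" using assms by simp
      also have "\<dots> \<le> 2 powr (p + 1) * ((s * \<bar>u x\<bar>) powr (p + 1) + (t * \<bar>v x\<bar>) powr (p + 1))"
        using assms by (intro powr_add_le) auto
      also have "\<dots> = 2 powr (p + 1) * (s powr (p + 1) * \<bar>u x\<bar> powr (p + 1) + t powr (p + 1) * \<bar>v x\<bar> powr (p + 1))"
        using assms by (simp add: powr_mult)
      finally show "norm (\<bar>s * \<bar>u x\<bar> + t * \<bar>v x\<bar>\<bar> powr (p + 1))
        \<le> norm (2 powr (p + 1) * (s powr (p + 1) * \<bar>u x\<bar> powr (p + 1) + t powr (p + 1) * \<bar>v x\<bar> powr (p + 1)))" by simp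
    qed
  qed measurable
  then show ?thesis by (simp add: Lpow_def)
qed

lemma Lpow_lincomb:
  assumes "u \<in> Lpow p" "v \<in> Lpow p" "p > 1"
  shows "(\<lambda>x. s * u x + t * v x) \<in> Lpow p"
proof (rule Lpow_bound[OF Lpow_abs_lincomb[OF assms, of "\<bar>s\<bar>" "\<bar>t\<bar>"]])
  show "AE x in lebesgue. \<bar>s * u x + t * v x\<bar> \<le> \<bar>s\<bar> * \<bar>u x\<bar> + \<bar>t\<bar> * \<bar>v x\<bar>"
    using abs_triangle_ineq by (intro AE_I2) (simp flip: abs_mult)
qed (use assms in \<open>auto simp: Lpow_def\<close>)

lemma Lpow_scale: "u \<in> Lpow p \<Longrightarrow> p > 1 \<Longrightarrow> (\<lambda>x. s * u x) \<in> Lpow p"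
  using Lpow_lincomb[of u p u s 0] by simp

lemma Lpow_integrable: "u \<in> Lpow p \<Longrightarrow> integrable lebesgue (\<lambda>x. \<bar>u x\<bar> powr (p + 1))"
  and Lpow_measurable: "u \<in> Lpow p \<Longrightarrow> u \<in> borel_measurable lebesgue"
  by (simp_all add: Lpow_def)

lemma integrable_opow_mult:
  assumes "u \<in> Lpow p" "v \<in> Lpow p" "p > 1"
  shows "integrable lebesgue (\<lambda>x. opow p (u x) * v x)"
proof (rule Bochner_Integration.integrable_bound)
  show "integrable lebesgue (\<lambda>x. \<bar>u x\<bar> powr (p + 1) + \<bar>v x\<bar> powr (p + 1))"
    using assms by (auto simp: Lpow_def)
  show "AE x in lebesgue. norm (opow p (u x) * v x) \<le> norm (\<bar>u x\<bar> powr (p + 1) + \<bar>v x\<bar> powr (p + 1))"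
    using abs_opow_mult_le[OF assms(3)] by (intro AE_I2) auto
  have [measurable]: "u \<in> borel_measurable lebesgue" "v \<in> borel_measurable lebesgue" using assms by (auto simp: Lpow_def)
  show "(\<lambda>x. opow p (u x) * v x) \<in> borel_measurable lebesgue" by measurable
qed

lemma powr_rem_measurable [measurable]: "case_prod (powr_rem p) \<in> borel_measurable (borel \<Otimes>\<^sub>M borel)"
  unfolding powr_rem_def by measurable

lemma integrable_powr_rem:
  assumes "u \<in> Lpow p" "v \<in> Lpow p" "p > 1"
  shows "integrable lebesgue (\<lambda>x. powr_rem p (u x) (v x))"
proof -
  have "integrable lebesgue (\<lambda>x. \<bar>u x + v x\<bar> powr (p + 1))"
    using Lpow_lincomb[OF assms, of 1 1] by (simp add: Lpow_def)
  then show ?thesis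
    unfolding powr_rem_def using assms integrable_opow_mult[OF assms] by (simp add: Lpow_def)
qed

lemma tendsto_integral_powr_rem:
  assumes a: "a \<in> Lpow p" and m: "m \<in> Lpow p" and p: "p > 1"
    and y: "\<And>n. y n \<in> borel_measurable lebesgue" "z \<in> borel_measurable lebesgue"
    and lim: "AE x in lebesgue. (\<lambda>n. y n x) \<longlonglongrightarrow> z x" and bd: "\<And>n. AE x in lebesgue. \<bar>y n x\<bar> \<le> m x"
  shows "(\<lambda>n. \<integral>x. powr_rem p (a x) (y n x) \<partial>lebesgue) \<longlonglongrightarrow> (\<integral>x. powr_rem p (a x) (z x) \<partial>lebesgue)"
proof (rule integral_dominated_convergence)
  have [measurable]: "a \<in> borel_measurable lebesgue" using a by (simp add: Lpow_def)
  note y[measurable]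
  show "(\<lambda>x. powr_rem p (a x) (z x)) \<in> borel_measurable lebesgue"
    "\<And>n. (\<lambda>x. powr_rem p (a x) (y n x)) \<in> borel_measurable lebesgue" by measurable
  show "integrable lebesgue (\<lambda>x. (2 powr (p + 1) + 2) * (\<bar>a x\<bar> powr (p + 1) + \<bar>m x\<bar> powr (p + 1)))"
    using a m by (auto simp: Lpow_def)
  show "AE x in lebesgue. (\<lambda>n. powr_rem p (a x) (y n x)) \<longlonglongrightarrow> powr_rem p (a x) (z x)"
    using lim
  proof eventually_elim
    case (elim x)
    then show ?case unfolding powr_rem_def using p
      by (intro tendsto_intros tendsto_powr') auto
  qed
  show "AE x in lebesgue. norm (powr_rem p (a x) (y n x)) \<le> (2 powr (p + 1) + 2) * (\<bar>a x\<bar> powr (p + 1) + \<bar>m x\<bar> powr (p + 1))" for n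
    using bd[of n]
  proof eventually_elim
    case (elim x)
    have "norm (powr_rem p (a x) (y n x)) \<le> (2 powr (p + 1) + 2) * (\<bar>a x\<bar> powr (p + 1) + \<bar>y n x\<bar> powr (p + 1))"
      using abs_powr_rem_le[OF p] by simp
    also have "\<dots> \<le> (2 powr (p + 1) + 2) * (\<bar>a x\<bar> powr (p + 1) + \<bar>m x\<bar> powr (p + 1))"
      using elim p by (intro mult_left_mono add_left_mono powr_mono2) auto
    finally show ?case .
  qed
qed

lemma tendsto_integral_abs_powr:
  assumes m: "m \<in> Lpow p" and p: "p > 1"
    and y: "\<And>n. y n \<in> borel_measurable lebesgue" "z \<in> borel_measurable lebesgue"
    and lim: "AE x in lebesgue. (\<lambda>n. y n x) \<longlonglongrightarrow> z x" and bd: "\<And>n. AE x in lebesgue. \<bar>y n x\<bar> \<le> m x"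
  shows "(\<lambda>n. \<integral>x. \<bar>y n x\<bar> powr (p + 1) \<partial>lebesgue) \<longlonglongrightarrow> (\<integral>x. \<bar>z x\<bar> powr (p + 1) \<partial>lebesgue)"
proof -
  \<comment> \<open>With base point \<open>0\<close> the remainder is a multiple of the power, so
    the preceding limit lemma covers this one.\<close>
  have "powr_rem p 0 t = \<bar>t\<bar> powr (p + 1) / (p + 1)" for t using p by (simp add: powr_rem_def)
  moreover have "(\<lambda>x. 0) \<in> Lpow p" by (simp add: Lpow_def)
  note tendsto_integral_powr_rem[OF this m p y lim bd]
  ultimately have "(\<lambda>n. (\<integral>x. \<bar>y n x\<bar> powr (p + 1) \<partial>lebesgue) / (p + 1)) \<longlonglongrightarrow> (\<integral>x. \<bar>z x\<bar> powr (p + 1) \<partial>lebesgue) / (p + 1)"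
    by simp
  from tendsto_mult_right[OF this, of "p + 1"] show ?thesis using p by simp
qed

section \<open>The energy along rays from the small minimizer\<close>

definition energy0 :: "(real^'n::finite \<Rightarrow> real) \<Rightarrow> real \<Rightarrow> (real^'n \<Rightarrow> real) \<Rightarrow> (real^'n \<Rightarrow> real^'n) \<Rightarrow> real" where
  "energy0 w p u g = 1 / 2 * (\<integral>x. (norm (g x))\<^sup>2 \<partial>lebesgue)
     - 1 / (p + 1) * (\<integral>x. \<bar>u x\<bar> powr (p + 1) \<partial>lebesgue) - (\<integral>x. w x * u x \<partial>lebesgue)"

text \<open>The energy of \<open>a + t k\<close> minus that of \<open>a\<close>, for a critical point \<open>a\<close>.\<close>
definition ray_energy :: "real \<Rightarrow> (real^'n::finite \<Rightarrow> real) \<Rightarrow> (real^'n \<Rightarrow> real) \<Rightarrow> (real^'n \<Rightarrow> real^'n) \<Rightarrow> real \<Rightarrow> real" where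
  "ray_energy p a k gk t = 1 / 2 * t\<^sup>2 * (\<integral>x. (norm (gk x))\<^sup>2 \<partial>lebesgue) - (\<integral>x. powr_rem p (a x) (t * k x) \<partial>lebesgue)"

lemma ray_energy_0 [simp]: "ray_energy p a k gk 0 = 0"
  by (simp add: ray_energy_def powr_rem_def)

lemma integral_norm_add_scaled:
  assumes "g \<in> L2 UNIV" "h \<in> L2 UNIV"
  shows "(\<integral>x. (norm (g x + t *\<^sub>R h x))\<^sup>2 \<partial>lebesgue)
    = (\<integral>x. (norm (g x))\<^sup>2 \<partial>lebesgue) + 2 * t * (\<integral>x. g x \<bullet> h x \<partial>lebesgue) + t\<^sup>2 * (\<integral>x. (norm (h x))\<^sup>2 \<partial>lebesgue)"
  using integral_lincomb_L2[of g lebesgue h 1 t] assms by (simp add: L2_UNIV)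

text \<open>The number \<open>S\<close> is the square of a Sobolev constant: raising
  \<open>sobolev_le\<close> to the power \<open>2 / (p + 1)\<close> gives a bound of the squared
  norm by \<open>S\<close> times the Dirichlet integral. Smallness of \<open>S\<close> is imposed
  separately, where a ray maximum has to be unique.\<close>

locale sobolev_domain =
  fixes U :: "(real^'n::finite) set" and p S :: real
  assumes p: "p > 1" and finite_measure: "U \<in> lmeasurable" and S: "S > 0"
    and sobolev_Lpow: "sobolev0 U u g \<Longrightarrow> u \<in> Lpow p"
    and sobolev_le: "sobolev0 U u g \<Longrightarrow>
      (\<integral>x. \<bar>u x\<bar> powr (p + 1) \<partial>lebesgue) \<le> (S * (\<integral>x. (norm (g x))\<^sup>2 \<partial>lebesgue)) powr ((p + 1) / 2)"
begin

text \<open>Keeping the linear term explicit lets one formula serve twice: it yields criticality of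
  the small minimizer, and after that reduces the energy on a ray to
  \<open>ray_energy\<close>.\<close>

lemma energy0_expand:
  assumes w: "w \<in> L2 UNIV" and a: "sobolev0 U a ga" and k: "sobolev0 U k gk"
  shows "energy0 w p (\<lambda>x. a x + t * k x) (\<lambda>x. ga x + t *\<^sub>R gk x) = energy0 w p a ga
    + t * ((\<integral>x. ga x \<bullet> gk x \<partial>lebesgue) - (\<integral>x. opow p (a x) * k x \<partial>lebesgue) - (\<integral>x. w x * k x \<partial>lebesgue))
    + ray_energy p a k gk t"
proof -
  have L: "a \<in> L2 UNIV" "k \<in> L2 UNIV" "ga \<in> L2 UNIV" "gk \<in> L2 UNIV" using a k by (auto simp: sobolev0_def)
  have P: "a \<in> Lpow p" "k \<in> Lpow p" "(\<lambda>x. t * k x) \<in> Lpow p" "(\<lambda>x. a x + t * k x) \<in> Lpow p"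
    using sobolev_Lpow[OF a] sobolev_Lpow[OF k] Lpow_lincomb[of a p k 1 t] Lpow_scale[of k p t] p by auto
  have g: "(\<integral>x. (norm (ga x + t *\<^sub>R gk x))\<^sup>2 \<partial>lebesgue) = (\<integral>x. (norm (ga x))\<^sup>2 \<partial>lebesgue)
      + 2 * t * (\<integral>x. ga x \<bullet> gk x \<partial>lebesgue) + t\<^sup>2 * (\<integral>x. (norm (gk x))\<^sup>2 \<partial>lebesgue)"
    using L by (intro integral_norm_add_scaled)
  have "(\<integral>x. \<bar>a x + t * k x\<bar> powr (p + 1) \<partial>lebesgue)
    = (\<integral>x. \<bar>a x\<bar> powr (p + 1) + (p + 1) * powr_rem p (a x) (t * k x) + (p + 1) * t * (opow p (a x) * k x) \<partial>lebesgue)"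
    using p by (intro Bochner_Integration.integral_cong) (auto simp: powr_rem_def field_simps)
  also have "\<dots> = (\<integral>x. \<bar>a x\<bar> powr (p + 1) \<partial>lebesgue) + (p + 1) * (\<integral>x. powr_rem p (a x) (t * k x) \<partial>lebesgue)
      + (p + 1) * t * (\<integral>x. opow p (a x) * k x \<partial>lebesgue)"
    using Lpow_integrable[OF P(1)] integrable_powr_rem[OF P(1,3) p] integrable_opow_mult[OF P(1,2) p] by simp
  finally have q: "1 / (p + 1) * (\<integral>x. \<bar>a x + t * k x\<bar> powr (p + 1) \<partial>lebesgue)
      = 1 / (p + 1) * (\<integral>x. \<bar>a x\<bar> powr (p + 1) \<partial>lebesgue) + (\<integral>x. powr_rem p (a x) (t * k x) \<partial>lebesgue)
      + t * (\<integral>x. opow p (a x) * k x \<partial>lebesgue)"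
    using p by (simp add: distrib_left)
  have "(\<integral>x. w x * (a x + t * k x) \<partial>lebesgue) = (\<integral>x. w x * a x + t * (w x * k x) \<partial>lebesgue)"
    by (simp add: algebra_simps)
  also have "\<dots> = (\<integral>x. w x * a x \<partial>lebesgue) + t * (\<integral>x. w x * k x \<partial>lebesgue)"
    using L2_inner[OF w L(1)] L2_inner[OF w L(2)] by simp
  finally show ?thesis unfolding energy0_def ray_energy_def g q by (simp add: algebra_simps)
qed

text \<open>The constraint is a strict inequality and therefore persists at \<open>a + t k\<close>
  for small \<open>t\<close>. Since the remainder is nonnegative, the energy gain is at most the
  linear term plus \<open>t\<^sup>2 B / 2\<close>; division by \<open>t\<close> and the use of
  \<open>k\<close> and \<open>- k\<close> give the equation.\<close>

lemma small_minimizer_critical: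
  assumes w: "w \<in> L2 UNIV" and a: "sobolev0 U a ga" and less: "(\<integral>x. \<bar>a x\<bar> powr (p + 1) \<partial>lebesgue) < 1"
    and min: "\<And>v h. sobolev0 U v h \<Longrightarrow> (\<integral>x. \<bar>v x\<bar> powr (p + 1) \<partial>lebesgue) < 1 \<Longrightarrow> energy0 w p a ga \<le> energy0 w p v h"
    and k: "sobolev0 U k gk"
  shows "(\<integral>x. ga x \<bullet> gk x \<partial>lebesgue) = (\<integral>x. opow p (a x) * k x \<partial>lebesgue) + (\<integral>x. w x * k x \<partial>lebesgue)"
proof -
  have nonneg: "0 \<le> (\<integral>x. ga x \<bullet> gk x \<partial>lebesgue) - (\<integral>x. opow p (a x) * k x \<partial>lebesgue) - (\<integral>x. w x * k x \<partial>lebesgue)"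
    if k: "sobolev0 U k gk" for k gk
  proof -
    define \<Lambda> where "\<Lambda> = (\<integral>x. ga x \<bullet> gk x \<partial>lebesgue) - (\<integral>x. opow p (a x) * k x \<partial>lebesgue) - (\<integral>x. w x * k x \<partial>lebesgue)"
    define B where "B = (\<integral>x. (norm (gk x))\<^sup>2 \<partial>lebesgue)"
    have P: "a \<in> Lpow p" "k \<in> Lpow p" using sobolev_Lpow[OF a] sobolev_Lpow[OF k] by auto
    define t where "t = (\<lambda>n. 1 / real (Suc n))"
    have t: "t \<longlonglongrightarrow> 0" unfolding t_def using LIMSEQ_inverse_real_of_nat by (simp add: inverse_eq_divide)
    have t0: "t n > 0" "t n \<le> 1" for n by (auto simp: t_def)
    have "(\<lambda>n. \<integral>x. \<bar>a x + t n * k x\<bar> powr (p + 1) \<partial>lebesgue) \<longlonglongrightarrow> (\<integral>x. \<bar>a x\<bar> powr (p + 1) \<partial>lebesgue)"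
    proof (rule tendsto_integral_abs_powr[OF Lpow_abs_lincomb[OF P p, of 1 1] p])
      show "AE x in lebesgue. (\<lambda>n. a x + t n * k x) \<longlonglongrightarrow> a x"
      proof (intro AE_I2)
        fix x show "(\<lambda>n. a x + t n * k x) \<longlonglongrightarrow> a x"
          using tendsto_add[OF tendsto_const tendsto_mult_left_zero[OF t], of "a x" "k x"] by simp
      qed
      show "AE x in lebesgue. \<bar>a x + t n * k x\<bar> \<le> 1 * \<bar>a x\<bar> + 1 * \<bar>k x\<bar>" for n
      proof (intro AE_I2)
        fix x
        have "\<bar>t n * k x\<bar> \<le> 1 * \<bar>k x\<bar>" unfolding abs_mult using t0[of n] by (intro mult_right_mono) auto
        then show "\<bar>a x + t n * k x\<bar> \<le> 1 * \<bar>a x\<bar> + 1 * \<bar>k x\<bar>" by linarith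
      qed
    qed (use P in \<open>auto simp: Lpow_def\<close>)
    then have "\<forall>\<^sub>F n in sequentially. (\<integral>x. \<bar>a x + t n * k x\<bar> powr (p + 1) \<partial>lebesgue) < 1"
      using less by (rule order_tendstoD)
    then have "\<forall>\<^sub>F n in sequentially. 0 \<le> \<Lambda> + 1 / 2 * t n * B"
    proof eventually_elim
      case (elim n)
      have s: "sobolev0 U (\<lambda>x. a x + t n * k x) (\<lambda>x. ga x + t n *\<^sub>R gk x)"
        using sobolev0_lincomb[OF a k, of 1 "t n"] by simp
      have "energy0 w p a ga \<le> energy0 w p a ga + t n * \<Lambda> + ray_energy p a k gk (t n)"
        using min[OF s elim] unfolding energy0_expand[OF w a k] \<Lambda>_def .
      moreover have "ray_energy p a k gk (t n) \<le> 1 / 2 * (t n)\<^sup>2 * B"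
        using powr_rem_nonneg[OF p] by (simp add: ray_energy_def B_def)
      ultimately have "0 \<le> t n * (\<Lambda> + 1 / 2 * t n * B)" by (simp add: algebra_simps power2_eq_square)
      then show ?case using t0[of n] by (simp add: zero_le_mult_iff)
    qed
    moreover have "(\<lambda>n. \<Lambda> + 1 / 2 * t n * B) \<longlonglongrightarrow> \<Lambda> + 1 / 2 * 0 * B" by (intro tendsto_intros t)
    ultimately have "0 \<le> \<Lambda> + 1 / 2 * 0 * B" by (intro tendsto_lowerbound[of _ _ sequentially]) auto
    then show ?thesis by (simp add: \<Lambda>_def)
  qed
  have "sobolev0 U (\<lambda>x. - k x) (\<lambda>x. - gk x)" using sobolev0_lincomb[OF k k, of "-1" 0] by simp
  from nonneg[OF this] nonneg[OF k] show ?thesis by simp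
qed

lemma ray_energy_tendsto:
  assumes "a \<in> Lpow p" "k \<in> Lpow p" "t \<longlonglongrightarrow> t\<^sub>0"
  shows "(\<lambda>n. ray_energy p a k gk (t n)) \<longlonglongrightarrow> ray_energy p a k gk t\<^sub>0"
proof -
  obtain T where T: "\<And>n. \<bar>t n\<bar> \<le> T" "T > 0"
    using convergent_imp_Bseq[OF convergentI[OF assms(3)]] by (auto simp: Bseq_def)
  have "(\<lambda>n. \<integral>x. powr_rem p (a x) (t n * k x) \<partial>lebesgue) \<longlonglongrightarrow> (\<integral>x. powr_rem p (a x) (t\<^sub>0 * k x) \<partial>lebesgue)"
  proof (rule tendsto_integral_powr_rem[OF assms(1) Lpow_abs_lincomb[OF assms(2,2) p, of T 0] p])
    show "AE x in lebesgue. (\<lambda>n. t n * k x) \<longlonglongrightarrow> t\<^sub>0 * k x"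
      using assms(3) by (intro AE_I2 tendsto_intros)
    show "AE x in lebesgue. \<bar>t n * k x\<bar> \<le> T * \<bar>k x\<bar> + 0 * \<bar>k x\<bar>" for n
      using T(1)[of n] by (intro AE_I2) (auto simp: abs_mult intro!: mult_right_mono)
  qed (use assms T in \<open>auto simp: Lpow_def\<close>)
  then show ?thesis unfolding ray_energy_def by (intro tendsto_intros assms(3))
qed

lemma continuous_on_ray_energy:
  assumes "a \<in> Lpow p" "k \<in> Lpow p"
  shows "continuous_on A (ray_energy p a k gk)"
  using ray_energy_tendsto[OF assms] unfolding continuous_on_sequentially by (auto simp: o_def)

text \<open>The threshold depends on the direction only through \<open>G\<close> and
  \<open>c\<^sub>0\<close>. This uniformity is what later confines the maximum points of all
  competitors to one interval.\<close>

lemma ray_energy_negative: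
  assumes a: "a \<in> Lpow p" "(\<integral>x. \<bar>a x\<bar> powr (p + 1) \<partial>lebesgue) \<le> 1" and c\<^sub>0: "c\<^sub>0 > 0"
  obtains T where "T > 0" "\<And>k gk t. k \<in> Lpow p \<Longrightarrow> (\<integral>x. (norm (gk x))\<^sup>2 \<partial>lebesgue) \<le> G \<Longrightarrow>
    c\<^sub>0 \<le> (\<integral>x. \<bar>k x\<bar> powr (p + 1) \<partial>lebesgue) \<Longrightarrow> t > T \<Longrightarrow> ray_energy p a k gk t < 0"
proof -
  obtain c C where cC: "c > 0" "C \<ge> 0" "\<And>x y. powr_rem p x y \<ge> c * \<bar>y\<bar> powr (p + 1) - C * \<bar>x\<bar> powr (p + 1)"
    using powr_rem_coercive[OF p] by blast
  \<comment> \<open>Beyond the threshold, \<open>c * c\<^sub>0 * t powr (p - 1)\<close> is at least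
    \<open>\<bar>G\<bar> + C + 1\<close>, so the integral of the remainder is at least
    \<open>t\<^sup>2 * \<bar>G\<bar> + 1\<close> and exceeds the quadratic term.\<close>
  define D where "D = (\<bar>G\<bar> + C + 1) / (c * c\<^sub>0)"
  have D: "D > 0" using cC c\<^sub>0 by (auto simp: D_def intro!: divide_pos_pos)
  define T where "T = max 1 (D powr (1 / (p - 1)))"
  have "ray_energy p a k gk t < 0"
    if k: "k \<in> Lpow p" "(\<integral>x. (norm (gk x))\<^sup>2 \<partial>lebesgue) \<le> G" "c\<^sub>0 \<le> (\<integral>x. \<bar>k x\<bar> powr (p + 1) \<partial>lebesgue)" and t: "t > T" for k gk t
  proof -
    have t1: "t \<ge> 1" "t \<ge> D powr (1 / (p - 1))" using t by (auto simp: T_def)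
    have "D = (D powr (1 / (p - 1))) powr (p - 1)" using p D by (simp add: powr_powr)
    also have "\<dots> \<le> t powr (p - 1)" using t1 p by (intro powr_mono2) auto
    finally have tD: "\<bar>G\<bar> + C + 1 \<le> c * c\<^sub>0 * t powr (p - 1)" using cC c\<^sub>0 by (simp add: D_def field_simps)
    have tk: "(\<lambda>x. t * k x) \<in> Lpow p" using k p by (intro Lpow_scale)
    have "c * (t powr (p + 1) * (\<integral>x. \<bar>k x\<bar> powr (p + 1) \<partial>lebesgue)) - C * (\<integral>x. \<bar>a x\<bar> powr (p + 1) \<partial>lebesgue)
      = (\<integral>x. c * \<bar>t * k x\<bar> powr (p + 1) - C * \<bar>a x\<bar> powr (p + 1) \<partial>lebesgue)"
      using Lpow_integrable[OF k(1)] Lpow_integrable[OF a(1)] t1 by (simp add: abs_mult powr_mult)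
    also have "\<dots> \<le> (\<integral>x. powr_rem p (a x) (t * k x) \<partial>lebesgue)"
      using cC Lpow_integrable[OF tk] Lpow_integrable[OF a(1)] integrable_powr_rem[OF a(1) tk p]
      by (intro integral_mono) auto
    finally have 1: "c * (t powr (p + 1) * (\<integral>x. \<bar>k x\<bar> powr (p + 1) \<partial>lebesgue)) - C * (\<integral>x. \<bar>a x\<bar> powr (p + 1) \<partial>lebesgue)
      \<le> (\<integral>x. powr_rem p (a x) (t * k x) \<partial>lebesgue)" .
    have tp: "t powr (p + 1) = t\<^sup>2 * t powr (p - 1)" using abs_powr_square[of t p] t1 by (simp add: mult.commute)
    have "C * (\<integral>x. \<bar>a x\<bar> powr (p + 1) \<partial>lebesgue) \<le> C * 1" using a cC by (intro mult_left_mono) auto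
    moreover have "c * (t powr (p + 1) * c\<^sub>0) \<le> c * (t powr (p + 1) * (\<integral>x. \<bar>k x\<bar> powr (p + 1) \<partial>lebesgue))"
      using cC k by (intro mult_left_mono) auto
    moreover have "t\<^sup>2 * (\<bar>G\<bar> + C + 1) \<le> t\<^sup>2 * (c * c\<^sub>0 * t powr (p - 1))" using tD by (intro mult_left_mono) auto
    moreover have "1 / 2 * t\<^sup>2 * (\<integral>x. (norm (gk x))\<^sup>2 \<partial>lebesgue) \<le> 1 / 2 * t\<^sup>2 * \<bar>G\<bar>"
      using k by (intro mult_left_mono) auto
    moreover have "C \<le> t\<^sup>2 * C" "1 \<le> t\<^sup>2" using t1 cC by (auto simp: mult_le_cancel_right1 one_le_power)
    ultimately have "t\<^sup>2 * \<bar>G\<bar> + 1 \<le> (\<integral>x. powr_rem p (a x) (t * k x) \<partial>lebesgue)"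
      "1 / 2 * t\<^sup>2 * (\<integral>x. (norm (gk x))\<^sup>2 \<partial>lebesgue) \<le> 1 / 2 * (t\<^sup>2 * \<bar>G\<bar>)"
      using 1 tp by (simp_all add: algebra_simps)
    moreover have "0 \<le> t\<^sup>2 * \<bar>G\<bar>" by simp
    ultimately show ?thesis unfolding ray_energy_def by linarith
  qed
  moreover have "T > 0" by (simp add: T_def)
  ultimately show thesis using that by blast
qed

lemma ray_energy_attains_max:
  assumes a: "a \<in> Lpow p" "(\<integral>x. \<bar>a x\<bar> powr (p + 1) \<partial>lebesgue) \<le> 1" and k: "k \<in> Lpow p"
    and pos: "(\<integral>x. \<bar>k x\<bar> powr (p + 1) \<partial>lebesgue) > 0"
  obtains t where "t \<ge> 0" "\<And>t'. t' \<ge> 0 \<Longrightarrow> ray_energy p a k gk t' \<le> ray_energy p a k gk t"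
proof -
  obtain T where T: "T > 0" "\<And>t. t > T \<Longrightarrow> ray_energy p a k gk t < 0"
    using ray_energy_negative[OF a pos, of "\<integral>x. (norm (gk x))\<^sup>2 \<partial>lebesgue"] k by (metis order_refl)
  obtain t where t: "t \<in> {0..T}" "\<And>t'. t' \<in> {0..T} \<Longrightarrow> ray_energy p a k gk t' \<le> ray_energy p a k gk t"
    using continuous_attains_sup[OF compact_Icc _ continuous_on_ray_energy[OF a(1) k], of 0 T gk] T by auto
  show thesis
  proof (rule that[of t])
    show "ray_energy p a k gk t' \<le> ray_energy p a k gk t" if "t' \<ge> 0" for t'
    proof (cases "t' \<le> T")
      case False
      then have "ray_energy p a k gk t' < 0" by (intro T) auto
      also have "0 \<le> ray_energy p a k gk t" using t(2)[of 0] T by simp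
      finally show ?thesis by simp
    qed (use t that in auto)
  qed (use t in auto)
qed

end

text \<open>A minimum below \<open>M\<close> cannot sit at an endpoint; if the minimum equals
  \<open>M\<close>, the function is constant and the midpoint serves.\<close>

lemma interior_min_between_max:
  fixes f :: "real \<Rightarrow> real"
  assumes lr: "l < r" and f: "continuous_on {l..r} f" and le: "\<And>t. t \<in> {l..r} \<Longrightarrow> f t \<le> M" and ends: "f l = M" "f r = M"
  obtains \<tau> where "l < \<tau>" "\<tau> < r" "\<And>t. t \<in> {l..r} \<Longrightarrow> f \<tau> \<le> f t"
proof -
  obtain \<tau> where \<tau>: "\<tau> \<in> {l..r}" "\<And>t. t \<in> {l..r} \<Longrightarrow> f \<tau> \<le> f t"
    using continuous_attains_inf[OF compact_Icc _ f] lr by auto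
  show thesis
  proof (cases "f \<tau> = M")
    case True
    let ?m = "(l + r) / 2"
    have "f ?m \<le> f t" if "t \<in> {l..r}" for t
      using le[of ?m] \<tau>(2)[OF that] True lr by (auto simp: field_simps)
    then show thesis using lr by (intro that[of ?m]) auto
  next
    case False
    then have "\<tau> \<noteq> l" "\<tau> \<noteq> r" using ends by auto
    then show thesis using \<tau> by (intro that[of \<tau>]) auto
  qed
qed

section \<open>Uniqueness of the maximum on a ray\<close>

context sobolev_domain
begin

lemma integrable_powr_square:
  assumes "u \<in> Lpow p" "v \<in> Lpow p"
  shows "integrable lebesgue (\<lambda>x. \<bar>u x\<bar> powr (p - 1) * (v x)\<^sup>2)"
proof (rule Bochner_Integration.integrable_bound)
  show "integrable lebesgue (\<lambda>x. \<bar>u x\<bar> powr (p + 1) + \<bar>v x\<bar> powr (p + 1))" using assms by (auto simp: Lpow_def)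
  show "AE x in lebesgue. norm (\<bar>u x\<bar> powr (p - 1) * (v x)\<^sup>2) \<le> norm (\<bar>u x\<bar> powr (p + 1) + \<bar>v x\<bar> powr (p + 1))"
  proof (intro AE_I2)
    fix x
    have "\<bar>u x\<bar> powr (p - 1) * (v x)\<^sup>2 = \<bar>u x\<bar> powr (p - 1) * \<bar>v x\<bar> powr 2" by (cases "v x = 0") auto
    also have "\<dots> \<le> \<bar>u x\<bar> powr (p - 1 + 2) + \<bar>v x\<bar> powr (p - 1 + 2)" using p by (intro powr_mult_le_sum) auto
    finally show "norm (\<bar>u x\<bar> powr (p - 1) * (v x)\<^sup>2) \<le> norm (\<bar>u x\<bar> powr (p + 1) + \<bar>v x\<bar> powr (p + 1))"
      by (simp add: add.commute)
  qed
  have [measurable]: "u \<in> borel_measurable lebesgue" "v \<in> borel_measurable lebesgue" using assms by (auto simp: Lpow_def)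
  show "(\<lambda>x. \<bar>u x\<bar> powr (p - 1) * (v x)\<^sup>2) \<in> borel_measurable lebesgue" by measurable
qed

text \<open>Hoelder's inequality with exponents \<open>(p + 1) / (p - 1)\<close> and
  \<open>(p + 1) / 2\<close>, up to the factor \<open>2\<close>: dividing \<open>v\<close> by its
  norm \<open>\<mu>\<close> reduces it to the pointwise bound
  \<open>powr_mult_le_sum\<close>.\<close>

lemma integral_powr_square_le:
  assumes "u \<in> Lpow p" "v \<in> Lpow p" "(\<integral>x. \<bar>u x\<bar> powr (p + 1) \<partial>lebesgue) \<le> 1"
    and pos: "(\<integral>x. \<bar>v x\<bar> powr (p + 1) \<partial>lebesgue) > 0"
  shows "(\<integral>x. \<bar>u x\<bar> powr (p - 1) * (v x)\<^sup>2 \<partial>lebesgue) \<le> 2 * (\<integral>x. \<bar>v x\<bar> powr (p + 1) \<partial>lebesgue) powr (2 / (p + 1))"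
proof -
  define X where "X = (\<integral>x. \<bar>v x\<bar> powr (p + 1) \<partial>lebesgue)"
  define \<mu> where "\<mu> = X powr (1 / (p + 1))"
  have X: "X > 0" using pos by (simp add: X_def)
  have \<mu>: "\<mu> > 0" "\<mu> powr (p + 1) = X" "\<mu>\<^sup>2 = X powr (2 / (p + 1))"
    using X p by (auto simp: \<mu>_def powr_powr simp flip: powr_numeral)
  have "(\<integral>x. \<bar>u x\<bar> powr (p - 1) * (v x)\<^sup>2 \<partial>lebesgue)
    \<le> (\<integral>x. \<mu>\<^sup>2 * (\<bar>u x\<bar> powr (p + 1) + \<bar>v x\<bar> powr (p + 1) / X) \<partial>lebesgue)"
  proof (rule integral_mono[OF integrable_powr_square[OF assms(1,2)]])
    show "integrable lebesgue (\<lambda>x. \<mu>\<^sup>2 * (\<bar>u x\<bar> powr (p + 1) + \<bar>v x\<bar> powr (p + 1) / X))"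
      using assms by (auto simp: Lpow_def)
    fix x
    have "\<bar>u x\<bar> powr (p - 1) * (\<bar>v x\<bar> / \<mu>) powr 2 \<le> \<bar>u x\<bar> powr (p - 1 + 2) + (\<bar>v x\<bar> / \<mu>) powr (p - 1 + 2)"
      using p \<mu> by (intro powr_mult_le_sum) auto
    also have "(\<bar>v x\<bar> / \<mu>) powr (p - 1 + 2) = \<bar>v x\<bar> powr (p + 1) / X"
      using \<mu> by (simp add: powr_divide add.commute)
    also have "(\<bar>v x\<bar> / \<mu>) powr 2 = (v x)\<^sup>2 / \<mu>\<^sup>2"
      using \<mu> by (cases "v x = 0") (auto simp: power_divide)
    finally have "\<mu>\<^sup>2 * (\<bar>u x\<bar> powr (p - 1) * ((v x)\<^sup>2 / \<mu>\<^sup>2)) \<le> \<mu>\<^sup>2 * (\<bar>u x\<bar> powr (p - 1 + 2) + \<bar>v x\<bar> powr (p + 1) / X)"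
      by (intro mult_left_mono) auto
    then show "\<bar>u x\<bar> powr (p - 1) * (v x)\<^sup>2 \<le> \<mu>\<^sup>2 * (\<bar>u x\<bar> powr (p + 1) + \<bar>v x\<bar> powr (p + 1) / X)"
      using \<mu>(1) by (simp add: add.commute)
  qed
  also have "\<dots> = \<mu>\<^sup>2 * ((\<integral>x. \<bar>u x\<bar> powr (p + 1) \<partial>lebesgue) + X / X)"
    using assms by (simp add: Lpow_def X_def)
  also have "\<dots> \<le> \<mu>\<^sup>2 * (1 + 1)" using assms X by (intro mult_left_mono) auto
  finally show ?thesis by (simp add: \<mu> X_def)
qed

lemma Lpow_integral_pos:
  assumes "u \<in> Lpow p" "\<not> (AE x in lebesgue. u x = 0)"
  shows "(\<integral>x. \<bar>u x\<bar> powr (p + 1) \<partial>lebesgue) > 0"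
proof -
  have "(\<integral>x. \<bar>u x\<bar> powr (p + 1) \<partial>lebesgue) \<noteq> 0"
  proof
    assume "(\<integral>x. \<bar>u x\<bar> powr (p + 1) \<partial>lebesgue) = 0"
    then have "AE x in lebesgue. \<bar>u x\<bar> powr (p + 1) = 0"
      using assms by (subst (asm) integral_nonneg_eq_0_iff_AE) (auto simp: Lpow_def)
    then show False using assms by simp
  qed
  then show ?thesis using integral_nonneg_AE[of "\<lambda>x. \<bar>u x\<bar> powr (p + 1)" lebesgue] by (simp add: order_less_le)
qed

text \<open>The convexity remainder based at \<open>a\<close> splits into the one at
  \<open>a + \<tau> k\<close> plus a term linear in \<open>\<epsilon>\<close>. Thus first and second
  derivative at an arbitrary \<open>\<tau>\<close> become visible.\<close>

lemma ray_energy_increment: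
  assumes "a \<in> Lpow p" "k \<in> Lpow p"
  shows "ray_energy p a k gk (\<tau> + \<epsilon>) - ray_energy p a k gk \<tau>
    = \<epsilon> * (\<tau> * (\<integral>x. (norm (gk x))\<^sup>2 \<partial>lebesgue) - (\<integral>x. (opow p (a x + \<tau> * k x) - opow p (a x)) * k x \<partial>lebesgue))
      + 1 / 2 * \<epsilon>\<^sup>2 * (\<integral>x. (norm (gk x))\<^sup>2 \<partial>lebesgue) - (\<integral>x. powr_rem p (a x + \<tau> * k x) (\<epsilon> * k x) \<partial>lebesgue)"
proof -
  have P: "(\<lambda>x. a x + \<tau> * k x) \<in> Lpow p" "(\<lambda>x. t * k x) \<in> Lpow p" for t
    using Lpow_lincomb[OF assms p, of 1 \<tau>] Lpow_scale[OF assms(2) p] by auto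
  have "powr_rem p (a x) ((\<tau> + \<epsilon>) * k x) = powr_rem p (a x) (\<tau> * k x)
      + (\<epsilon> * (opow p (a x + \<tau> * k x) * k x - opow p (a x) * k x) + powr_rem p (a x + \<tau> * k x) (\<epsilon> * k x))" for x
    by (simp add: powr_rem_def algebra_simps diff_divide_distrib)
  then have "(\<integral>x. powr_rem p (a x) ((\<tau> + \<epsilon>) * k x) \<partial>lebesgue) = (\<integral>x. powr_rem p (a x) (\<tau> * k x)
      + (\<epsilon> * (opow p (a x + \<tau> * k x) * k x - opow p (a x) * k x) + powr_rem p (a x + \<tau> * k x) (\<epsilon> * k x)) \<partial>lebesgue)"
    by presburger
  also have "\<dots> = (\<integral>x. powr_rem p (a x) (\<tau> * k x) \<partial>lebesgue)
      + (\<epsilon> * (\<integral>x. opow p (a x + \<tau> * k x) * k x - opow p (a x) * k x \<partial>lebesgue) + (\<integral>x. powr_rem p (a x + \<tau> * k x) (\<epsilon> * k x) \<partial>lebesgue))"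
    using integrable_powr_rem[OF assms(1) P(2) p, of \<tau>] integrable_opow_mult[OF P(1) assms(2) p] integrable_opow_mult[OF assms p]
      integrable_powr_rem[OF P(1,2) p, of \<epsilon>] by simp
  finally show ?thesis unfolding ray_energy_def by (simp add: algebra_simps power2_eq_square)
qed

text \<open>Two maximum points of the energy on a ray enclose an interior minimum point, where the derivative vanishes
  and the second derivative is nonnegative. On a domain with a small Sobolev constant this forces the
  direction of the ray to vanish.\<close>
lemma ray_energy_unique_max:
  assumes a: "a \<in> Lpow p" "(\<integral>x. \<bar>a x\<bar> powr (p + 1) \<partial>lebesgue) \<le> 1" and k: "sobolev0 U k gk"
    and nz: "\<not> (AE x in lebesgue. k x = 0)"
    and cC: "c > 0" "C \<ge> 0" "\<And>x y. p * \<bar>x + y\<bar> powr (p - 1) * y\<^sup>2 - (opow p (x + y) - opow p x) * y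
      \<ge> c * \<bar>y\<bar> powr (p + 1) - C * (\<bar>x\<bar> powr (p - 1) * y\<^sup>2)"
    and small: "2 * (p * 2 powr (p - 1)) * (1 + C / c) * S < 1"
    and max: "\<And>t. t \<ge> 0 \<Longrightarrow> ray_energy p a k gk t \<le> ray_energy p a k gk 1"
    and t\<^sub>0: "t\<^sub>0 \<ge> 0" "ray_energy p a k gk 1 \<le> ray_energy p a k gk t\<^sub>0"
  shows "t\<^sub>0 = 1"
proof (rule ccontr)
  assume "t\<^sub>0 \<noteq> 1"
  let ?f = "ray_energy p a k gk"
  have kP: "k \<in> Lpow p" using sobolev_Lpow[OF k] .
  define A where "A = (\<integral>x. (norm (gk x))\<^sup>2 \<partial>lebesgue)"
  have A0: "A \<ge> 0" by (simp add: A_def)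
  have eq: "?f t\<^sub>0 = ?f 1" using max[OF t\<^sub>0(1)] t\<^sub>0(2) by simp
  obtain \<tau> where \<tau>: "min t\<^sub>0 1 < \<tau>" "\<tau> < max t\<^sub>0 1" "\<And>t. t \<in> {min t\<^sub>0 1..max t\<^sub>0 1} \<Longrightarrow> ?f \<tau> \<le> ?f t"
  proof (rule interior_min_between_max[of "min t\<^sub>0 1" "max t\<^sub>0 1" ?f "?f 1"])
    show "min t\<^sub>0 1 < max t\<^sub>0 1" using \<open>t\<^sub>0 \<noteq> 1\<close> by auto
    show "continuous_on {min t\<^sub>0 1..max t\<^sub>0 1} ?f" by (rule continuous_on_ray_energy[OF a(1) kP])
    show "?f t \<le> ?f 1" if "t \<in> {min t\<^sub>0 1..max t\<^sub>0 1}" for t using that t\<^sub>0(1) by (intro max) auto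
    show "?f (min t\<^sub>0 1) = ?f 1" "?f (max t\<^sub>0 1) = ?f 1" using eq by (auto simp: min_def max_def)
  qed blast
  have \<tau>0: "\<tau> > 0" using \<tau>(1) t\<^sub>0(1) by auto
  define \<epsilon>\<^sub>0 where "\<epsilon>\<^sub>0 = min 1 (min (\<tau> - min t\<^sub>0 1) (max t\<^sub>0 1 - \<tau>))"
  have \<epsilon>\<^sub>0: "\<epsilon>\<^sub>0 > 0" "\<epsilon>\<^sub>0 \<le> 1" using \<tau> by (auto simp: \<epsilon>\<^sub>0_def)
  have near: "?f \<tau> \<le> ?f (\<tau> + \<epsilon>)" if "\<bar>\<epsilon>\<bar> \<le> \<epsilon>\<^sub>0" for \<epsilon>
    using that by (intro \<tau>(3)) (auto simp: \<epsilon>\<^sub>0_def)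
  define P where "P = (\<integral>x. (opow p (a x + \<tau> * k x) - opow p (a x)) * k x \<partial>lebesgue)"
  let ?b = "\<lambda>x. a x + \<tau> * k x"
  have bP: "?b \<in> Lpow p" using Lpow_lincomb[OF a(1) kP p, of 1 \<tau>] by simp
  have inc: "0 \<le> \<epsilon> * (\<tau> * A - P) + 1 / 2 * \<epsilon>\<^sup>2 * A - (\<integral>x. powr_rem p (?b x) (\<epsilon> * k x) \<partial>lebesgue)" if "\<bar>\<epsilon>\<bar> \<le> \<epsilon>\<^sub>0" for \<epsilon>
    using near[OF that] ray_energy_increment[OF a(1) kP, of gk \<tau> \<epsilon>] unfolding A_def P_def by linarith
  define \<epsilon> where "\<epsilon> = (\<lambda>n. \<epsilon>\<^sub>0 / real (Suc n))"
  have \<epsilon>: "\<epsilon> \<longlonglongrightarrow> 0" "\<epsilon> n > 0" "\<epsilon> n \<le> \<epsilon>\<^sub>0" for n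
  proof -
    show "\<epsilon> \<longlonglongrightarrow> 0" unfolding \<epsilon>_def using tendsto_mult_right_zero[OF LIMSEQ_inverse_real_of_nat, of \<epsilon>\<^sub>0]
      by (simp add: divide_inverse)
    show "\<epsilon> n > 0" "\<epsilon> n \<le> \<epsilon>\<^sub>0" using \<epsilon>\<^sub>0 by (auto simp: \<epsilon>_def field_simps)
  qed
  \<comment> \<open>The increment is nonnegative for both signs of \<open>\<epsilon>\<close>.
    Discarding the nonnegative remainder, dividing by \<open>\<bar>\<epsilon>\<bar>\<close> and
    passing to the limit gives the first-order condition at \<open>\<tau>\<close>.\<close>
  have deriv: "\<tau> * A = P"
  proof -
    have 1: "0 \<le> s * (\<tau> * A - P)" if s: "\<bar>s\<bar> = 1" for s :: real
    proof -
      have "0 \<le> s * (\<tau> * A - P) + 1 / 2 * \<epsilon> n * A" for n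
      proof -
        have "s\<^sup>2 = 1" using s by (simp add: power2_eq_1_iff abs_if split: if_splits)
        have "\<bar>s * \<epsilon> n\<bar> \<le> \<epsilon>\<^sub>0" using \<epsilon>(2,3)[of n] s by (simp add: abs_mult)
        from inc[OF this] have "0 \<le> (s * \<epsilon> n) * (\<tau> * A - P) + 1 / 2 * (s * \<epsilon> n)\<^sup>2 * A"
          using powr_rem_nonneg[OF p] integral_nonneg_AE[of "\<lambda>x. powr_rem p (?b x) (s * \<epsilon> n * k x)" lebesgue] by fastforce
        also have "\<dots> = \<epsilon> n * (s * (\<tau> * A - P) + 1 / 2 * \<epsilon> n * A)"
          using \<open>s\<^sup>2 = 1\<close> by (simp add: algebra_simps power2_eq_square)
        finally show ?thesis using \<epsilon>(2)[of n] by (simp add: zero_le_mult_iff)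
      qed
      moreover have "(\<lambda>n. s * (\<tau> * A - P) + 1 / 2 * \<epsilon> n * A) \<longlonglongrightarrow> s * (\<tau> * A - P) + 1 / 2 * 0 * A"
        by (intro tendsto_intros \<epsilon>)
      ultimately have "0 \<le> s * (\<tau> * A - P) + 1 / 2 * 0 * A"
        by (intro tendsto_lowerbound[of _ _ sequentially]) auto
      then show ?thesis by simp
    qed
    from 1[of 1] 1[of "-1"] show ?thesis by simp
  qed
  \<comment> \<open>The linear term of the increment has vanished, so division by
    \<open>\<epsilon>\<^sup>2\<close> leads to the second-order condition; the Taylor form provides
    both the pointwise limit and the dominating function.\<close>
  have second: "(\<integral>x. p * \<bar>?b x\<bar> powr (p - 1) * (k x)\<^sup>2 / 2 \<partial>lebesgue) \<le> 1 / 2 * A"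
  proof -
    have lim: "(\<lambda>n. \<integral>x. powr_rem p (?b x) (\<epsilon> n * k x) / (\<epsilon> n)\<^sup>2 \<partial>lebesgue)
        \<longlonglongrightarrow> (\<integral>x. p * \<bar>?b x\<bar> powr (p - 1) * (k x)\<^sup>2 / 2 \<partial>lebesgue)"
    proof (rule integral_dominated_convergence)
      have [measurable]: "k \<in> borel_measurable lebesgue" "a \<in> borel_measurable lebesgue"
        using kP a by (auto simp: Lpow_def)
      show "(\<lambda>x. p * \<bar>?b x\<bar> powr (p - 1) * (k x)\<^sup>2 / 2) \<in> borel_measurable lebesgue"
        "\<And>n. (\<lambda>x. powr_rem p (?b x) (\<epsilon> n * k x) / (\<epsilon> n)\<^sup>2) \<in> borel_measurable lebesgue" by measurable
      let ?m = "\<lambda>x. 1 * \<bar>?b x\<bar> + 1 * \<bar>k x\<bar>"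
      have "?m \<in> Lpow p" by (rule Lpow_abs_lincomb[OF bP kP p]) auto
      from integrable_powr_square[OF this kP]
      show "integrable lebesgue (\<lambda>x. p / 2 * (\<bar>?m x\<bar> powr (p - 1) * (k x)\<^sup>2))" by simp
      have T: "\<exists>\<theta>>0. \<theta> < \<epsilon> n \<and> powr_rem p (?b x) (\<epsilon> n * k x) / (\<epsilon> n)\<^sup>2 = p * \<bar>?b x + \<theta> * k x\<bar> powr (p - 1) * (k x)\<^sup>2 / 2" for n x
        by (rule powr_rem_Taylor[OF p \<epsilon>(2), of n "?b x" "k x"]) (use \<epsilon>(2)[of n] in auto)
      show "AE x in lebesgue. (\<lambda>n. powr_rem p (?b x) (\<epsilon> n * k x) / (\<epsilon> n)\<^sup>2) \<longlonglongrightarrow> p * \<bar>?b x\<bar> powr (p - 1) * (k x)\<^sup>2 / 2"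
      proof (intro AE_I2)
        fix x
        obtain \<theta> where \<theta>: "\<And>n. \<theta> n > 0" "\<And>n. \<theta> n < \<epsilon> n"
          "\<And>n. powr_rem p (?b x) (\<epsilon> n * k x) / (\<epsilon> n)\<^sup>2 = p * \<bar>?b x + \<theta> n * k x\<bar> powr (p - 1) * (k x)\<^sup>2 / 2"
          using T[of _ x] by metis
        have "\<theta> \<longlonglongrightarrow> 0"
          by (rule tendsto_sandwich[OF _ _ tendsto_const \<epsilon>(1)]) (use \<theta>(1,2) in \<open>auto intro!: always_eventually less_imp_le\<close>)
        then have "(\<lambda>n. p * \<bar>?b x + \<theta> n * k x\<bar> powr (p - 1) * (k x)\<^sup>2 / 2) \<longlonglongrightarrow> p * \<bar>?b x + 0 * k x\<bar> powr (p - 1) * (k x)\<^sup>2 / 2"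
          using p by (intro tendsto_intros tendsto_powr') auto
        then show "(\<lambda>n. powr_rem p (?b x) (\<epsilon> n * k x) / (\<epsilon> n)\<^sup>2) \<longlonglongrightarrow> p * \<bar>?b x\<bar> powr (p - 1) * (k x)\<^sup>2 / 2"
          unfolding \<theta>(3) by simp
      qed
      show "AE x in lebesgue. norm (powr_rem p (?b x) (\<epsilon> n * k x) / (\<epsilon> n)\<^sup>2) \<le> p / 2 * (\<bar>?m x\<bar> powr (p - 1) * (k x)\<^sup>2)" for n
      proof (intro AE_I2)
        fix x
        obtain \<theta> where \<theta>: "\<theta> > 0" "\<theta> < \<epsilon> n" "powr_rem p (?b x) (\<epsilon> n * k x) / (\<epsilon> n)\<^sup>2 = p * \<bar>?b x + \<theta> * k x\<bar> powr (p - 1) * (k x)\<^sup>2 / 2"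
          using T by blast
        have "\<theta> \<le> 1" using \<theta>(2) \<epsilon>(3)[of n] \<epsilon>\<^sub>0 by linarith
        then have "\<bar>\<theta> * k x\<bar> \<le> 1 * \<bar>k x\<bar>" unfolding abs_mult using \<theta>(1) by (intro mult_right_mono) auto
        then have "\<bar>?b x + \<theta> * k x\<bar> \<le> \<bar>?m x\<bar>"
          using abs_triangle_ineq[of "?b x" "\<theta> * k x"] by simp
        then have "\<bar>?b x + \<theta> * k x\<bar> powr (p - 1) * (k x)\<^sup>2 \<le> \<bar>?m x\<bar> powr (p - 1) * (k x)\<^sup>2"
          using p by (intro mult_right_mono powr_mono2) auto
        then show "norm (powr_rem p (?b x) (\<epsilon> n * k x) / (\<epsilon> n)\<^sup>2) \<le> p / 2 * (\<bar>?m x\<bar> powr (p - 1) * (k x)\<^sup>2)"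
          unfolding \<theta>(3) using p by (simp add: mult.assoc)
      qed
    qed
    show ?thesis
    proof (rule tendsto_upperbound[OF lim])
      show "\<forall>\<^sub>F n in sequentially. (\<integral>x. powr_rem p (?b x) (\<epsilon> n * k x) / (\<epsilon> n)\<^sup>2 \<partial>lebesgue) \<le> 1 / 2 * A"
      proof (intro always_eventually allI)
        fix n
        have "\<bar>\<epsilon> n\<bar> \<le> \<epsilon>\<^sub>0" using \<epsilon>(2,3)[of n] by simp
        from inc[OF this, unfolded deriv] have "(\<integral>x. powr_rem p (?b x) (\<epsilon> n * k x) \<partial>lebesgue) \<le> 1 / 2 * A * (\<epsilon> n)\<^sup>2"
          by (simp add: mult_ac)
        then show "(\<integral>x. powr_rem p (?b x) (\<epsilon> n * k x) / (\<epsilon> n)\<^sup>2 \<partial>lebesgue) \<le> 1 / 2 * A"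
          using \<epsilon>(2)[of n] by (simp add: pos_divide_le_eq mult_ac)
      qed
    qed simp
  qed
  \<comment> \<open>Rescaling the direction moves the minimum point to \<open>t = 1\<close>. The two
    conditions then compare integrals of \<open>a\<close> and \<open>H\<close> with the Dirichlet
    integral \<open>A'\<close> of \<open>H\<close>: \<open>R\<close> is the first-order one,
    \<open>L\<close> the second-order one.\<close>
  define H where "H = (\<lambda>x. \<tau> * k x)"
  define A' where "A' = \<tau>\<^sup>2 * A"
  define X where "X = (\<integral>x. \<bar>H x\<bar> powr (p + 1) \<partial>lebesgue)"
  define Q where "Q = (\<integral>x. \<bar>a x\<bar> powr (p - 1) * (H x)\<^sup>2 \<partial>lebesgue)"
  have H: "sobolev0 U H (\<lambda>x. \<tau> *\<^sub>R gk x)" using sobolev0_lincomb[OF k k, of \<tau> 0] by (simp add: H_def)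
  then have HP: "H \<in> Lpow p" by (rule sobolev_Lpow)
  have Hn: "\<not> (AE x in lebesgue. H x = 0)" using nz \<tau>0 by (simp add: H_def)
  have X0: "X > 0" unfolding X_def by (rule Lpow_integral_pos[OF HP Hn])
  have AH: "(\<integral>x. (norm (\<tau> *\<^sub>R gk x))\<^sup>2 \<partial>lebesgue) = A'" by (simp add: A'_def A_def power_mult_distrib)
  have XA: "X \<le> (S * A') powr ((p + 1) / 2)" using sobolev_le[OF H] unfolding X_def AH .
  have SA: "S * A' \<ge> 0" using S A0 by (simp add: A'_def)
  have "X powr (2 / (p + 1)) \<le> ((S * A') powr ((p + 1) / 2)) powr (2 / (p + 1))"
    using XA X0 p by (intro powr_mono2) auto
  also have "\<dots> = S * A'"
  proof -
    have "(p + 1) / 2 * (2 / (p + 1)) = 1" using p by (simp add: divide_simps)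
    then show ?thesis unfolding powr_powr using SA by (simp only: powr_one)
  qed
  finally have X2: "X powr (2 / (p + 1)) \<le> S * A'" .
  have Q: "Q \<le> 2 * (S * A')"
    using integral_powr_square_le[OF a(1) HP a(2)] X0 X2 unfolding Q_def X_def by linarith
  have iR: "integrable lebesgue (\<lambda>x. (opow p (a x + H x) - opow p (a x)) * H x)"
    using integrable_opow_mult[OF bP HP p] integrable_opow_mult[OF a(1) HP p] by (simp add: left_diff_distrib H_def)
  have iL: "integrable lebesgue (\<lambda>x. p * \<bar>a x + H x\<bar> powr (p - 1) * (H x)\<^sup>2)"
    using integrable_powr_square[OF bP HP] by (simp add: mult.assoc H_def)
  have iX: "integrable lebesgue (\<lambda>x. \<bar>H x\<bar> powr (p + 1))" using HP by (simp add: Lpow_def)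
  have iQ: "integrable lebesgue (\<lambda>x. \<bar>a x\<bar> powr (p - 1) * (H x)\<^sup>2)" by (rule integrable_powr_square[OF a(1) HP])
  have R: "(\<integral>x. (opow p (a x + H x) - opow p (a x)) * H x \<partial>lebesgue) = A'"
  proof -
    have "(\<integral>x. (opow p (a x + H x) - opow p (a x)) * H x \<partial>lebesgue) = \<tau> * P"
      unfolding P_def H_def by (subst integral_mult_right_zero[symmetric]) (simp add: mult_ac)
    then show ?thesis using deriv by (simp add: A'_def power2_eq_square)
  qed
  have "(\<integral>x. p * \<bar>a x + H x\<bar> powr (p - 1) * (H x)\<^sup>2 \<partial>lebesgue) = 2 * \<tau>\<^sup>2 * (\<integral>x. p * \<bar>?b x\<bar> powr (p - 1) * (k x)\<^sup>2 / 2 \<partial>lebesgue)"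
    unfolding H_def by (subst integral_mult_right_zero[symmetric]) (simp add: power_mult_distrib mult_ac)
  also have "\<dots> \<le> 2 * \<tau>\<^sup>2 * (1 / 2 * A)" using second by (intro mult_left_mono) auto
  finally have L: "(\<integral>x. p * \<bar>a x + H x\<bar> powr (p - 1) * (H x)\<^sup>2 \<partial>lebesgue) \<le> A'" by (simp add: A'_def)
  \<comment> \<open>Subtracting the first-order from the second-order condition leaves a nonpositive
    integral, which \<open>cC\<close> bounds from below. Hence the pure power of \<open>H\<close> is
    controlled by the mixed term \<open>Q\<close>.\<close>
  have "c * X - C * Q = (\<integral>x. c * \<bar>H x\<bar> powr (p + 1) - C * (\<bar>a x\<bar> powr (p - 1) * (H x)\<^sup>2) \<partial>lebesgue)"
    using iX iQ by (simp add: X_def Q_def)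
  also have "\<dots> \<le> (\<integral>x. p * \<bar>a x + H x\<bar> powr (p - 1) * (H x)\<^sup>2 - (opow p (a x + H x) - opow p (a x)) * H x \<partial>lebesgue)"
    using iX iQ iL iR cC(3) by (intro integral_mono) auto
  also have "\<dots> \<le> 0" using iL iR L R by simp
  finally have XQ: "X \<le> C / c * Q" using cC by (simp add: field_simps)
  \<comment> \<open>Now \<open>X \<le> C / c * Q\<close> and \<open>Q \<le> 2 * (S * A')\<close>
    turn the first-order condition into an upper bound for \<open>A'\<close> by itself times a
    factor that \<open>small\<close> makes less than \<open>1\<close>.\<close>
  have "A' \<le> (\<integral>x. p * 2 powr (p - 1) * (\<bar>a x\<bar> powr (p - 1) * (H x)\<^sup>2 + \<bar>H x\<bar> powr (p + 1)) \<partial>lebesgue)"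
    unfolding R[symmetric] using iX iQ iR opow_diff_le[OF p] by (intro integral_mono) auto
  also have "\<dots> = p * 2 powr (p - 1) * (Q + X)" using iX iQ by (simp add: X_def Q_def)
  also have "\<dots> \<le> p * 2 powr (p - 1) * (Q + C / c * Q)" using XQ p by (intro mult_left_mono) auto
  also have "\<dots> = p * 2 powr (p - 1) * (1 + C / c) * Q" by (simp add: algebra_simps)
  also have "\<dots> \<le> p * 2 powr (p - 1) * (1 + C / c) * (2 * (S * A'))"
    using Q p cC by (intro mult_left_mono) auto
  also have "\<dots> = (2 * (p * 2 powr (p - 1)) * (1 + C / c) * S) * A'" by (simp add: algebra_simps)
  finally have "A' \<le> (2 * (p * 2 powr (p - 1)) * (1 + C / c) * S) * A'" .
  moreover have "A' > 0"
  proof -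
    have "A' \<noteq> 0" using XA X0 p by auto
    then show ?thesis using A0 \<tau>0 by (simp add: A'_def order_less_le)
  qed
  ultimately show False using small mult_less_cancel_right2[of "2 * (p * 2 powr (p - 1)) * (1 + C / c) * S" A'] by auto
qed


text \<open>On the finite measure set \<open>U\<close> the lower power \<open>p\<close> is
  integrable as well. It is needed for \<open>\<rho>\<close> without a factor \<open>v\<close>,
  which arises from the truncation error.\<close>

lemma abs_powr_le_support:
  assumes "k x = 0 \<or> x \<in> U"
  shows "\<bar>k x\<bar> powr p \<le> indicator U x + \<bar>k x\<bar> powr (p + 1)"
proof (cases "x \<in> U")
  case True
  have "\<bar>k x\<bar> powr p \<le> 1 + \<bar>k x\<bar> powr (p + 1)"
  proof (cases "\<bar>k x\<bar> \<le> 1")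
    case le: True
    then have "\<bar>k x\<bar> powr p \<le> 1 powr p" using p by (intro powr_mono2) auto
    then show ?thesis by (simp add: add_increasing2)
  next
    case False
    then have "\<bar>k x\<bar> powr p \<le> \<bar>k x\<bar> powr (p + 1)" by (intro powr_mono) auto
    then show ?thesis by simp
  qed
  then show ?thesis using True by simp
qed (use assms in simp)

text \<open>The competitors are \<open>d + \<epsilon> s v\<close>, smoothly truncated so that they have sign \<open>s\<close>. The truncation does not
  increase the Dirichlet integral and costs only \<open>O(\<epsilon>\<^sup>2)\<close> in the remaining terms.\<close>
lemma minimax_variational_inequality:
  assumes a: "sobolev0 U a ga" "(\<integral>x. \<bar>a x\<bar> powr (p + 1) \<partial>lebesgue) \<le> 1"
    and d: "sobolev0 U d gd" "\<not> (AE x in lebesgue. d x = 0)" "AE x in lebesgue. s * d x \<ge> 0"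
    and s: "s = 1 \<or> s = - 1"
    and cC: "c > 0" "C \<ge> 0" "\<And>x y. p * \<bar>x + y\<bar> powr (p - 1) * y\<^sup>2 - (opow p (x + y) - opow p x) * y
      \<ge> c * \<bar>y\<bar> powr (p + 1) - C * (\<bar>x\<bar> powr (p - 1) * y\<^sup>2)"
    and small: "2 * (p * 2 powr (p - 1)) * (1 + C / c) * S < 1"
    and max: "\<forall>t\<ge>0. ray_energy p a d gd t \<le> ray_energy p a d gd 1"
    and min: "\<forall>k gk t. sobolev0 U k gk \<longrightarrow> \<not> (AE x in lebesgue. k x = 0) \<longrightarrow> (AE x in lebesgue. s * k x \<ge> 0) \<longrightarrow>
      t \<ge> 0 \<longrightarrow> (\<forall>t'\<ge>0. ray_energy p a k gk t' \<le> ray_energy p a k gk t) \<longrightarrow>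
      ray_energy p a d gd 1 \<le> ray_energy p a k gk t"
    and v: "sobolev0 U v gv"
  shows "(\<integral>x. s * (opow p (a x + d x) - opow p (a x)) * v x \<partial>lebesgue) \<le> s * (\<integral>x. gd x \<bullet> gv x \<partial>lebesgue)"
proof -
  have s2: "s * s = 1" "\<bar>s\<bar> = 1" using s by auto
  have aP: "a \<in> Lpow p" and dP: "d \<in> Lpow p" and vP: "v \<in> Lpow p" using a d v sobolev_Lpow by auto
  note [measurable] = Lpow_measurable[OF aP] Lpow_measurable[OF dP] Lpow_measurable[OF vP]
  have L: "gd \<in> L2 UNIV" "gv \<in> L2 UNIV" using d v by (auto simp: sobolev0_def)
  have z: "a x = 0" "d x = 0" "v x = 0" if "x \<notin> U" for x using that a d v by (auto simp: sobolev0_def)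
  define A I B where "A = (\<integral>x. (norm (gd x))\<^sup>2 \<partial>lebesgue)" and "I = (\<integral>x. gd x \<bullet> gv x \<partial>lebesgue)"
    and "B = (\<integral>x. (norm (gv x))\<^sup>2 \<partial>lebesgue)"
  have B0: "B \<ge> 0" by (simp add: B_def)
  define \<epsilon> where "\<epsilon> = (\<lambda>n. 1 / real (Suc n))"
  have \<epsilon>: "\<epsilon> \<longlonglongrightarrow> 0" "\<And>n. \<epsilon> n > 0" "\<And>n. \<epsilon> n \<le> 1"
    unfolding \<epsilon>_def using LIMSEQ_inverse_real_of_nat by (auto simp: inverse_eq_divide)
  define W where "W = (\<lambda>n x. s * d x + \<epsilon> n * v x)"
  define gW where "gW = (\<lambda>n x. s *\<^sub>R gd x + \<epsilon> n *\<^sub>R gv x)"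
  \<comment> \<open>With truncation parameter \<open>(\<epsilon> n)\<^sup>2\<close> the loss in
    \<open>klow\<close> is of second order, while the variation \<open>\<epsilon> n * v x\<close> is
    of first order.\<close>
  define k where "k = (\<lambda>n x. s * soft_pos ((\<epsilon> n)\<^sup>2) (W n x))"
  define gk where "gk = (\<lambda>n x. s *\<^sub>R (soft_pos' ((\<epsilon> n)\<^sup>2) (W n x) *\<^sub>R gW n x))"
  have \<epsilon>2: "(\<epsilon> n)\<^sup>2 > 0" for n using \<epsilon>(2)[of n] by simp
  have W: "sobolev0 U (W n) (gW n)" for n unfolding W_def gW_def by (rule sobolev0_lincomb[OF d(1) v])
  have k: "sobolev0 U (k n) (gk n)" for n
    using sobolev0_lincomb[OF sobolev0_soft_pos[OF \<epsilon>2[of n] W[of n]] sobolev0_soft_pos[OF \<epsilon>2[of n] W[of n]],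
        where a = s and b = 0]
    by (simp add: k_def gk_def)
  then have kP: "k n \<in> Lpow p" for n by (rule sobolev_Lpow)
  note km[measurable] = Lpow_measurable[OF kP]
  have ksgn: "s * k n x \<ge> 0" for n x
    using soft_pos_bounds(1)[OF \<epsilon>2] s2 by (simp add: k_def mult.assoc[symmetric])
  have sk: "s * k n x = soft_pos ((\<epsilon> n)\<^sup>2) (W n x)" for n x
    using s2 by (simp add: k_def mult.assoc[symmetric])
  have klow: "s * (k n x - d x) \<ge> \<epsilon> n * v x - (\<epsilon> n)\<^sup>2" for n x
    using soft_pos_bounds(2)[OF \<epsilon>2[of n], of "W n x"] sk[of n x] by (simp add: W_def algebra_simps)
  have kle: "\<bar>k n x\<bar> \<le> \<bar>d x\<bar> + \<bar>v x\<bar>" for n x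
  proof -
    have "\<bar>k n x\<bar> = soft_pos ((\<epsilon> n)\<^sup>2) (W n x)" using soft_pos_bounds(1)[OF \<epsilon>2] s2 by (simp add: k_def abs_mult)
    also have "\<dots> \<le> \<bar>W n x\<bar>" using soft_pos_bounds(3)[OF \<epsilon>2[of n], of "W n x"] by simp
    also have "\<dots> \<le> \<bar>s * d x\<bar> + \<bar>\<epsilon> n * v x\<bar>" unfolding W_def by (rule abs_triangle_ineq)
    also have "\<bar>\<epsilon> n * v x\<bar> \<le> 1 * \<bar>v x\<bar>" unfolding abs_mult using \<epsilon>(2,3)[of n] by (intro mult_right_mono) auto
    finally show ?thesis using s2 by (simp add: abs_mult)
  qed
  have klim: "AE x in lebesgue. (\<lambda>n. k n x) \<longlonglongrightarrow> d x"
    using d(3)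
  proof eventually_elim
    case (elim x)
    have Wl: "(\<lambda>n. W n x) \<longlonglongrightarrow> s * d x + 0 * v x" unfolding W_def by (intro tendsto_intros \<epsilon>)
    have lo: "(\<lambda>n. max (W n x) 0 - (\<epsilon> n)\<^sup>2) \<longlonglongrightarrow> max (s * d x + 0 * v x) 0 - 0\<^sup>2"
      by (intro tendsto_intros \<epsilon> Wl)
    have hi: "(\<lambda>n. max (W n x) 0) \<longlonglongrightarrow> max (s * d x + 0 * v x) 0 - 0\<^sup>2"
      using tendsto_max[OF Wl tendsto_const[of 0]] by simp
    have bd: "max (W n x) 0 - (\<epsilon> n)\<^sup>2 \<le> s * k n x" "s * k n x \<le> max (W n x) 0" for n
      using soft_pos_bounds[OF \<epsilon>2[of n], of "W n x"] \<epsilon>2[of n] unfolding sk by (auto simp: max_def)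
    have "(\<lambda>n. s * k n x) \<longlonglongrightarrow> max (s * d x + 0 * v x) 0 - 0\<^sup>2"
      by (rule tendsto_sandwich[OF _ _ lo hi]) (intro always_eventually allI bd)+
    then have "(\<lambda>n. s * k n x) \<longlonglongrightarrow> s * d x" using elim by simp
    from tendsto_mult_left[OF this, of s] show "(\<lambda>n. k n x) \<longlonglongrightarrow> d x" using s2 by (simp flip: mult.assoc)
  qed
  have gle: "(\<integral>x. (norm (gk n x))\<^sup>2 \<partial>lebesgue) \<le> A + 2 * (\<epsilon> n * s) * I + (\<epsilon> n)\<^sup>2 * B" for n
  proof -
    have "(\<integral>x. (norm (gk n x))\<^sup>2 \<partial>lebesgue) \<le> (\<integral>x. (norm (gW n x))\<^sup>2 \<partial>lebesgue)"
    proof (rule integral_mono)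
      show "integrable lebesgue (\<lambda>x. (norm (gk n x))\<^sup>2)" "integrable lebesgue (\<lambda>x. (norm (gW n x))\<^sup>2)"
        using k[of n] W[of n] by (auto simp: sobolev0_def L2_UNIV)
      show "(norm (gk n x))\<^sup>2 \<le> (norm (gW n x))\<^sup>2" for x
        using soft_pos'_bounds[OF \<epsilon>2[of n], of "W n x"] s2 by (auto simp: gk_def abs_mult intro!: power_mono mult_left_le_one_le)
    qed
    also have "\<dots> = A + 2 * (\<epsilon> n * s) * I + (\<epsilon> n)\<^sup>2 * B"
      using integral_lincomb_L2[of gd lebesgue gv s "\<epsilon> n"] L s2 unfolding gW_def A_def B_def I_def
      by (simp add: L2_UNIV power2_eq_square mult_ac)
    finally show ?thesis .
  qed
  define G where "G = A + 2 * \<bar>I\<bar> + B"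
  have gG: "(\<integral>x. (norm (gk n x))\<^sup>2 \<partial>lebesgue) \<le> G" for n
  proof -
    have "\<epsilon> n * s * I \<le> \<bar>\<epsilon> n * s * I\<bar>" by simp
    also have "\<dots> = \<epsilon> n * \<bar>I\<bar>" using \<epsilon>(2)[of n] s2 by (simp add: abs_mult)
    also have "\<dots> \<le> 1 * \<bar>I\<bar>" using \<epsilon>(3)[of n] by (intro mult_right_mono) auto
    finally have "2 * (\<epsilon> n * s) * I \<le> 2 * \<bar>I\<bar>" by simp
    moreover have "(\<epsilon> n)\<^sup>2 * B \<le> 1 * B" using \<epsilon>(2,3)[of n] B0 by (intro mult_right_mono power_le_one) auto
    ultimately show ?thesis using gle[of n] by (simp add: G_def)
  qed
  \<comment> \<open>Half of the mass of \<open>d\<close> remains a lower bound for the mass of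
    \<open>k n\<close> when \<open>n\<close> is large, so that a single \<open>T\<close> works for
    all these competitors.\<close>
  define c\<^sub>0 where "c\<^sub>0 = (\<integral>x. \<bar>d x\<bar> powr (p + 1) \<partial>lebesgue) / 2"
  have c\<^sub>0: "c\<^sub>0 > 0" using Lpow_integral_pos[OF dP d(2)] by (simp add: c\<^sub>0_def)
  have m: "(\<lambda>x. 1 * \<bar>d x\<bar> + 1 * \<bar>v x\<bar>) \<in> Lpow p" by (rule Lpow_abs_lincomb[OF dP vP p]) auto
  have "(\<lambda>n. \<integral>x. \<bar>k n x\<bar> powr (p + 1) \<partial>lebesgue) \<longlonglongrightarrow> (\<integral>x. \<bar>d x\<bar> powr (p + 1) \<partial>lebesgue)"
    using kle by (intro tendsto_integral_abs_powr[OF m p] klim) auto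
  then have "\<forall>\<^sub>F n in sequentially. (\<integral>x. \<bar>k n x\<bar> powr (p + 1) \<partial>lebesgue) > c\<^sub>0"
    by (rule order_tendstoD) (use c\<^sub>0 in \<open>simp add: c\<^sub>0_def\<close>)
  then obtain N where N: "\<And>n. n \<ge> N \<Longrightarrow> (\<integral>x. \<bar>k n x\<bar> powr (p + 1) \<partial>lebesgue) > c\<^sub>0"
    by (auto simp: eventually_sequentially)
  obtain T where T: "T > 0" "\<And>k gk t. k \<in> Lpow p \<Longrightarrow> (\<integral>x. (norm (gk x))\<^sup>2 \<partial>lebesgue) \<le> G \<Longrightarrow>
    c\<^sub>0 \<le> (\<integral>x. \<bar>k x\<bar> powr (p + 1) \<partial>lebesgue) \<Longrightarrow> t > T \<Longrightarrow> ray_energy p a k gk t < 0"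
    using ray_energy_negative[OF aP a(2) c\<^sub>0] by blast
  have "\<exists>t. 0 \<le> t \<and> t \<le> T \<and> ray_energy p a d gd 1 \<le> ray_energy p a (k n) (gk n) t" if n: "n \<ge> N" for n
  proof -
    have pos: "(\<integral>x. \<bar>k n x\<bar> powr (p + 1) \<partial>lebesgue) > 0" using N[OF n] c\<^sub>0 by linarith
    obtain t where t: "t \<ge> 0" "\<And>t'. t' \<ge> 0 \<Longrightarrow> ray_energy p a (k n) (gk n) t' \<le> ray_energy p a (k n) (gk n) t"
      using ray_energy_attains_max[OF aP a(2) kP pos] by blast
    have "\<not> (AE x in lebesgue. k n x = 0)"
    proof
      assume "AE x in lebesgue. k n x = 0"
      then have "(\<integral>x. \<bar>k n x\<bar> powr (p + 1) \<partial>lebesgue) = (\<integral>x. 0 \<partial>(lebesgue :: (real^'n) measure))"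
        by (intro integral_cong_AE) auto
      then show False using pos by simp
    qed
    then have le: "ray_energy p a d gd 1 \<le> ray_energy p a (k n) (gk n) t"
      using min k[of n] ksgn t by auto
    have "t \<le> T"
    proof (rule ccontr)
      assume "\<not> t \<le> T"
      then have "ray_energy p a (k n) (gk n) t < 0" using N[OF n] by (intro T(2) kP gG) auto
      then show False using t(2)[of 0] by simp
    qed
    with t le show ?thesis by blast
  qed
  then obtain t where t: "\<And>n. n \<ge> N \<Longrightarrow> 0 \<le> t n" "\<And>n. n \<ge> N \<Longrightarrow> t n \<le> T"
    "\<And>n. n \<ge> N \<Longrightarrow> ray_energy p a d gd 1 \<le> ray_energy p a (k n) (gk n) (t n)" by metis
  have "\<forall>n. t (n + N) \<in> {0..T}" using t by auto
  \<comment> \<open>The numbers \<open>t n\<close> were chosen as maximum points on the rays of the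
    competitors. Only their boundedness is known, so the argument continues along a convergent
    subsequence.\<close>
  then obtain l and r :: "nat \<Rightarrow> nat" where l: "l \<in> {0..T}" and r: "strict_mono r" and tl: "((\<lambda>n. t (n + N)) \<circ> r) \<longlonglongrightarrow> l"
    using seq_compactE[OF compact_imp_seq_compact[OF compact_Icc[of 0 T]], of "\<lambda>n. t (n + N)"] by metis
  define j where "j = (\<lambda>n. r n + N)"
  have j: "j n \<ge> N" for n by (simp add: j_def)
  have jm: "strict_mono j" using r by (auto simp: j_def strict_mono_def)
  have tl: "(\<lambda>n. t (j n)) \<longlonglongrightarrow> l" using tl by (simp add: j_def o_def)
  have \<epsilon>j: "(\<lambda>n. \<epsilon> (j n)) \<longlonglongrightarrow> 0" using LIMSEQ_subseq_LIMSEQ[OF \<epsilon>(1) jm] by (simp add: o_def)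
  have kj: "AE x in lebesgue. (\<lambda>n. k (j n) x) \<longlonglongrightarrow> d x"
    using klim by eventually_elim (use LIMSEQ_subseq_LIMSEQ[OF _ jm] in \<open>auto simp: o_def\<close>)
  have tabs: "\<bar>t (j n)\<bar> \<le> T" for n using t(1,2)[OF j[of n]] by simp
  \<comment> \<open>For the Dirichlet integrals the upper bound \<open>gle\<close> is enough;
    convergence of the gradients \<open>gk n\<close> does not have to be shown. In the limit the ray
    of \<open>d\<close> is at least as high at \<open>l\<close> as at \<open>1\<close>, and
    uniqueness applies.\<close>
  have l1: "l = 1"
  proof (rule ray_energy_unique_max[OF aP a(2) d(1,2) cC small])
    show "l \<ge> 0" using l by simp
    show "ray_energy p a d gd t \<le> ray_energy p a d gd 1" if "t \<ge> 0" for t using max that by simp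
    have "(\<lambda>n. 1 / 2 * (t (j n))\<^sup>2 * (A + 2 * (\<epsilon> (j n) * s) * I + (\<epsilon> (j n))\<^sup>2 * B) - (\<integral>x. powr_rem p (a x) (t (j n) * k (j n) x) \<partial>lebesgue))
      \<longlonglongrightarrow> 1 / 2 * l\<^sup>2 * (A + 2 * (0 * s) * I + 0\<^sup>2 * B) - (\<integral>x. powr_rem p (a x) (l * d x) \<partial>lebesgue)"
    proof (intro tendsto_intros tl \<epsilon>j tendsto_integral_powr_rem[OF aP _ p])
      show "(\<lambda>x. T * \<bar>d x\<bar> + T * \<bar>v x\<bar>) \<in> Lpow p" using T by (intro Lpow_abs_lincomb dP vP p) auto
      show "AE x in lebesgue. (\<lambda>n. t (j n) * k (j n) x) \<longlonglongrightarrow> l * d x"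
        using kj by eventually_elim (intro tendsto_intros tl)
      show "AE x in lebesgue. \<bar>t (j n) * k (j n) x\<bar> \<le> T * \<bar>d x\<bar> + T * \<bar>v x\<bar>" for n
      proof (intro AE_I2)
        fix x
        have "\<bar>t (j n) * k (j n) x\<bar> \<le> T * (\<bar>d x\<bar> + \<bar>v x\<bar>)"
          unfolding abs_mult using tabs[of n] kle[of "j n" x] by (intro mult_mono) auto
        then show "\<bar>t (j n) * k (j n) x\<bar> \<le> T * \<bar>d x\<bar> + T * \<bar>v x\<bar>" by (simp add: algebra_simps)
      qed
    qed measurable
    moreover have "ray_energy p a d gd 1 \<le> 1 / 2 * (t (j n))\<^sup>2 * (A + 2 * (\<epsilon> (j n) * s) * I + (\<epsilon> (j n))\<^sup>2 * B) - (\<integral>x. powr_rem p (a x) (t (j n) * k (j n) x) \<partial>lebesgue)" for n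
    proof -
      have "1 / 2 * (t (j n))\<^sup>2 * (\<integral>x. (norm (gk (j n) x))\<^sup>2 \<partial>lebesgue) \<le> 1 / 2 * (t (j n))\<^sup>2 * (A + 2 * (\<epsilon> (j n) * s) * I + (\<epsilon> (j n))\<^sup>2 * B)"
        using gle[of "j n"] by (intro mult_left_mono) auto
      then show ?thesis using t(3)[OF j[of n]] unfolding ray_energy_def[of p a "k (j n)"] by linarith
    qed
    ultimately have "ray_energy p a d gd 1 \<le> 1 / 2 * l\<^sup>2 * (A + 2 * (0 * s) * I + 0\<^sup>2 * B) - (\<integral>x. powr_rem p (a x) (l * d x) \<partial>lebesgue)"
      by (intro tendsto_lowerbound[of _ _ sequentially]) auto
    then show "ray_energy p a d gd 1 \<le> ray_energy p a d gd l" by (simp add: ray_energy_def[of p a d gd l] A_def)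
  qed
  define \<rho> where "\<rho> = (\<lambda>n x. s * (opow p (a x + t (j n) * d x) - opow p (a x)))"
  have \<rho>m[measurable]: "\<rho> n \<in> borel_measurable lebesgue" for n unfolding \<rho>_def by measurable
  let ?m = "\<lambda>x. 1 * \<bar>a x\<bar> + T * \<bar>d x\<bar>"
  have mP: "?m \<in> Lpow p" using T by (intro Lpow_abs_lincomb aP dP p) auto
  have bP: "(\<lambda>x. a x + \<tau> * d x) \<in> Lpow p" for \<tau> using Lpow_lincomb[OF aP dP p, of 1 \<tau>] by simp
  have \<rho>le: "\<bar>\<rho> n x\<bar> \<le> 2 * \<bar>?m x\<bar> powr p" for n x
  proof -
    have "\<bar>t (j n) * d x\<bar> \<le> T * \<bar>d x\<bar>" unfolding abs_mult using tabs[of n] by (intro mult_right_mono) auto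
    then have 1: "\<bar>a x + t (j n) * d x\<bar> \<le> \<bar>?m x\<bar>" using abs_triangle_ineq[of "a x" "t (j n) * d x"] by linarith
    have 2: "\<bar>a x\<bar> \<le> \<bar>?m x\<bar>" using T by simp
    have "\<bar>\<rho> n x\<bar> \<le> \<bar>opow p (a x + t (j n) * d x)\<bar> + \<bar>opow p (a x)\<bar>"
      unfolding \<rho>_def abs_mult s2(2) using abs_triangle_ineq4 by simp
    also have "\<dots> \<le> \<bar>?m x\<bar> powr p + \<bar>?m x\<bar> powr p"
      unfolding abs_opow using 1 2 p by (intro add_mono powr_mono2) auto
    finally show ?thesis by simp
  qed
  have \<rho>lim: "(\<lambda>n. \<rho> n x) \<longlonglongrightarrow> s * (opow p (a x + l * d x) - opow p (a x))" for x
    unfolding \<rho>_def by (intro tendsto_intros isCont_tendsto_compose[OF isCont_opow[OF p]] tl)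
  have D1: "integrable lebesgue (\<lambda>x. 2 * (\<bar>?m x\<bar> powr p * \<bar>v x\<bar>))"
    using integrable_abs[OF integrable_opow_mult[OF mP vP p]] by (simp add: abs_mult abs_opow)
  have D2: "integrable lebesgue (\<lambda>x. 2 * (indicator U x + \<bar>?m x\<bar> powr (p + 1)))"
    using Lpow_integrable[OF mP] finite_measure by (auto simp: fmeasurable_def)
  have \<rho>le2: "\<bar>\<rho> n x\<bar> \<le> 2 * (indicator U x + \<bar>?m x\<bar> powr (p + 1))" for n x
    using \<rho>le[of n x] abs_powr_le_support[of ?m x] z[of x] by fastforce
  have i1: "integrable lebesgue (\<lambda>x. \<rho> n x * v x)" and i2: "integrable lebesgue (\<rho> n)" for n
  proof -
    show "integrable lebesgue (\<lambda>x. \<rho> n x * v x)"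
    proof (rule Bochner_Integration.integrable_bound[OF D1])
      show "AE x in lebesgue. norm (\<rho> n x * v x) \<le> norm (2 * (\<bar>?m x\<bar> powr p * \<bar>v x\<bar>))"
      proof (intro AE_I2)
        fix x
        have "\<bar>\<rho> n x\<bar> * \<bar>v x\<bar> \<le> (2 * \<bar>?m x\<bar> powr p) * \<bar>v x\<bar>" using \<rho>le by (intro mult_right_mono) auto
        then show "norm (\<rho> n x * v x) \<le> norm (2 * (\<bar>?m x\<bar> powr p * \<bar>v x\<bar>))" by (simp add: abs_mult mult.assoc)
      qed
    qed measurable
    show "integrable lebesgue (\<rho> n)"
      by (rule Bochner_Integration.integrable_bound[OF D2]) (use \<rho>le2 in \<open>auto intro!: AE_I2 order_trans[OF _ abs_ge_self]\<close>)
  qed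
  \<comment> \<open>The ray of \<open>d\<close> at \<open>t (j n)\<close> lies below its maximum,
    hence below the competitor at the same parameter. So the gain in the Dirichlet integral
    dominates the change of the remainder, which convexity bounds from below; finally
    \<open>t (j n) * \<epsilon> (j n)\<close> is divided out.\<close>
  have key: "(\<integral>x. \<rho> n x * v x \<partial>lebesgue) - \<epsilon> (j n) * (\<integral>x. \<rho> n x \<partial>lebesgue)
      \<le> t (j n) * s * I + 1 / 2 * t (j n) * \<epsilon> (j n) * B" if tp: "t (j n) > 0" for n
  proof -
    define \<tau> e where "\<tau> = t (j n)" and "e = \<epsilon> (j n)"
    have \<tau>: "\<tau> > 0" and e: "e > 0" using tp \<epsilon>(2) by (auto simp: \<tau>_def e_def)
    have iP: "integrable lebesgue (\<lambda>x. powr_rem p (a x) (\<tau> * k (j n) x))" "integrable lebesgue (\<lambda>x. powr_rem p (a x) (\<tau> * d x))"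
      by (intro integrable_powr_rem aP Lpow_scale kP dP p)+
    have "(\<integral>x. \<tau> * e * (\<rho> n x * v x - e * \<rho> n x) \<partial>lebesgue)
        \<le> (\<integral>x. powr_rem p (a x) (\<tau> * k (j n) x) - powr_rem p (a x) (\<tau> * d x) \<partial>lebesgue)"
    proof (rule integral_mono_AE)
      show "integrable lebesgue (\<lambda>x. \<tau> * e * (\<rho> n x * v x - e * \<rho> n x))" using i1[of n] i2[of n] by simp
      show "integrable lebesgue (\<lambda>x. powr_rem p (a x) (\<tau> * k (j n) x) - powr_rem p (a x) (\<tau> * d x))" using iP by simp
      show "AE x in lebesgue. \<tau> * e * (\<rho> n x * v x - e * \<rho> n x) \<le> powr_rem p (a x) (\<tau> * k (j n) x) - powr_rem p (a x) (\<tau> * d x)"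
        using d(3)
      proof eventually_elim
        case (elim x)
        have \<rho>0: "\<rho> n x \<ge> 0"
        proof (cases "s = 1")
          case True
          then show ?thesis using elim \<tau> opow_mono[OF p, of "a x" "a x + \<tau> * d x"] by (simp add: \<rho>_def \<tau>_def)
        next
          case False
          then have "s = - 1" using s by simp
          moreover have "\<tau> * d x \<le> 0" using elim \<tau> \<open>s = - 1\<close> by (simp add: mult_nonneg_nonpos)
          ultimately show ?thesis using opow_mono[OF p, of "a x + \<tau> * d x" "a x"] by (simp add: \<rho>_def \<tau>_def)
        qed
        have "\<tau> * e * (\<rho> n x * v x - e * \<rho> n x) = \<tau> * (\<rho> n x * (e * v x - e\<^sup>2))"
          by (simp add: algebra_simps power2_eq_square)
        \<comment> \<open>Nonnegativity of \<open>\<rho> n x\<close> makes the one-sided bound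
          \<open>klow\<close> sufficient: wherever truncation lifts the competitor, it helps the
          inequality.\<close>
        also have "\<dots> \<le> \<tau> * (\<rho> n x * (s * (k (j n) x - d x)))"
          using \<tau> \<rho>0 klow[of "j n" x] by (intro mult_left_mono) (auto simp: e_def)
        also have "\<dots> = (s * s) * ((opow p (a x + \<tau> * d x) - opow p (a x)) * (\<tau> * k (j n) x - \<tau> * d x))"
          by (simp add: \<rho>_def \<tau>_def algebra_simps)
        also have "\<dots> \<le> powr_rem p (a x) (\<tau> * k (j n) x) - powr_rem p (a x) (\<tau> * d x)"
          unfolding s2 using powr_rem_diff[OF p, of "a x" "\<tau> * d x" "\<tau> * k (j n) x"] by simp
        finally show ?case .
      qed
    qed
    moreover have "(\<integral>x. \<tau> * e * (\<rho> n x * v x - e * \<rho> n x) \<partial>lebesgue) = \<tau> * e * ((\<integral>x. \<rho> n x * v x \<partial>lebesgue) - e * (\<integral>x. \<rho> n x \<partial>lebesgue))"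
      using i1[of n] i2[of n] by simp
    moreover have "(\<integral>x. powr_rem p (a x) (\<tau> * k (j n) x) - powr_rem p (a x) (\<tau> * d x) \<partial>lebesgue)
        = (\<integral>x. powr_rem p (a x) (\<tau> * k (j n) x) \<partial>lebesgue) - (\<integral>x. powr_rem p (a x) (\<tau> * d x) \<partial>lebesgue)" using iP by simp
    moreover have "ray_energy p a d gd \<tau> \<le> ray_energy p a (k (j n)) (gk (j n)) \<tau>"
      using max t(3)[OF j[of n]] \<tau> unfolding \<tau>_def by (meson less_imp_le order_trans)
    moreover have "1 / 2 * \<tau>\<^sup>2 * (\<integral>x. (norm (gk (j n) x))\<^sup>2 \<partial>lebesgue) \<le> 1 / 2 * \<tau>\<^sup>2 * (A + 2 * (e * s) * I + e\<^sup>2 * B)"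
      using gle[of "j n"] by (intro mult_left_mono) (auto simp: e_def)
    ultimately have "\<tau> * e * ((\<integral>x. \<rho> n x * v x \<partial>lebesgue) - e * (\<integral>x. \<rho> n x \<partial>lebesgue))
        \<le> 1 / 2 * \<tau>\<^sup>2 * (A + 2 * (e * s) * I + e\<^sup>2 * B) - 1 / 2 * \<tau>\<^sup>2 * A"
      unfolding ray_energy_def A_def[symmetric] by linarith
    also have "\<dots> = \<tau> * e * (\<tau> * s * I + 1 / 2 * \<tau> * e * B)" by (simp add: algebra_simps power2_eq_square)
    finally show ?thesis using \<tau> e by (simp add: \<tau>_def e_def mult_le_cancel_left_pos)
  qed
  let ?\<rho> = "\<lambda>x. s * (opow p (a x + l * d x) - opow p (a x))"
  have lim1: "(\<lambda>n. \<integral>x. \<rho> n x * v x \<partial>lebesgue) \<longlonglongrightarrow> (\<integral>x. ?\<rho> x * v x \<partial>lebesgue)"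
  proof (rule integral_dominated_convergence[OF _ _ D1])
    show "AE x in lebesgue. norm (\<rho> n x * v x) \<le> 2 * (\<bar>?m x\<bar> powr p * \<bar>v x\<bar>)" for n
    proof (intro AE_I2)
      fix x
      have "\<bar>\<rho> n x\<bar> * \<bar>v x\<bar> \<le> (2 * \<bar>?m x\<bar> powr p) * \<bar>v x\<bar>" using \<rho>le by (intro mult_right_mono) auto
      then show "norm (\<rho> n x * v x) \<le> 2 * (\<bar>?m x\<bar> powr p * \<bar>v x\<bar>)" by (simp add: abs_mult mult.assoc)
    qed
    show "AE x in lebesgue. (\<lambda>n. \<rho> n x * v x) \<longlonglongrightarrow> ?\<rho> x * v x"
      by (intro AE_I2 tendsto_mult \<rho>lim tendsto_const)
  qed measurable
  have lim2: "(\<lambda>n. \<integral>x. \<rho> n x \<partial>lebesgue) \<longlonglongrightarrow> (\<integral>x. ?\<rho> x \<partial>lebesgue)"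
    by (rule integral_dominated_convergence[OF _ _ D2]) (use \<rho>lim \<rho>le2 in \<open>auto intro!: AE_I2\<close>)
  have "(\<integral>x. ?\<rho> x * v x \<partial>lebesgue) - 0 * (\<integral>x. ?\<rho> x \<partial>lebesgue) \<le> l * s * I + 1 / 2 * l * 0 * B"
  proof (rule tendsto_le)
    show "(\<lambda>n. (\<integral>x. \<rho> n x * v x \<partial>lebesgue) - \<epsilon> (j n) * (\<integral>x. \<rho> n x \<partial>lebesgue))
      \<longlonglongrightarrow> (\<integral>x. ?\<rho> x * v x \<partial>lebesgue) - 0 * (\<integral>x. ?\<rho> x \<partial>lebesgue)"
      by (intro tendsto_diff tendsto_mult lim1 lim2 \<epsilon>j)
    show "(\<lambda>n. t (j n) * s * I + 1 / 2 * t (j n) * \<epsilon> (j n) * B) \<longlonglongrightarrow> l * s * I + 1 / 2 * l * 0 * B"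
      by (intro tendsto_intros tl \<epsilon>j)
    have "\<forall>\<^sub>F n in sequentially. t (j n) > 0" using tl l1 by (intro order_tendstoD) auto
    then show "\<forall>\<^sub>F n in sequentially. (\<integral>x. \<rho> n x * v x \<partial>lebesgue) - \<epsilon> (j n) * (\<integral>x. \<rho> n x \<partial>lebesgue)
      \<le> t (j n) * s * I + 1 / 2 * t (j n) * \<epsilon> (j n) * B"
      by eventually_elim (rule key)
  qed simp
  then show ?thesis by (simp add: l1 I_def)
qed

lemma minimax_critical:
  assumes a: "sobolev0 U a ga" "(\<integral>x. \<bar>a x\<bar> powr (p + 1) \<partial>lebesgue) \<le> 1"
    and d: "sobolev0 U d gd" "\<not> (AE x in lebesgue. d x = 0)" "AE x in lebesgue. s * d x \<ge> 0"
    and s: "s = 1 \<or> s = - 1"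
    and cC: "c > 0" "C \<ge> 0" "\<And>x y. p * \<bar>x + y\<bar> powr (p - 1) * y\<^sup>2 - (opow p (x + y) - opow p x) * y
      \<ge> c * \<bar>y\<bar> powr (p + 1) - C * (\<bar>x\<bar> powr (p - 1) * y\<^sup>2)"
    and small: "2 * (p * 2 powr (p - 1)) * (1 + C / c) * S < 1"
    and max: "\<forall>t\<ge>0. ray_energy p a d gd t \<le> ray_energy p a d gd 1"
    and min: "\<forall>k gk t. sobolev0 U k gk \<longrightarrow> \<not> (AE x in lebesgue. k x = 0) \<longrightarrow> (AE x in lebesgue. s * k x \<ge> 0) \<longrightarrow>
      t \<ge> 0 \<longrightarrow> (\<forall>t'\<ge>0. ray_energy p a k gk t' \<le> ray_energy p a k gk t) \<longrightarrow>
      ray_energy p a d gd 1 \<le> ray_energy p a k gk t"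
    and v: "sobolev0 U v gv"
  shows "(\<integral>x. gd x \<bullet> gv x \<partial>lebesgue) = (\<integral>x. (opow p (a x + d x) - opow p (a x)) * v x \<partial>lebesgue)"
proof -
  note ineq = minimax_variational_inequality[OF a d s cC small max min]
  have v': "sobolev0 U (\<lambda>x. - v x) (\<lambda>x. - gv x)" using sobolev0_lincomb[OF v v, of "-1" 0] by simp
  have e: "(\<integral>x. s * (opow p (a x + d x) - opow p (a x)) * v x \<partial>lebesgue)
      = s * (\<integral>x. (opow p (a x + d x) - opow p (a x)) * v x \<partial>lebesgue)"
    by (subst integral_mult_right_zero[symmetric]) (simp add: mult.assoc)
  have "(\<integral>x. s * (opow p (a x + d x) - opow p (a x)) * v x \<partial>lebesgue) = s * (\<integral>x. gd x \<bullet> gv x \<partial>lebesgue)"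
    using ineq[OF v] ineq[OF v'] by simp
  then show ?thesis unfolding e using s by auto
qed

end

section \<open>From the minimax definitions to the Dirichlet problem\<close>

lemma AE_lebesgue_on:
  assumes "U \<in> sets lebesgue"
  shows "(AE x in lebesgue_on U. P x) \<longleftrightarrow> (AE x in lebesgue. x \<in> U \<longrightarrow> P x)"
  using assms by (subst AE_restrict_space_iff) auto

lemma energy_eq_energy0:
  fixes u :: "real^'n::finite \<Rightarrow> real"
  assumes u: "sobolev0 U u g" and "U \<subseteq> \<Omega>" "open \<Omega>"
  shows "energy \<Omega> w p u = energy0 (\<lambda>x. if x \<in> \<Omega> then w x else 0) p u g"
proof -
  have V: "\<Omega> \<in> sets lebesgue" using assms by auto
  have z: "u x = 0" if "x \<notin> \<Omega>" for x using assms that by (auto simp: sobolev0_def)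
  have e: "(\<lambda>x. if x \<in> \<Omega> then \<bar>u x\<bar> powr (p + 1) else 0) = (\<lambda>x. \<bar>u x\<bar> powr (p + 1))"
    "(\<lambda>x. if x \<in> \<Omega> then w x * u x else 0) = (\<lambda>x. (if x \<in> \<Omega> then w x else 0) * u x)"
    using z by auto
  show ?thesis
    unfolding energy_def energy0_def integral_weak_gradient_squared[OF assms] integral_lebesgue_on[OF V] e ..
qed

text \<open>With \<open>d = u - a\<close> the abstract minimax property becomes the hypotheses of
  \<open>minimax_critical\<close>. The equation obtained for \<open>d\<close> contains the
  difference of the nonlinearities at \<open>u\<close> and at \<open>a\<close>; adding the equation
  of \<open>a\<close> leaves that of \<open>u\<close>, with the term \<open>w\<close>.\<close>

lemma (in sobolev_domain) minimax_solution:
  assumes U: "open U" "U \<subseteq> \<Omega>" and \<Omega>: "open \<Omega>" and w: "w \<in> L2 \<Omega>" and s: "s = 1 \<or> s = - 1"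
    and cC: "c > 0" "C \<ge> 0" "\<And>x y. p * \<bar>x + y\<bar> powr (p - 1) * y\<^sup>2 - (opow p (x + y) - opow p x) * y
      \<ge> c * \<bar>y\<bar> powr (p + 1) - C * (\<bar>x\<bar> powr (p - 1) * y\<^sup>2)"
    and small: "2 * (p * 2 powr (p - 1)) * (1 + C / c) * S < 1"
    and a: "unique_small_minimizer \<Omega> w p U a" and u: "one_sided_minimax \<Omega> w p U s a u"
  shows "weak_dirichlet_solution U (\<lambda>x. \<bar>u x\<bar> powr (p - 1) * u x + w x) u"
proof -
  have Um: "U \<in> sets lebesgue" and \<Omega>m: "\<Omega> \<in> sets lebesgue" using U \<Omega> by auto
  define w' where "w' = (\<lambda>x. if x \<in> \<Omega> then w x else 0)"
  have w': "w' \<in> L2 UNIV" using w unfolding L2_zero_extension[OF \<Omega>m, of w] w'_def .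
  have E: "energy \<Omega> w p v = energy0 w' p v h" if "sobolev0 U v h" for v h
    using energy_eq_energy0[OF that U(2) \<Omega>] by (simp add: w'_def)
  have I: "(\<integral>x. \<bar>v x\<bar> powr (p + 1) \<partial>lebesgue_on U) = (\<integral>x. \<bar>v x\<bar> powr (p + 1) \<partial>lebesgue)" if "sobolev0 U v h" for v h
  proof -
    have "(\<lambda>x. if x \<in> U then \<bar>v x\<bar> powr (p + 1) else 0) = (\<lambda>x. \<bar>v x\<bar> powr (p + 1))"
      using that by (auto simp: sobolev0_def)
    then show ?thesis unfolding integral_lebesgue_on[OF Um] by simp
  qed
  have aS: "a \<in> small_functions p U" and amin: "\<And>v. v \<in> small_functions p U \<Longrightarrow> energy \<Omega> w p a \<le> energy \<Omega> w p v"
    using a unfolding unique_small_minimizer_def is_arg_min_def by (auto simp: not_less)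
  obtain ga where ga: "sobolev0 U a ga" using aS H10_iff_sobolev0[OF U(1)] by (auto simp: small_functions_def)
  have a1: "(\<integral>x. \<bar>a x\<bar> powr (p + 1) \<partial>lebesgue) < 1" using aS I[OF ga] by (simp add: small_functions_def)
  have crit: "(\<integral>x. ga x \<bullet> gk x \<partial>lebesgue) = (\<integral>x. opow p (a x) * k x \<partial>lebesgue) + (\<integral>x. w' x * k x \<partial>lebesgue)"
    if "sobolev0 U k gk" for k gk
  proof (rule small_minimizer_critical[OF w' ga a1 _ that])
    fix v h assume v: "sobolev0 U v h" and "(\<integral>x. \<bar>v x\<bar> powr (p + 1) \<partial>lebesgue) < 1"
    then have "v \<in> small_functions p U"
      using I[OF v] H10_iff_sobolev0[OF U(1)] by (auto simp: small_functions_def)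
    from amin[OF this] show "energy0 w' p a ga \<le> energy0 w' p v h" by (simp add: E[OF ga] E[OF v])
  qed
  have ray: "energy \<Omega> w p (\<lambda>x. a x + t * k x) = energy0 w' p a ga + ray_energy p a k gk t" if k: "sobolev0 U k gk" for k gk t
  proof -
    have "sobolev0 U (\<lambda>x. a x + t * k x) (\<lambda>x. ga x + t *\<^sub>R gk x)" using sobolev0_lincomb[OF ga k, of 1 t] by simp
    from E[OF this] show ?thesis unfolding energy0_expand[OF w' ga k] crit[OF k] by simp
  qed
  \<comment> \<open>\<open>GREATEST\<close> has the intended meaning only when the maximum is
    attained, so the value of \<open>ray_max\<close> is tied to an explicit maximum point
    \<open>t\<close>.\<close>
  have raymax: "ray_max \<Omega> w p a v = energy0 w' p a ga + ray_energy p a k gk t"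
    if k: "sobolev0 U k gk" and v: "\<And>x. v x - a x = k x" and t: "t \<ge> 0" "\<And>t'. t' \<ge> 0 \<Longrightarrow> ray_energy p a k gk t' \<le> ray_energy p a k gk t"
    for k gk v t
    unfolding ray_max_def v by (rule Greatest_equality) (use t in \<open>auto simp: ray[OF k]\<close>)
  have uS: "u \<in> one_sided U s a" and umin: "\<And>v. v \<in> one_sided U s a \<Longrightarrow> ray_max \<Omega> w p a u \<le> ray_max \<Omega> w p a v"
    and uE: "energy \<Omega> w p u = ray_max \<Omega> w p a u"
    using u unfolding one_sided_minimax_def is_arg_min_def by (auto simp: not_less)
  have uH: "u \<in> H10 U" using uS by (simp add: one_sided_def)
  then obtain gu where gu: "sobolev0 U u gu" using H10_iff_sobolev0[OF U(1)] by blast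
  define d gd where "d = (\<lambda>x. u x - a x)" and "gd = (\<lambda>x. gu x - ga x)"
  have d: "sobolev0 U d gd" using sobolev0_lincomb[OF gu ga, of 1 "-1"] by (simp add: d_def gd_def)
  have dz: "d x = 0" if "x \<notin> U" for x using d that by (auto simp: sobolev0_def)
  have dn: "\<not> (AE x in lebesgue. d x = 0)"
  proof
    assume "AE x in lebesgue. d x = 0"
    then have "AE x in lebesgue_on U. u x = a x" unfolding AE_lebesgue_on[OF Um] by eventually_elim (simp add: d_def)
    then show False using uS by (simp add: one_sided_def)
  qed
  have ds: "AE x in lebesgue. s * d x \<ge> 0"
  proof -
    have "AE x in lebesgue_on U. s * (u x - a x) \<ge> 0" using uS by (simp add: one_sided_def)
    then show ?thesis unfolding AE_lebesgue_on[OF Um]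
    proof eventually_elim
      case (elim x)
      then show ?case using dz[of x] by (cases "x \<in> U") (auto simp: d_def)
    qed
  qed
  have dP: "d \<in> Lpow p" by (rule sobolev_Lpow[OF d])
  have aP: "a \<in> Lpow p" by (rule sobolev_Lpow[OF ga])
  have u_eq: "energy \<Omega> w p u = energy0 w' p a ga + ray_energy p a d gd 1" using ray[OF d, of 1] by (simp add: d_def)
  \<comment> \<open>Existence of a maximum point is established first; only then does the equality
    of the energy of \<open>u\<close> with \<open>ray_max\<close> say that \<open>t = 1\<close> is
    maximal.\<close>
  have max: "\<forall>t\<ge>0. ray_energy p a d gd t \<le> ray_energy p a d gd 1"
  proof -
    obtain t where t: "t \<ge> 0" "\<And>t'. t' \<ge> 0 \<Longrightarrow> ray_energy p a d gd t' \<le> ray_energy p a d gd t"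
      using ray_energy_attains_max[OF aP less_imp_le[OF a1] dP Lpow_integral_pos[OF dP dn]] by blast
    have "ray_max \<Omega> w p a u = energy0 w' p a ga + ray_energy p a d gd t" by (rule raymax[OF d _ t]) (simp add: d_def)
    with uE u_eq t show ?thesis by simp
  qed
  have min: "\<forall>k gk t. sobolev0 U k gk \<longrightarrow> \<not> (AE x in lebesgue. k x = 0) \<longrightarrow> (AE x in lebesgue. s * k x \<ge> 0) \<longrightarrow>
      t \<ge> 0 \<longrightarrow> (\<forall>t'\<ge>0. ray_energy p a k gk t' \<le> ray_energy p a k gk t) \<longrightarrow>
      ray_energy p a d gd 1 \<le> ray_energy p a k gk t"
  proof (intro allI impI)
    fix k gk t assume k: "sobolev0 U k gk" and kn: "\<not> (AE x in lebesgue. k x = 0)" and ks: "AE x in lebesgue. s * k x \<ge> 0"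
      and t: "t \<ge> 0" "\<forall>t'\<ge>0. ray_energy p a k gk t' \<le> ray_energy p a k gk t"
    let ?v = "\<lambda>x. a x + k x"
    have kz: "k x = 0" if "x \<notin> U" for x using k that by (auto simp: sobolev0_def)
    have "?v \<in> H10 U" using sobolev0_lincomb[OF ga k, of 1 1] H10_iff_sobolev0[OF U(1)] by auto
    moreover have "\<not> (AE x in lebesgue_on U. ?v x = a x)"
    proof
      assume "AE x in lebesgue_on U. ?v x = a x"
      then have "AE x in lebesgue. k x = 0" unfolding AE_lebesgue_on[OF Um] by eventually_elim (use kz in auto)
      with kn show False by blast
    qed
    moreover have "AE x in lebesgue_on U. s * (?v x - a x) \<ge> 0"
      unfolding AE_lebesgue_on[OF Um] using ks by eventually_elim simp
    ultimately have "?v \<in> one_sided U s a" by (simp add: one_sided_def)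
    from umin[OF this] have "energy \<Omega> w p u \<le> ray_max \<Omega> w p a ?v" by (simp add: uE)
    also have "\<dots> = energy0 w' p a ga + ray_energy p a k gk t" by (rule raymax[OF k]) (use t in auto)
    finally show "ray_energy p a d gd 1 \<le> ray_energy p a k gk t" by (simp add: u_eq)
  qed
  show ?thesis
    unfolding weak_dirichlet_solution_def
  proof (intro conjI ballI uH)
    fix v assume "v \<in> H10 U"
    then obtain gv where v: "sobolev0 U v gv" using H10_iff_sobolev0[OF U(1)] by blast
    have vz: "v x = 0" if "x \<notin> U" for x using v that by (auto simp: sobolev0_def)
    have vP: "v \<in> Lpow p" by (rule sobolev_Lpow[OF v])
    have uP: "u \<in> Lpow p" by (rule sobolev_Lpow[OF gu])
    have L: "ga \<in> L2 UNIV" "gd \<in> L2 UNIV" "gv \<in> L2 UNIV" "v \<in> L2 UNIV" using ga d v by (auto simp: sobolev0_def)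
    have f: "(\<lambda>x. if x \<in> U then (\<bar>u x\<bar> powr (p - 1) * u x + w x) * v x else 0) = (\<lambda>x. opow p (u x) * v x + w' x * v x)"
      using vz U(2) by (auto simp: opow_def w'_def algebra_simps fun_eq_iff)
    have i: "integrable lebesgue (\<lambda>x. opow p (u x) * v x)" "integrable lebesgue (\<lambda>x. w' x * v x)"
      "integrable lebesgue (\<lambda>x. opow p (a x) * v x)"
      using integrable_opow_mult[OF uP vP p] L2_inner[OF w' L(4)] integrable_opow_mult[OF aP vP p] by simp_all
    show "integrable (lebesgue_on U) (\<lambda>x. (\<bar>u x\<bar> powr (p - 1) * u x + w x) * v x)"
      unfolding integrable_lebesgue_on_iff[OF Um] f using i by simp
    have "(\<integral>x. weak_gradient U u x \<bullet> weak_gradient U v x \<partial>lebesgue_on U) = (\<integral>x. gu x \<bullet> gv x \<partial>lebesgue)"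
      by (rule integral_weak_gradient_inner[OF gu v U(1)])
    also have "\<dots> = (\<integral>x. ga x \<bullet> gv x + gd x \<bullet> gv x \<partial>lebesgue)" by (simp add: gd_def inner_diff_left)
    also have "\<dots> = (\<integral>x. ga x \<bullet> gv x \<partial>lebesgue) + (\<integral>x. gd x \<bullet> gv x \<partial>lebesgue)"
      using L2_inner[OF L(1,3)] L2_inner[OF L(2,3)] by simp
    also have "(\<integral>x. gd x \<bullet> gv x \<partial>lebesgue) = (\<integral>x. (opow p (a x + d x) - opow p (a x)) * v x \<partial>lebesgue)"
      by (rule minimax_critical[OF ga less_imp_le[OF a1] d dn ds s cC small max min v])
    also have "\<dots> = (\<integral>x. opow p (u x) * v x \<partial>lebesgue) - (\<integral>x. opow p (a x) * v x \<partial>lebesgue)"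
      using i by (simp add: d_def left_diff_distrib)
    also have "(\<integral>x. ga x \<bullet> gv x \<partial>lebesgue) = (\<integral>x. opow p (a x) * v x \<partial>lebesgue) + (\<integral>x. w' x * v x \<partial>lebesgue)"
      by (rule crit[OF v])
    finally show "(\<integral>x. weak_gradient U u x \<bullet> weak_gradient U v x \<partial>lebesgue_on U)
        = (\<integral>x. (\<bar>u x\<bar> powr (p - 1) * u x + w x) * v x \<partial>lebesgue_on U)"
      unfolding integral_lebesgue_on[OF Um] f using i by simp
  qed
qed

section \<open>Images of small cubes\<close>

text \<open>A frontier point in \<open>U\<close> could be moved across the graph to a nearby point
  of \<open>U\<close> outside the closure of the domain. That the domain lies on one side of the
  graph is decisive: for a punctured ball the conclusion fails.\<close>

lemma open_subset_smooth_domain: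
  assumes \<Omega>: "open \<Omega>" "smooth_boundary \<Omega>" and U: "open U" "U \<subseteq> closure \<Omega>"
  shows "U \<subseteq> \<Omega>"
proof
  fix x\<^sub>0 assume x0: "x\<^sub>0 \<in> U"
  show "x\<^sub>0 \<in> \<Omega>"
  proof (rule ccontr)
    assume nin: "x\<^sub>0 \<notin> \<Omega>"
    with x0 U(2) \<Omega>(1) have "x\<^sub>0 \<in> frontier \<Omega>" by (auto simp: frontier_def interior_open)
    then obtain r i s \<gamma> where r: "r > 0" "s \<in> {-1, 1::real}" "smooth \<gamma>"
      and \<gamma>: "\<forall>x y. (\<forall>j. j \<noteq> i \<longrightarrow> x $ j = y $ j) \<longrightarrow> \<gamma> x = \<gamma> y"
      and eq: "\<Omega> \<inter> ball x\<^sub>0 r = {x \<in> ball x\<^sub>0 r. s * x $ i > \<gamma> x}"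
      by (elim bspec[OF \<Omega>(2)[unfolded smooth_boundary_def], elim_format] exE conjE bexE)
    have "x\<^sub>0 \<notin> {x \<in> ball x\<^sub>0 r. s * x $ i > \<gamma> x}" unfolding eq[symmetric] using nin by simp
    then have le: "s * x\<^sub>0 $ i \<le> \<gamma> x\<^sub>0" using r(1) by simp
    \<comment> \<open>Moving against the \<open>i\<close>-th direction decreases
      \<open>s * x $ i\<close> by \<open>\<eta>\<close> and leaves \<open>\<gamma>\<close>
      unchanged, since \<open>\<gamma>\<close> does not depend on that coordinate.\<close>
    define y where "y = (\<lambda>\<eta>::real. x\<^sub>0 - (\<eta> * s) *\<^sub>R axis i 1)"
    have "open (U \<inter> ball x\<^sub>0 r)" "x\<^sub>0 \<in> U \<inter> ball x\<^sub>0 r" using U x0 r by auto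
    then obtain e where e: "e > 0" "ball x\<^sub>0 e \<subseteq> U \<inter> ball x\<^sub>0 r" by (meson openE)
    have ye: "y (e/2) \<in> ball x\<^sub>0 e" using e r(2) by (auto simp: y_def dist_norm norm_axis_1)
    have "\<gamma> (y (e/2)) = \<gamma> x\<^sub>0" by (rule \<gamma>[rule_format]) (auto simp: y_def axis_def)
    moreover have "s * y (e/2) $ i = s * x\<^sub>0 $ i - e / 2" using r(2) by (auto simp: y_def axis_def algebra_simps)
    ultimately have lt: "s * y (e/2) $ i < \<gamma> (y (e/2))" using le e by simp
    define V where "V = {x. s * x $ i < \<gamma> x} \<inter> ball x\<^sub>0 e"
    have "open V" unfolding V_def using smooth_continuous[OF r(3)]
      by (intro open_Int open_ball open_Collect_less) (auto intro!: continuous_intros)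
    moreover have yV: "y (e/2) \<in> V" using lt ye by (simp add: V_def)
    moreover have "V \<inter> \<Omega> = {}"
    proof -
      have "x \<notin> \<Omega>" if "x \<in> V" for x
      proof
        assume "x \<in> \<Omega>"
        moreover have "x \<in> ball x\<^sub>0 r" "s * x $ i < \<gamma> x" using that e by (auto simp: V_def)
        ultimately have "x \<in> {x \<in> ball x\<^sub>0 r. s * x $ i > \<gamma> x}" using eq by blast
        then show False using \<open>s * x $ i < \<gamma> x\<close> by simp
      qed
      then show ?thesis by blast
    qed
    moreover have "y (e/2) \<in> closure \<Omega>" using ye e U(2) by blast
    ultimately show False using open_Int_closure_eq_empty[of V \<Omega>] by auto
  qed
qed

lemma open_scaled_cube:
  assumes "k \<ge> 1"
  shows "open (scaled_cube k z :: (real^'n::finite) set)"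
proof -
  have "{x::real^'n. \<forall>i. 0 < x $ i \<and> x $ i < 1} = box (\<chi> i. 0) (\<chi> i. 1)" by (auto simp: mem_box_cart)
  then have "open {x::real^'n. \<forall>i. 0 < x $ i \<and> x $ i < 1}" by (simp only: open_box)
  then have "open (cube z :: (real^'n) set)" unfolding cube_def by (rule open_translation)
  then show ?thesis unfolding scaled_cube_def using assms by (intro open_scaling) auto
qed

lemma scaled_cube_dist:
  fixes x y :: "real^'n::finite"
  assumes "x \<in> scaled_cube k z" "y \<in> scaled_cube k z" "k \<ge> 1"
  shows "norm (x - y) \<le> real CARD('n) / real k"
proof -
  have c: "\<bar>(x - y) $ i\<bar> \<le> 1 / real k" for i
  proof -
    obtain x' y' :: "real^'n" where "x = (1 / real k) *\<^sub>R ((\<chi> i. of_int (z $ i)) + x')" "y = (1 / real k) *\<^sub>R ((\<chi> i. of_int (z $ i)) + y')"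
      and b: "0 < x' $ i" "x' $ i < 1" "0 < y' $ i" "y' $ i < 1"
      using assms by (auto simp: scaled_cube_def cube_def)
    then have "(x - y) $ i = (x' $ i - y' $ i) / real k" by (simp add: field_simps diff_divide_distrib)
    also have "\<bar>\<dots>\<bar> \<le> 1 / real k" using b by (auto simp: abs_divide intro!: divide_right_mono)
    finally show ?thesis .
  qed
  have "norm (x - y) \<le> (\<Sum>i\<in>UNIV. \<bar>(x - y) $ i\<bar>)" by (rule norm_le_l1_cart)
  also have "\<dots> \<le> (\<Sum>i\<in>(UNIV::'n set). 1 / real k)" by (intro sum_mono c)
  finally show ?thesis by simp
qed

text \<open>Invariance of domain: the lower Lipschitz bound gives injectivity, the upper one
  continuity.\<close>

lemma bilipschitz_image_open:
  fixes T :: "real^'n::finite \<Rightarrow> real^'n"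
  assumes T: "T \<in> bilipschitz_maps L P Q" and A: "open A" "A \<subseteq> P" and L: "L \<ge> 1"
  shows "open (T ` A)"
proof (rule invariance_of_domain_gen)
  have b: "1 / L * norm (x - y) \<le> norm (T x - T y)" "norm (T x - T y) \<le> L * norm (x - y)" if "x \<in> A" "y \<in> A" for x y
    using T A(2) that by (auto simp: bilipschitz_maps_def)
  show "continuous_on A T"
    using L b by (intro lipschitz_on_continuous_on[of L] lipschitz_onI) (auto simp: dist_norm)
  show "inj_on T A"
  proof (rule inj_onI)
    fix x y assume "x \<in> A" "y \<in> A" "T x = T y"
    then have "1 / L * norm (x - y) \<le> 0" using b(1)[of x y] by simp
    then show "x = y" using L by (simp add: divide_le_0_iff)
  qed
qed (use A in auto)

text \<open>Clearing denominators, the claim is \<open>n (p - 1) < 2 (p + 1)\<close>. For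
  \<open>n \<ge> 3\<close> this is the growth hypothesis, and for \<open>n \<le> 2\<close> it holds
  for every \<open>p > 1\<close>.\<close>

lemma subcritical_exponent:
  assumes "p > 1" and "n \<ge> 1" and "n \<ge> 3 \<Longrightarrow> p < (real n + 2) / (real n - 2)"
  shows "real n * (1/2 - 1/(p + 1)) < 1"
proof -
  have "real n * (p - 1) < 2 * (p + 1)"
  proof (cases "n \<ge> 3")
    case True
    then have "p * (real n - 2) < real n + 2" using assms(3) by (simp add: pos_less_divide_eq)
    then show ?thesis by (simp add: algebra_simps)
  next
    case False
    then have "real n * (p - 1) \<le> 2 * (p - 1)" using assms by (intro mult_right_mono) auto
    then show ?thesis by simp
  qed
  moreover have "real n * (1/2 - 1/(p + 1)) = real n * (p - 1) / (2 * (p + 1))" using assms by (simp add: field_simps)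
  ultimately show ?thesis using assms by (simp add: pos_divide_less_eq)
qed

theorem proposition2p4:
  fixes \<Omega> :: "(real^'n) set" and w :: "real^'n \<Rightarrow> real" and p L :: real
    and k\<^sub>\<Omega> k\<^sub>L :: nat
    and ut u :: "nat \<Rightarrow> int^'n \<Rightarrow> (real^'n \<Rightarrow> real^'n) \<Rightarrow> real^'n \<Rightarrow> real"
  assumes "smooth_bounded_domain \<Omega>"
    and "w \<in> L2 \<Omega>"
    and "p > 1"
    and "CARD('n) \<ge> 3 \<Longrightarrow> p < (real CARD('n) + 2) / (real CARD('n) - 2)"
    and "L \<ge> 1"
    and "k\<^sub>\<Omega> \<ge> 1" and "\<And>k. k \<ge> k\<^sub>\<Omega> \<Longrightarrow> cube_indices \<Omega> k \<noteq> {}"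
    and "k\<^sub>L \<ge> k\<^sub>\<Omega>"
    and "\<And>k z T. k \<ge> k\<^sub>L \<Longrightarrow> z \<in> cube_indices \<Omega> k \<Longrightarrow>
           T \<in> bilipschitz_maps L (cube_union \<Omega> k) (closure \<Omega>) \<Longrightarrow>
           unique_small_minimizer \<Omega> w p (T ` scaled_cube k z) (ut k z T)"
    and "\<And>k z T. k \<ge> k\<^sub>L \<Longrightarrow> z \<in> cube_indices \<Omega> k \<Longrightarrow>
           T \<in> bilipschitz_maps L (cube_union \<Omega> k) (closure \<Omega>) \<Longrightarrow>
           one_sided_minimax \<Omega> w p (T ` scaled_cube k z) (cube_sign z) (ut k z T) (u k z T)"
  shows "\<exists>k\<^sub>1 \<ge> k\<^sub>L. \<forall>k \<ge> k\<^sub>1. \<forall>z \<in> cube_indices \<Omega> k.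
           \<forall>T \<in> bilipschitz_maps L (cube_union \<Omega> k) (closure \<Omega>).
             weak_dirichlet_solution (T ` scaled_cube k z)
               (\<lambda>x. \<bar>u k z T x\<bar> powr (p - 1) * u k z T x + w x) (u k z T)"
proof -
  have \<Omega>: "open \<Omega>" "bounded \<Omega>" "smooth_boundary \<Omega>" using assms(1) by (auto simp: smooth_bounded_domain_def)
  note p = \<open>p > 1\<close> and L = \<open>L \<ge> 1\<close>
  let ?n = "real CARD('n)"
  define \<alpha> where "\<alpha> = ?n * (1/2 - 1/(p + 1))"
  have \<alpha>: "\<alpha> < 1" unfolding \<alpha>_def using assms(4) p by (intro subcritical_exponent) (auto simp: Suc_le_eq)
  obtain c C where cC: "c > 0" "C \<ge> 0" "\<And>x y. p * \<bar>x + y\<bar> powr (p - 1) * y\<^sup>2 - (opow p (x + y) - opow p x) * y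
      \<ge> c * \<bar>y\<bar> powr (p + 1) - C * (\<bar>x\<bar> powr (p - 1) * y\<^sup>2)"
    using opow_second_order[OF p] by blast
  \<comment> \<open>The inequality \<open>\<kappa> * S R < 1\<close> is the hypothesis
    \<open>small\<close> of \<open>minimax_solution\<close>, and \<open>S R\<close> is the constant
    of \<open>Sobolev_inequality\<close> for \<open>q = p + 1\<close>. It tends to \<open>0\<close>
    with \<open>R\<close> because the exponent \<open>1 - \<alpha>\<close> is positive.\<close>
  define \<kappa> where "\<kappa> = 2 * (p * 2 powr (p - 1)) * (1 + C / c)"
  define S where "S = (\<lambda>R. (2 * ?n * (R powr (1 - \<alpha>) / (1 - \<alpha>)))\<^sup>2)"
  have "((\<lambda>R. \<kappa> * S R) \<longlongrightarrow> \<kappa> * (2 * ?n * (0 powr (1 - \<alpha>) / (1 - \<alpha>)))\<^sup>2) (at_right 0)"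
    unfolding S_def using \<alpha>
    by (intro tendsto_intros tendsto_powr') (auto intro: eventually_mono[OF eventually_at_right_less])
  then have "\<forall>\<^sub>F R in at_right 0. \<kappa> * S R < 1" by (rule order_tendstoD) simp
  then have "\<forall>\<^sub>F R in at_right 0. \<kappa> * S R < 1 \<and> R > 0" using eventually_at_right_less by (rule eventually_conj)
  then obtain R where R: "\<kappa> * S R < 1" "R > 0"
    using eventually_happens trivial_limit_at_right_real by blast
  \<comment> \<open>Two points of a cube of side \<open>1 / k\<close> are at distance at most
    \<open>n / k\<close>, so for \<open>k \<ge> N\<close> the points of its image under
    \<open>T\<close> are less than \<open>R\<close> apart.\<close>
  obtain N :: nat where N: "L * ?n / R < real N" using reals_Archimedean2 by blast
  show ?thesis
  proof (intro exI[of _ "max k\<^sub>L N"] conjI allI impI ballI)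
    fix k z T assume k: "max k\<^sub>L N \<le> k" and z: "z \<in> cube_indices \<Omega> k"
      and T: "T \<in> bilipschitz_maps L (cube_union \<Omega> k) (closure \<Omega>)"
    let ?U = "T ` scaled_cube k z"
    have k1: "k \<ge> 1" "k \<ge> k\<^sub>L" "k \<ge> N" using k assms(6,8) by auto
    have sub: "scaled_cube k z \<subseteq> cube_union \<Omega> k"
      using z closure_subset[of "cube z :: (real^'n) set"] unfolding cube_union_def scaled_cube_def by blast
    have U: "open ?U" by (rule bilipschitz_image_open[OF T open_scaled_cube[OF k1(1)] sub L])
    have "?U \<subseteq> closure \<Omega>" using T sub by (auto simp: bilipschitz_maps_def)
    then have U\<Omega>: "?U \<subseteq> \<Omega>" by (rule open_subset_smooth_domain[OF \<Omega>(1,3) U])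
    have diam: "dist x y < R" if xy: "x \<in> ?U" "y \<in> ?U" for x y
    proof -
      obtain x' y' where x': "x = T x'" "y = T y'" "x' \<in> scaled_cube k z" "y' \<in> scaled_cube k z" using xy by blast
      have "norm (T x' - T y') \<le> L * norm (x' - y')" using T sub x' by (auto simp: bilipschitz_maps_def)
      also have "\<dots> \<le> L * (?n / real k)" using L x' k1 by (intro mult_left_mono scaled_cube_dist) auto
      also have "\<dots> < R"
      proof -
        have "L * ?n / R < real k" using N k1(3) by linarith
        then show ?thesis using R(2) k1(1) by (simp add: field_simps)
      qed
      finally show ?thesis by (simp add: x' dist_norm)
    qed
    have q: "p + 1 > 2" using p by simp
    interpret sobolev_domain ?U p "S R"
    proof
      show "?U \<in> lmeasurable" using U bounded_subset[OF \<Omega>(2) U\<Omega>] by (intro lmeasurable_open)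
      show "S R > 0" using R(2) \<alpha> by (simp add: S_def)
      fix v g assume v: "sobolev0 ?U v g"
      note sob = Sobolev_inequality[OF v R(2) diam q \<alpha>[unfolded \<alpha>_def]]
      show "v \<in> Lpow p" using sob(1) v by (auto simp: Lpow_def sobolev0_def L2_UNIV)
      show "(\<integral>x. \<bar>v x\<bar> powr (p + 1) \<partial>lebesgue) \<le> (S R * (\<integral>x. (norm (g x))\<^sup>2 \<partial>lebesgue)) powr ((p + 1) / 2)"
        using sob(2) by (simp add: S_def \<alpha>_def)
    qed (rule p)
    have "\<bar>cube_sign z\<bar> = 1" by (simp add: cube_sign_def power_int_abs)
    then have s: "cube_sign z = 1 \<or> cube_sign z = - 1" by linarith
    show "weak_dirichlet_solution ?U (\<lambda>x. \<bar>u k z T x\<bar> powr (p - 1) * u k z T x + w x) (u k z T)"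
      using minimax_solution[OF U U\<Omega> \<Omega>(1) assms(2) s cC R(1)[unfolded \<kappa>_def]
          assms(9)[OF k1(2) z T] assms(10)[OF k1(2) z T]] .
  qed simp
qed

end
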